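(* Let $D$ and $D'$ be basic subsets of $\Phi$, and let $\phi\colon D\to\mathbb{F}_q^\times$ and $\phi'\colon D'\to\mathbb{F}_q^\times$ be maps. Then $\langle\xi_{D,\phi},\xi_{D',\phi'}\rangle\neq 0$ if and only if $(D,\phi)=(D',\phi')$.
   Context: Let $p\ge 3$ be a prime, $q=p^e$ ($e\ge 1$), $\mathbb{F}_q$ the field with $q$ elements, and $n\ge 1$. Let $G$ be one of $Sp_{2n}(q)$ (symplectic case), $O_{2n}(q)$ (even orthogonal case), $O_{2n+1}(q)$ (odd orthogonal case); put $m=2n$ in the first two cases and $m=2n+1$ in the third. Let $U_m(q)$ be the group of unipotent upper-triangular $m\times m$ matrices over $\mathbb{F}_q$, and $U=G\cap U_m(q)$, a Sylow $p$-subgroup of $G$. Explicitly, with $J$ the $n\times n$ matrix with 1's on the anti-diagonal and 0's elsewhere, $U$ consists of all block matrices $\begin{pmatrix} x & xu & xz \\ 0 & I_r & -u^TJ \\ 0 & 0 & Jx^{-T}J\end{pmatrix}$ with $x\in U_n(q)$, $u$ an $n\times r$ matrix and $z$ an $n\times n$ matrix over $\mathbb{F}_q$, where: $r=0$ and $Jz^T-zJ=0$ in the symplectic case; $r=0$ and $Jz^T+zJ=0$ in the even orthogonal case; $r=1$ and $Jz^T+zJ=-uu^T$ in the odd orthogonal case. Rows and columns of $m\times m$ matrices are indexed, in order, by $1,\dots,n,-n,\dots,-1$ if $m=2n$ and by $1,\dots,n,0,-n,\dots,-1$ if $m=2n+1$; this order is denoted $\prec$, so $1\prec\cdots\prec n\prec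 0\prec -n\prec\cdots\prec -1$. Roots: $\Phi=\{\varepsilon_i\pm\varepsilon_j:1\le i<j\le n\}\cup\Phi'$, with $\Phi'=\{2\varepsilon_i:1\le i\le n\}$ (symplectic), $\Phi'=\emptyset$ (even orthogonal), $\Phi'=\{\varepsilon_i:1\le i\le n\}$ (odd orthogonal), where $\varepsilon_1,\dots,\varepsilon_n$ are the coordinate functions on the diagonal torus. Entries: for $i<j$, $\mathcal{E}(\varepsilon_i-\varepsilon_j)=\{(i,j),(-j,-i)\}$, $\mathcal{E}(\varepsilon_i+\varepsilon_j)=\{(i,-j),(j,-i)\}$; $\mathcal{E}(2\varepsilon_i)=\{(i,-i)\}$ (symplectic); $\mathcal{E}(\varepsilon_i)=\{(i,0),(0,-i)\}$ (odd orthogonal). For $\Psi\subseteq\Phi$, $\mathcal{E}(\Psi)=\bigcup_{\alpha\in\Psi}\mathcal{E}(\alpha)$, and $\mathcal{E}=\mathcal{E}(\Phi)$. For each $\alpha\in\Phi$ there is exactly one $(i,j)\in\mathcal{E}(\alpha)$ with $1\le i\le n$ and $i\prec j\preceq -i$. A subset of $\mathcal{E}$ is basic if it contains at most one entry from each row and at most one entry from each column; $D\subseteq\Phi$ is a basic subset if $\mathcal{E}(D)$ is basic. Supercharacters: for $i<j$, $U_{\varepsilon_i-\varepsilon_j}=\{x\in U: x_{i,k}=0,\ i<k<j\}$; $U_{\varepsilon_i+\varepsilon_j}=\{x\in U:x_{i,k}=x_{j,l}=0,\ i<k\le n,\ j\prec l\preceq 0\}$; and for $\alpha=2\varepsilon_i$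 (symplectic) or $\alpha=\varepsilon_i$ (odd orthogonal), $U_\alpha=\{x\in U:x_{i,k}=0,\ i<k\le n\}$. Fix a nontrivial linear character $\vartheta\colon\mathbb{F}_q^+\to\mathbb{C}^\times$. For $\alpha\in\Phi$, $r\in\mathbb{F}_q^\times$, $\lambda_{\alpha,r}(x)=\vartheta(rx_{i,j})$ (with $(i,j)$ the distinguished entry of $\mathcal{E}(\alpha)$ above) is a linear character of $U_\alpha$, and the elementary character is the induced character $\xi_{\alpha,r}=(\lambda_{\alpha,r})^U$. For a basic subset $D\subseteq\Phi$ and a map $\phi\colon D\to\mathbb{F}_q^\times$, the supercharacter is $\xi_{D,\phi}=\prod_{\alpha\in D}\xi_{\alpha,\phi(\alpha)}$ (the trivial character $1_U$ if $D=\emptyset$). $\langle\cdot,\cdot\rangle$ is the usual scalar product of class functions on $U$. *)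

theory Defs
  imports "HOL-Library.FuncSet" "HOL-Library.Cardinality" "HOL-Computational_Algebra.Primes"
    "HOL-Algebra.Group" "Jordan_Normal_Form.Determinant"
begin

section \<open>The classical groups and their unipotent upper-triangular subgroups\<close>

datatype ctype = Symplectic | EvenOrthogonal | OddOrthogonal

text \<open>\<open>mid t\<close> is the size of the middle block (written \<open>r\<close> in the block
  description of \<open>U\<close>), \<open>msize t n\<close> is the size \<open>m\<close> of the matrices.\<close>

definition mid :: "ctype \<Rightarrow> nat" where
  "mid t = (if t = OddOrthogonal then 1 else 0)"

definition msize :: "ctype \<Rightarrow> nat \<Rightarrow> nat" where
  "msize t n = n + mid t + n"

definition antidiag :: "nat \<Rightarrow> 'a::{zero,one} mat" where
  "antidiag n = mat n n (\<lambda>(i, j). if i + j + 1 = n then 1 else 0)"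

text \<open>The defining bilinear form: the anti-diagonal form, with the sign \<open>-1\<close> in the lower half in
  the symplectic case. This is the form for which \<open>U\<close> is the group of block matrices displayed in
  \<open>unip_iff_blocks\<close> below. In odd characteristic the isometries of a symmetric bilinear form and of
  the associated quadratic form coincide.\<close>

definition form_mat :: "ctype \<Rightarrow> nat \<Rightarrow> 'a::field mat" where
  "form_mat t n = mat (msize t n) (msize t n)
     (\<lambda>(i, j). if i + j + 1 = msize t n then (if t = Symplectic \<and> n \<le> i then -1 else 1) else 0)"

definition classical_group :: "ctype \<Rightarrow> nat \<Rightarrow> 'a::field mat set" where
  "classical_group t n =
     {A \<in> carrier_mat (msize t n) (msize t n).
        transpose_mat A * form_mat t n * A = form_mat t n}"

definition unitriangular :: "nat \<Rightarrow> 'a::field mat set" where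
  "unitriangular m = {A \<in> carrier_mat m m. upper_triangular A \<and> (\<forall>i<m. A $$ (i, i) = 1)}"

definition unip :: "ctype \<Rightarrow> nat \<Rightarrow> 'a::field mat set" where
  "unip t n = classical_group t n \<inter> unitriangular (msize t n)"

definition unip_group :: "ctype \<Rightarrow> nat \<Rightarrow> 'a::field mat monoid" where
  "unip_group t n = \<lparr>carrier = unip t n, mult = (*), one = 1\<^sub>m (msize t n)\<rparr>"


section \<open>Signed labels, roots and basic subsets\<close>

text \<open>Rows and columns are labelled by the integers \<open>1, \<dots>, n, (0,) -n, \<dots>, -1\<close>, in this order
  (\<open>0\<close> occurs only in the odd orthogonal case), whereas library matrices are indexed from \<open>0\<close>.\<close>

definition labels :: "ctype \<Rightarrow> nat \<Rightarrow> int set" where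
  "labels t n = {1..int n} \<union> (if t = OddOrthogonal then {0} else {}) \<union> {- int n..-1}"

definition prec :: "int \<Rightarrow> int \<Rightarrow> bool" (infix \<open>\<prec>\<close> 50) where
  "a \<prec> b \<longleftrightarrow> (0 < a \<and> (b \<le> 0 \<or> a < b)) \<or> (a = 0 \<and> b < 0) \<or> (a < 0 \<and> b < 0 \<and> a < b)"

definition preceq :: "int \<Rightarrow> int \<Rightarrow> bool" (infix \<open>\<preceq>\<close> 50) where
  "a \<preceq> b \<longleftrightarrow> a \<prec> b \<or> a = b"

definition pos :: "ctype \<Rightarrow> nat \<Rightarrow> int \<Rightarrow> nat" where
  "pos t n l = (if 0 < l then nat l - 1 else if l = 0 then n else nat (int (msize t n) + l))"

definition entry :: "ctype \<Rightarrow> nat \<Rightarrow> 'a mat \<Rightarrow> int \<Rightarrow> int \<Rightarrow> 'a" where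
  "entry t n x i j = x $$ (pos t n i, pos t n j)"

text \<open>\<open>Minus i j\<close>, \<open>Plus i j\<close>, \<open>Long i\<close>, \<open>Short i\<close> stand for \<open>\<epsilon>\<^sub>i - \<epsilon>\<^sub>j\<close>, \<open>\<epsilon>\<^sub>i + \<epsilon>\<^sub>j\<close>,
  \<open>2\<epsilon>\<^sub>i\<close>, \<open>\<epsilon>\<^sub>i\<close>. Only the elements of \<open>roots t n\<close> are meaningful, and all functions on roots below
  are only used there.\<close>

datatype root = Minus int int | Plus int int | Long int | Short int

definition roots :: "ctype \<Rightarrow> nat \<Rightarrow> root set" where
  "roots t n =
     {Minus i j | i j. 1 \<le> i \<and> i < j \<and> j \<le> int n} \<union>
     {Plus i j | i j. 1 \<le> i \<and> i < j \<and> j \<le> int n} \<union>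
     (case t of
        Symplectic \<Rightarrow> {Long i | i. 1 \<le> i \<and> i \<le> int n}
      | EvenOrthogonal \<Rightarrow> {}
      | OddOrthogonal \<Rightarrow> {Short i | i. 1 \<le> i \<and> i \<le> int n})"

fun root_entries :: "root \<Rightarrow> (int \<times> int) set" where
  "root_entries (Minus i j) = {(i, j), (-j, -i)}"
| "root_entries (Plus i j) = {(i, -j), (j, -i)}"
| "root_entries (Long i) = {(i, -i)}"
| "root_entries (Short i) = {(i, 0), (0, -i)}"

definition basic_entries :: "(int \<times> int) set \<Rightarrow> bool" where
  "basic_entries B \<longleftrightarrow>
     (\<forall>i j k. (i, j) \<in> B \<and> (i, k) \<in> B \<longrightarrow> j = k) \<and>
     (\<forall>i j k. (i, k) \<in> B \<and> (j, k) \<in> B \<longrightarrow> i = j)"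

definition basic_roots :: "ctype \<Rightarrow> nat \<Rightarrow> root set \<Rightarrow> bool" where
  "basic_roots t n D \<longleftrightarrow> D \<subseteq> roots t n \<and> basic_entries (\<Union>\<alpha>\<in>D. root_entries \<alpha>)"

text \<open>The distinguished entry of a root; see \<open>dist_entry_unique\<close>.\<close>

fun dist_entry :: "root \<Rightarrow> int \<times> int" where
  "dist_entry (Minus i j) = (i, j)"
| "dist_entry (Plus i j) = (i, -j)"
| "dist_entry (Long i) = (i, -i)"
| "dist_entry (Short i) = (i, 0)"


section \<open>Class functions, elementary characters and supercharacters\<close>

definition nontrivial_additive_char :: "('a::field \<Rightarrow> complex) \<Rightarrow> bool" where
  "nontrivial_additive_char \<theta> \<longleftrightarrow>
     (\<forall>a b. \<theta> (a + b) = \<theta> a * \<theta> b) \<and> (\<forall>a. \<theta> a \<noteq> 0) \<and> (\<exists>a. \<theta> a \<noteq> 1)"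

definition class_inner :: "('g, 'b) monoid_scheme \<Rightarrow> ('g \<Rightarrow> complex) \<Rightarrow> ('g \<Rightarrow> complex) \<Rightarrow> complex" where
  "class_inner G f h = (\<Sum>x\<in>carrier G. f x * cnj (h x)) / of_nat (card (carrier G))"

text \<open>Frobenius' formula for the character of \<open>G\<close> induced by a character \<open>\<chi>\<close> of a subgroup \<open>H\<close>
  of the finite group \<open>G\<close>; only the values of \<open>\<chi>\<close> on \<open>H\<close> matter.\<close>

definition induced :: "('g, 'b) monoid_scheme \<Rightarrow> 'g set \<Rightarrow> ('g \<Rightarrow> complex) \<Rightarrow> 'g \<Rightarrow> complex" where
  "induced G H \<chi> g =
     (\<Sum>x\<in>{x \<in> carrier G. x \<otimes>\<^bsub>G\<^esub> g \<otimes>\<^bsub>G\<^esub> inv\<^bsub>G\<^esub> x \<in> H}. \<chi> (x \<otimes>\<^bsub>G\<^esub> g \<otimes>\<^bsub>G\<^esub> inv\<^bsub>G\<^esub> x)) / of_nat (card H)"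

fun unip_root :: "ctype \<Rightarrow> nat \<Rightarrow> root \<Rightarrow> 'a::field mat set" where
  "unip_root t n (Minus i j) = {x \<in> unip t n. \<forall>k. i < k \<and> k < j \<longrightarrow> entry t n x i k = 0}"
| "unip_root t n (Plus i j) = {x \<in> unip t n.
     (\<forall>k. i < k \<and> k \<le> int n \<longrightarrow> entry t n x i k = 0) \<and>
     (\<forall>l\<in>labels t n. j \<prec> l \<and> l \<preceq> 0 \<longrightarrow> entry t n x j l = 0)}"
| "unip_root t n (Long i) = {x \<in> unip t n. \<forall>k. i < k \<and> k \<le> int n \<longrightarrow> entry t n x i k = 0}"
| "unip_root t n (Short i) = {x \<in> unip t n. \<forall>k. i < k \<and> k \<le> int n \<longrightarrow> entry t n x i k = 0}"

definition elem_lin_char ::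
    "ctype \<Rightarrow> nat \<Rightarrow> ('a::field \<Rightarrow> complex) \<Rightarrow> root \<Rightarrow> 'a \<Rightarrow> 'a mat \<Rightarrow> complex" where
  "elem_lin_char t n \<theta> \<alpha> r x = \<theta> (r * entry t n x (fst (dist_entry \<alpha>)) (snd (dist_entry \<alpha>)))"

definition elem_char ::
    "ctype \<Rightarrow> nat \<Rightarrow> ('a::field \<Rightarrow> complex) \<Rightarrow> root \<Rightarrow> 'a \<Rightarrow> 'a mat \<Rightarrow> complex" where
  "elem_char t n \<theta> \<alpha> r = induced (unip_group t n) (unip_root t n \<alpha>) (elem_lin_char t n \<theta> \<alpha> r)"

definition superchar ::
    "ctype \<Rightarrow> nat \<Rightarrow> ('a::field \<Rightarrow> complex) \<Rightarrow> root set \<Rightarrow> (root \<Rightarrow> 'a) \<Rightarrow> 'a mat \<Rightarrow> complex" where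
  "superchar t n \<theta> D \<phi> x = (\<Prod>\<alpha>\<in>D. elem_char t n \<theta> \<alpha> (\<phi> \<alpha>) x)"


section \<open>Agreement with the explicit descriptions\<close>

lemma finite_roots: "finite (roots t n)"
proof -
  have "roots t n \<subseteq> (\<lambda>(i, j). Minus i j) ` ({1..int n} \<times> {1..int n}) \<union>
    (\<lambda>(i, j). Plus i j) ` ({1..int n} \<times> {1..int n}) \<union> Long ` {1..int n} \<union> Short ` {1..int n}"
    by (auto simp: roots_def image_iff split: ctype.splits)
  then show ?thesis by (rule finite_subset) auto
qed

lemma dist_entry_unique:
  assumes "\<alpha> \<in> roots t n"
  shows "(i, j) \<in> root_entries \<alpha> \<and> 1 \<le> i \<and> i \<le> int n \<and> i \<prec> j \<and> j \<preceq> -i \<longleftrightarrow> (i, j) = dist_entry \<alpha>"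
  using assms by (auto simp: roots_def prec_def preceq_def split: ctype.splits)

lemma bij_betw_pos: "bij_betw (pos t n) (labels t n) {..<msize t n}"
proof (rule bij_betw_byWitness[where f' = "\<lambda>k. if k < n then int k + 1 else
      if k < n + mid t then 0 else int k - int (msize t n)"])
qed (auto simp: pos_def labels_def msize_def mid_def split: if_splits)

lemma pos_less_iff:
  "a \<in> labels t n \<Longrightarrow> b \<in> labels t n \<Longrightarrow> pos t n a < pos t n b \<longleftrightarrow> a \<prec> b"
  by (auto simp: pos_def labels_def msize_def mid_def prec_def split: if_splits)

lemma finite_unip: "finite (unip t n :: 'a::{field,finite} mat set)"
proof -
  let ?m = "msize t n"
  have "unip t n \<subseteq> mat ?m ?m ` (({..<?m} \<times> {..<?m}) \<rightarrow>\<^sub>E (UNIV :: 'a set))"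
  proof
    fix A :: "'a mat" assume "A \<in> unip t n"
    then have A: "A \<in> carrier_mat ?m ?m" by (simp add: unip_def classical_group_def)
    have "A = mat ?m ?m (restrict (($$) A) ({..<?m} \<times> {..<?m}))"
      using A by (intro eq_matI) auto
    then show "A \<in> mat ?m ?m ` (({..<?m} \<times> {..<?m}) \<rightarrow>\<^sub>E (UNIV :: 'a set))"
      by (rule ssubst) (auto intro!: imageI)
  qed
  then show ?thesis by (rule finite_subset) (auto intro!: finite_PiE)
qed


lemma unitriangularD:
  assumes "A \<in> unitriangular m"
  shows "A \<in> carrier_mat m m" "j < i \<Longrightarrow> i < m \<Longrightarrow> A $$ (i, j) = 0" "i < m \<Longrightarrow> A $$ (i, i) = 1"
  using assms by (auto simp: unitriangular_def)

lemma unitriangular_mult: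
  assumes A: "A \<in> unitriangular m" and B: "B \<in> unitriangular m"
  shows "A * B \<in> unitriangular m"
proof -
  note a = unitriangularD[OF A] and b = unitriangularD[OF B]
  have ent: "(A * B) $$ (i, j) = (\<Sum>k<m. A $$ (i, k) * B $$ (k, j))" if "i < m" "j < m" for i j
    using a(1) b(1) that by (simp add: scalar_prod_def lessThan_atLeast0)
  have "(A * B) $$ (i, j) = 0" if "j < i" "i < m" for i j
  proof -
    have "A $$ (i, k) * B $$ (k, j) = 0" if "k < m" for k
      using a(2)[of k i] b(2)[of j k] that \<open>j < i\<close> \<open>i < m\<close> by (cases "k < i") auto
    then have "(\<Sum>k<m. A $$ (i, k) * B $$ (k, j)) = 0" by (intro sum.neutral) auto
    then show ?thesis using that by (simp add: ent)
  qed
  moreover have "(A * B) $$ (i, i) = 1" if "i < m" for i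
  proof -
    have "A $$ (i, k) * B $$ (k, i) = (if k = i then 1 else 0)" if "k < m" for k
      using a(2)[of k i] a(3)[of i] b(2)[of i k] b(3)[of i] that \<open>i < m\<close>
      by (cases k i rule: linorder_cases) auto
    then show ?thesis using that by (simp add: ent)
  qed
  ultimately show ?thesis using a(1) b(1) by (auto simp: unitriangular_def)
qed

lemma unitriangular_inverse:
  assumes A: "A \<in> unitriangular m" and B: "B \<in> carrier_mat m m" and AB: "A * B = 1\<^sub>m m"
  shows "B \<in> unitriangular m"
proof -
  note a = unitriangularD[OF A]
  have key: "j \<le> i \<longrightarrow> B $$ (i, j) = (if i = j then 1 else 0)" if "i < m" for i j
    using that
  proof (induction "m - i" arbitrary: i rule: less_induct)
    case less
    show ?case
    proof
      assume ji: "j \<le> i"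
      have "(A * B) $$ (i, j) = (\<Sum>k<m. A $$ (i, k) * B $$ (k, j))"
        using a(1) B less.prems ji by (simp add: scalar_prod_def lessThan_atLeast0)
      also have "\<dots> = (\<Sum>k<m. if k = i then B $$ (i, j) else 0)"
      proof (rule sum.cong[OF refl])
        fix k assume k: "k \<in> {..<m}"
        show "A $$ (i, k) * B $$ (k, j) = (if k = i then B $$ (i, j) else 0)"
        proof (cases k i rule: linorder_cases)
          case greater
          then have "B $$ (k, j) = 0" using less.hyps[of k] less.prems k ji by auto
          with greater show ?thesis by simp
        qed (use a less.prems in auto)
      qed
      also have "\<dots> = B $$ (i, j)" using less.prems by simp
      finally show "B $$ (i, j) = (if i = j then 1 else 0)"
        using less.prems ji by (simp add: AB)
    qed
  qed
  then show ?thesis using B by (auto simp: unitriangular_def)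
qed

lemma unitriangular_invertible:
  assumes A: "A \<in> unitriangular m"
  obtains B where "B \<in> carrier_mat m m" "A * B = 1\<^sub>m m" "B * A = 1\<^sub>m m"
proof -
  note a = unitriangularD[OF A]
  have "det A = prod_list (diag_mat A)"
    using A by (intro det_upper_triangular[of _ m]) (auto simp: unitriangular_def)
  also have "diag_mat A = map (\<lambda>_. 1) [0..<m]"
    using a by (auto simp: diag_mat_def)
  also have "prod_list \<dots> = 1"
    by (simp add: map_replicate_const)
  finally have "det A \<noteq> 0" by simp
  then have "A \<in> Units (ring_mat TYPE('a) m ())"
    using a(1) by (intro det_non_zero_imp_unit)
  then show ?thesis using that by (auto simp: Units_def ring_mat_def)
qed

lemma group_unip: "group (unip_group t n :: 'a::field mat monoid)"
proof (rule groupI)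
  let ?m = "msize t n" and ?K = "form_mat t n :: 'a mat"
  have K: "?K \<in> carrier_mat ?m ?m" by (simp add: form_mat_def)
  fix A B C :: "'a mat"
  show "\<one>\<^bsub>unip_group t n\<^esub> \<in> carrier (unip_group t n :: 'a mat monoid)"
    using K by (auto simp: unip_group_def unip_def classical_group_def unitriangular_def)
  assume A: "A \<in> carrier (unip_group t n)"
  then have Ac: "A \<in> carrier_mat ?m ?m" and Au: "A \<in> unitriangular ?m"
    and Ak: "transpose_mat A * ?K * A = ?K"
    by (auto simp: unip_group_def unip_def classical_group_def)
  show "\<one>\<^bsub>unip_group t n\<^esub> \<otimes>\<^bsub>unip_group t n\<^esub> A = A"
    using Ac by (simp add: unip_group_def)
  obtain Z where Z: "Z \<in> carrier_mat ?m ?m" "A * Z = 1\<^sub>m ?m" "Z * A = 1\<^sub>m ?m"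
    using unitriangular_invertible[OF Au] by blast
  have "transpose_mat Z * ?K * Z = transpose_mat Z * (transpose_mat A * ?K * A) * Z"
    by (simp add: Ak)
  also have "\<dots> = (transpose_mat Z * transpose_mat A) * ?K * (A * Z)"
    using Ac Z(1) K by (simp add: assoc_mult_mat[of _ ?m ?m _ ?m _ ?m])
  also have "transpose_mat Z * transpose_mat A = 1\<^sub>m ?m"
    using transpose_mult[OF Ac Z(1)] Z(2) by (simp add: transpose_one)
  finally have "transpose_mat Z * ?K * Z = ?K" using K Z by simp
  then show "\<exists>Y\<in>carrier (unip_group t n). Y \<otimes>\<^bsub>unip_group t n\<^esub> A = \<one>\<^bsub>unip_group t n\<^esub>"
    using Z unitriangular_inverse[OF Au Z(1,2)]
    by (intro bexI[of _ Z]) (auto simp: unip_group_def unip_def classical_group_def)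
  assume B: "B \<in> carrier (unip_group t n)"
  then have Bc: "B \<in> carrier_mat ?m ?m" and Bu: "B \<in> unitriangular ?m"
    and Bk: "transpose_mat B * ?K * B = ?K"
    by (auto simp: unip_group_def unip_def classical_group_def)
  have "transpose_mat (A * B) * ?K * (A * B) = transpose_mat B * (transpose_mat A * ?K * A) * B"
    using Ac Bc K by (simp add: transpose_mult[OF Ac Bc] assoc_mult_mat[of _ ?m ?m _ ?m _ ?m])
  also have "\<dots> = ?K" by (simp add: Ak Bk)
  finally show "A \<otimes>\<^bsub>unip_group t n\<^esub> B \<in> carrier (unip_group t n)"
    using Ac Bc unitriangular_mult[OF Au Bu]
    by (auto simp: unip_group_def unip_def classical_group_def)
  assume "C \<in> carrier (unip_group t n)"
  then have "C \<in> carrier_mat ?m ?m"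
    by (auto simp: unip_group_def unip_def classical_group_def)
  then show "A \<otimes>\<^bsub>unip_group t n\<^esub> B \<otimes>\<^bsub>unip_group t n\<^esub> C = A \<otimes>\<^bsub>unip_group t n\<^esub> (B \<otimes>\<^bsub>unip_group t n\<^esub> C)"
    using Ac Bc by (simp add: unip_group_def)
qed

text \<open>Matrices with block rows and columns of sizes \<open>n\<close>, \<open>r\<close>, \<open>n\<close>.\<close>

definition block3 :: "nat \<Rightarrow> nat \<Rightarrow> 'a mat \<Rightarrow> 'a mat \<Rightarrow> 'a mat \<Rightarrow> 'a mat \<Rightarrow> 'a mat \<Rightarrow> 'a mat
    \<Rightarrow> 'a mat \<Rightarrow> 'a mat \<Rightarrow> 'a mat \<Rightarrow> 'a mat" where
  "block3 n r A11 A12 A13 A21 A22 A23 A31 A32 A33 = mat (n + r + n) (n + r + n) (\<lambda>(i, j).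
     if i < n then
       if j < n then A11 $$ (i, j) else if j < n + r then A12 $$ (i, j - n)
       else A13 $$ (i, j - (n + r))
     else if i < n + r then
       if j < n then A21 $$ (i - n, j) else if j < n + r then A22 $$ (i - n, j - n)
       else A23 $$ (i - n, j - (n + r))
     else
       if j < n then A31 $$ (i - (n + r), j) else if j < n + r then A32 $$ (i - (n + r), j - n)
       else A33 $$ (i - (n + r), j - (n + r)))"

lemma sum_lessThan_add:
  "(\<Sum>k<a + b. f k) = (\<Sum>k<a. f k) + (\<Sum>k<b. f (a + k))"
  for f :: "nat \<Rightarrow> 'a::comm_monoid_add" and a b :: nat
  by (induction b) (auto simp: add.assoc)

lemma mult_block3:
  fixes A11 :: "'a::semiring_0 mat"
  assumes A: "A11 \<in> carrier_mat n n" "A12 \<in> carrier_mat n r" "A13 \<in> carrier_mat n n"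
    "A21 \<in> carrier_mat r n" "A22 \<in> carrier_mat r r" "A23 \<in> carrier_mat r n"
    "A31 \<in> carrier_mat n n" "A32 \<in> carrier_mat n r" "A33 \<in> carrier_mat n n"
  and B: "B11 \<in> carrier_mat n n" "B12 \<in> carrier_mat n r" "B13 \<in> carrier_mat n n"
    "B21 \<in> carrier_mat r n" "B22 \<in> carrier_mat r r" "B23 \<in> carrier_mat r n"
    "B31 \<in> carrier_mat n n" "B32 \<in> carrier_mat n r" "B33 \<in> carrier_mat n n"
  shows "block3 n r A11 A12 A13 A21 A22 A23 A31 A32 A33 * block3 n r B11 B12 B13 B21 B22 B23 B31 B32 B33 =
    block3 n r
      (A11 * B11 + A12 * B21 + A13 * B31) (A11 * B12 + A12 * B22 + A13 * B32) (A11 * B13 + A12 * B23 + A13 * B33)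
      (A21 * B11 + A22 * B21 + A23 * B31) (A21 * B12 + A22 * B22 + A23 * B32) (A21 * B13 + A22 * B23 + A23 * B33)
      (A31 * B11 + A32 * B21 + A33 * B31) (A31 * B12 + A32 * B22 + A33 * B32) (A31 * B13 + A32 * B23 + A33 * B33)"
    (is "?A * ?B = ?C")
proof (rule eq_matI)
  fix i j assume "i < dim_row ?C" "j < dim_col ?C"
  then have ij: "i < n + r + n" "j < n + r + n" by (auto simp: block3_def)
  have "(?A * ?B) $$ (i, j) = (\<Sum>k<n + r + n. ?A $$ (i, k) * ?B $$ (k, j))"
    using ij by (simp add: scalar_prod_def lessThan_atLeast0 block3_def)
  also have "\<dots> = (\<Sum>k<n. ?A $$ (i, k) * ?B $$ (k, j)) +
      (\<Sum>k<r. ?A $$ (i, n + k) * ?B $$ (n + k, j)) +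
      (\<Sum>k<n. ?A $$ (i, n + r + k) * ?B $$ (n + r + k, j))"
    by (simp add: sum_lessThan_add)
  also have "\<dots> = ?C $$ (i, j)"
    using ij A B by (auto simp: block3_def scalar_prod_def lessThan_atLeast0)
  finally show "(?A * ?B) $$ (i, j) = ?C $$ (i, j)" .
qed (auto simp: block3_def)

lemma transpose_block3:
  assumes A: "A11 \<in> carrier_mat n n" "A12 \<in> carrier_mat n r" "A13 \<in> carrier_mat n n"
    "A21 \<in> carrier_mat r n" "A22 \<in> carrier_mat r r" "A23 \<in> carrier_mat r n"
    "A31 \<in> carrier_mat n n" "A32 \<in> carrier_mat n r" "A33 \<in> carrier_mat n n"
  shows "transpose_mat (block3 n r A11 A12 A13 A21 A22 A23 A31 A32 A33) =
    block3 n r (transpose_mat A11) (transpose_mat A21) (transpose_mat A31)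
      (transpose_mat A12) (transpose_mat A22) (transpose_mat A32)
      (transpose_mat A13) (transpose_mat A23) (transpose_mat A33)"
  using A by (intro eq_matI) (auto simp: block3_def)

lemma block3_entries:
  "i < n \<Longrightarrow> j < n \<Longrightarrow> block3 n r A B C D E F G H I $$ (i, j) = A $$ (i, j)"
  "i < n \<Longrightarrow> j < r \<Longrightarrow> block3 n r A B C D E F G H I $$ (i, n + j) = B $$ (i, j)"
  "i < n \<Longrightarrow> j < n \<Longrightarrow> block3 n r A B C D E F G H I $$ (i, n + r + j) = C $$ (i, j)"
  "i < r \<Longrightarrow> j < n \<Longrightarrow> block3 n r A B C D E F G H I $$ (n + i, j) = D $$ (i, j)"
  "i < r \<Longrightarrow> j < r \<Longrightarrow> block3 n r A B C D E F G H I $$ (n + i, n + j) = E $$ (i, j)"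
  "i < r \<Longrightarrow> j < n \<Longrightarrow> block3 n r A B C D E F G H I $$ (n + i, n + r + j) = F $$ (i, j)"
  "i < n \<Longrightarrow> j < n \<Longrightarrow> block3 n r A B C D E F G H I $$ (n + r + i, j) = G $$ (i, j)"
  "i < n \<Longrightarrow> j < r \<Longrightarrow> block3 n r A B C D E F G H I $$ (n + r + i, n + j) = H $$ (i, j)"
  "i < n \<Longrightarrow> j < n \<Longrightarrow> block3 n r A B C D E F G H I $$ (n + r + i, n + r + j) = I $$ (i, j)"
  by (auto simp: block3_def)

lemma block3_eqD:
  assumes eq: "block3 n r A B C D E F G H I = block3 n r A' B' C' D' E' F' G' H' I'"
  shows "A \<in> carrier_mat n n \<Longrightarrow> A' \<in> carrier_mat n n \<Longrightarrow> A = A'"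
    "C \<in> carrier_mat n n \<Longrightarrow> C' \<in> carrier_mat n n \<Longrightarrow> C = C'"
    "F \<in> carrier_mat r n \<Longrightarrow> F' \<in> carrier_mat r n \<Longrightarrow> F = F'"
    "I \<in> carrier_mat n n \<Longrightarrow> I' \<in> carrier_mat n n \<Longrightarrow> I = I'"
proof -
  have e: "block3 n r A B C D E F G H I $$ k = block3 n r A' B' C' D' E' F' G' H' I' $$ k" for k
    by (simp add: eq)
  show "A \<in> carrier_mat n n \<Longrightarrow> A' \<in> carrier_mat n n \<Longrightarrow> A = A'"
    using e[of "(_, _)"] by (intro eq_matI) (auto, metis block3_entries(1))
  show "C \<in> carrier_mat n n \<Longrightarrow> C' \<in> carrier_mat n n \<Longrightarrow> C = C'"
    using e[of "(_, _)"] by (intro eq_matI) (auto, metis block3_entries(3))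
  show "F \<in> carrier_mat r n \<Longrightarrow> F' \<in> carrier_mat r n \<Longrightarrow> F = F'"
    using e[of "(_, _)"] by (intro eq_matI) (auto, metis block3_entries(6))
  show "I \<in> carrier_mat n n \<Longrightarrow> I' \<in> carrier_mat n n \<Longrightarrow> I = I'"
    using e[of "(_, _)"] by (intro eq_matI) (auto, metis block3_entries(9))
qed

lemma antidiag_simps [simp]:
  "antidiag n \<in> carrier_mat n n"
  "transpose_mat (antidiag n) = antidiag n"
  "antidiag n * antidiag n = (1\<^sub>m n :: 'a::field mat)"
proof -
  show "antidiag n \<in> carrier_mat n n" by (simp add: antidiag_def)
  show "transpose_mat (antidiag n) = antidiag n" by (rule eq_matI) (auto simp: antidiag_def)
  show "antidiag n * antidiag n = (1\<^sub>m n :: 'a mat)"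
  proof (rule eq_matI)
    fix i j assume "i < dim_row (1\<^sub>m n :: 'a mat)" "j < dim_col (1\<^sub>m n :: 'a mat)"
    then have ij: "i < n" "j < n" by auto
    then have "(antidiag n * antidiag n :: 'a mat) $$ (i, j) =
        (\<Sum>k<n. (if i + k + 1 = n then 1 else 0) * (if k + j + 1 = n then 1 else 0))"
      by (simp add: antidiag_def scalar_prod_def lessThan_atLeast0)
    also have "\<dots> = (\<Sum>k<n. if k = n - 1 - i then (if i = j then 1 else 0) else 0)"
      using ij by (intro sum.cong) auto
    also have "\<dots> = (1\<^sub>m n :: 'a mat) $$ (i, j)" using ij by simp
    finally show "(antidiag n * antidiag n :: 'a mat) $$ (i, j) = 1\<^sub>m n $$ (i, j)" .
  qed (auto simp: antidiag_def)
qed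

lemma antidiag_conj_entry:
  assumes "M \<in> carrier_mat n n" "i < n" "j < n"
  shows "(antidiag n * M * antidiag n) $$ (i, j) = (M $$ (n - 1 - i, n - 1 - j) :: 'a::field)"
proof -
  have left: "(antidiag n * M) $$ (i, k) = M $$ (n - 1 - i, k)" if "k < n" for k
  proof -
    have "(antidiag n * M) $$ (i, k) = (\<Sum>l<n. (if i + l + 1 = n then 1 else 0) * M $$ (l, k))"
      using assms that by (simp add: antidiag_def scalar_prod_def lessThan_atLeast0)
    also have "\<dots> = (\<Sum>l<n. if l = n - 1 - i then M $$ (n - 1 - i, k) else 0)"
      using assms by (intro sum.cong) auto
    finally show ?thesis using assms by simp
  qed
  have "(antidiag n * M * antidiag n) $$ (i, j) =
      (\<Sum>l<n. (antidiag n * M) $$ (i, l) * (if l + j + 1 = n then 1 else 0))"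
    using assms by (simp add: antidiag_def scalar_prod_def lessThan_atLeast0)
  also have "\<dots> = (\<Sum>l<n. if l = n - 1 - j then M $$ (n - 1 - i, l) else 0)"
    using assms by (intro sum.cong) (auto simp: left)
  finally show ?thesis using assms by simp
qed

lemma unitriangular_antitranspose:
  assumes "y \<in> unitriangular n"
  shows "antidiag n * transpose_mat y * antidiag n \<in> unitriangular n"
proof -
  note y = unitriangularD[OF assms]
  have c: "antidiag n * transpose_mat y * antidiag n \<in> carrier_mat n n"
    using y(1) by (auto intro!: mult_carrier_mat)
  have "(antidiag n * transpose_mat y * antidiag n) $$ (i, j) = y $$ (n - 1 - j, n - 1 - i)"
    if "i < n" "j < n" for i j
    using y(1) that by (subst antidiag_conj_entry) auto
  with c y show ?thesis by (auto simp: unitriangular_def intro!: upper_triangularI)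
qed

lemma form_mat_block3:
  "form_mat t n = block3 n (mid t) (0\<^sub>m n n) (0\<^sub>m n (mid t)) (antidiag n)
     (0\<^sub>m (mid t) n) (1\<^sub>m (mid t)) (0\<^sub>m (mid t) n)
     ((if t = Symplectic then -1 else 1) \<cdot>\<^sub>m antidiag n) (0\<^sub>m n (mid t)) (0\<^sub>m n n)"
  by (rule eq_matI)
    (auto simp: form_mat_def block3_def msize_def antidiag_def mid_def split: if_splits)


lemma isometry_blocks:
  fixes x :: "'a::field mat" and n r :: nat and s :: 'a
  defines "J \<equiv> antidiag n"
  assumes c: "x \<in> carrier_mat n n" "b \<in> carrier_mat n r" "c \<in> carrier_mat n n"
    "d \<in> carrier_mat r n" "w \<in> carrier_mat n n"
  shows "transpose_mat (block3 n r x b c (0\<^sub>m r n) (1\<^sub>m r) d (0\<^sub>m n n) (0\<^sub>m n r) w) *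
      block3 n r (0\<^sub>m n n) (0\<^sub>m n r) J (0\<^sub>m r n) (1\<^sub>m r) (0\<^sub>m r n) (s \<cdot>\<^sub>m J) (0\<^sub>m n r) (0\<^sub>m n n) *
      block3 n r x b c (0\<^sub>m r n) (1\<^sub>m r) d (0\<^sub>m n n) (0\<^sub>m n r) w =
    block3 n r (0\<^sub>m n n) (0\<^sub>m n r) (transpose_mat x * J * w)
      (0\<^sub>m r n) (1\<^sub>m r) (transpose_mat b * J * w + d)
      (transpose_mat w * (s \<cdot>\<^sub>m J) * x) (transpose_mat w * (s \<cdot>\<^sub>m J) * b + transpose_mat d)
      (transpose_mat w * (s \<cdot>\<^sub>m J) * c + transpose_mat d * d + transpose_mat c * J * w)"
proof -
  have J: "J \<in> carrier_mat n n" by (simp add: J_def)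
  note mc = mult_carrier_mat[of _ n n _ n] mult_carrier_mat[of _ r n _ n] mult_carrier_mat[of _ n n _ r]
    mult_carrier_mat[of _ r n _ r] mult_carrier_mat[of _ n r _ r] mult_carrier_mat[of _ r r _ n]
    mult_carrier_mat[of _ n r _ n]
  show ?thesis
    using c J
    apply (simp add: transpose_block3 mc)
    apply (subst mult_block3)
    apply (simp_all add: mc)
    apply (subst mult_block3)
    apply (simp_all add: mc)
    apply (simp add: comm_add_mat[of d r n] mc)
    done
qed


text \<open>The block description of \<open>U\<close>, where \<open>y = x\<^sup>-\<^sup>1\<close>.\<close>

lemma unip_iff_blocks:
  fixes A :: "'a::field mat" and n :: nat and t :: ctype
  defines "J \<equiv> antidiag n" and "r \<equiv> mid t"
  shows "A \<in> unip t n \<longleftrightarrow>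
    (\<exists>x y u z. x \<in> unitriangular n \<and> y \<in> carrier_mat n n \<and> x * y = 1\<^sub>m n \<and>
       u \<in> carrier_mat n r \<and> z \<in> carrier_mat n n \<and>
       (case t of
          Symplectic \<Rightarrow> J * transpose_mat z - z * J = 0\<^sub>m n n
        | EvenOrthogonal \<Rightarrow> J * transpose_mat z + z * J = 0\<^sub>m n n
        | OddOrthogonal \<Rightarrow> J * transpose_mat z + z * J = - (u * transpose_mat u)) \<and>
       A = block3 n r x (x * u) (x * z)
             (0\<^sub>m r n) (1\<^sub>m r) (- (transpose_mat u * J))
             (0\<^sub>m n n) (0\<^sub>m n r) (J * transpose_mat y * J))"
    (is "_ \<longleftrightarrow> ?R")
proof -
  define s :: 'a where "s = (if t = Symplectic then -1 else 1)"
  have J: "J \<in> carrier_mat n n" "transpose_mat J = J" "J * J = 1\<^sub>m n" by (simp_all add: J_def)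
  have r1: "r \<le> 1" and m: "msize t n = n + r + n"
    by (auto simp: r_def mid_def msize_def)
  note mc = mult_carrier_mat[of _ n n _ n] mult_carrier_mat[of _ r n _ n] mult_carrier_mat[of _ n n _ r]
    mult_carrier_mat[of _ r n _ r] mult_carrier_mat[of _ n r _ r] mult_carrier_mat[of _ r r _ n]
    mult_carrier_mat[of _ n r _ n]
  note as = assoc_mult_mat[of _ n n _ n _ n] assoc_mult_mat[of _ r n _ n _ n]
    assoc_mult_mat[of _ n n _ n _ r] assoc_mult_mat[of _ n n _ r _ n] assoc_mult_mat[of _ n r _ n _ n]
    assoc_mult_mat[of _ n r _ n _ r] assoc_mult_mat[of _ r n _ n _ r]
  have JJ: "J * (J * M) = M" if "M \<in> carrier_mat n k" for M k
    using that J assoc_mult_mat[of J n n J n M k] by simp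
  note tr = transpose_mult[of _ n n _ n] transpose_mult[of _ n n _ r] transpose_mult[of _ r n _ n]

  define Q where "Q z u = J * transpose_mat z + u * transpose_mat u + s \<cdot>\<^sub>m (z * J)" for z u
  have Qc: "Q z u \<in> carrier_mat n n" if "z \<in> carrier_mat n n" "u \<in> carrier_mat n r" for z u
    using that J by (auto simp: Q_def mc)
  have cond: "(case t of
          Symplectic \<Rightarrow> J * transpose_mat z - z * J = 0\<^sub>m n n
        | EvenOrthogonal \<Rightarrow> J * transpose_mat z + z * J = 0\<^sub>m n n
        | OddOrthogonal \<Rightarrow> J * transpose_mat z + z * J = - (u * transpose_mat u)) \<longleftrightarrow>
      Q z u = 0\<^sub>m n n"
    if z: "z \<in> carrier_mat n n" and u: "u \<in> carrier_mat n r" for z u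
  proof -
    have P: "J * transpose_mat z \<in> carrier_mat n n" "z * J \<in> carrier_mat n n"
      "u * transpose_mat u \<in> carrier_mat n n"
      using z u J by (simp_all add: mc)
    have uu: "u * transpose_mat u = 0\<^sub>m n n" if "t \<noteq> OddOrthogonal"
      using that u by (intro eq_matI) (auto simp: r_def mid_def scalar_prod_def)
    show ?thesis
    proof (cases t)
      case Symplectic
      then have "Q z u = J * transpose_mat z - z * J"
        using P uu by (intro eq_matI) (auto simp: Q_def s_def)
      with Symplectic show ?thesis by simp
    next
      case EvenOrthogonal
      then have "Q z u = J * transpose_mat z + z * J"
        using P uu by (intro eq_matI) (auto simp: Q_def s_def)
      with EvenOrthogonal show ?thesis by simp
    next
      case OddOrthogonal
      then have Q: "Q z u = (J * transpose_mat z + z * J) + u * transpose_mat u"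
      proof -
        have "X + W + 1 \<cdot>\<^sub>m Y = X + Y + W"
          if "X \<in> carrier_mat n n" "Y \<in> carrier_mat n n" "W \<in> carrier_mat n n" for X Y W :: "'a mat"
          using that by (intro eq_matI) auto
        with P OddOrthogonal show ?thesis by (simp add: Q_def s_def)
      qed
      have "X + Y = 0\<^sub>m n n \<longleftrightarrow> X = - Y" if "X \<in> carrier_mat n n" "Y \<in> carrier_mat n n"
        for X Y :: "'a mat"
        using that by (auto simp: mat_eq_iff eq_neg_iff_add_eq_0)
      from this[of "J * transpose_mat z + z * J" "u * transpose_mat u"] show ?thesis
        using P unfolding Q OddOrthogonal ctype.case by simp
    qed
  qed

  have blocks: "transpose_mat (block3 n r x b c (0\<^sub>m r n) (1\<^sub>m r) d (0\<^sub>m n n) (0\<^sub>m n r) w) *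
      form_mat t n * block3 n r x b c (0\<^sub>m r n) (1\<^sub>m r) d (0\<^sub>m n n) (0\<^sub>m n r) w =
    block3 n r (0\<^sub>m n n) (0\<^sub>m n r) (transpose_mat x * J * w)
      (0\<^sub>m r n) (1\<^sub>m r) (transpose_mat b * J * w + d)
      (transpose_mat w * (s \<cdot>\<^sub>m J) * x) (transpose_mat w * (s \<cdot>\<^sub>m J) * b + transpose_mat d)
      (transpose_mat w * (s \<cdot>\<^sub>m J) * c + transpose_mat d * d + transpose_mat c * J * w)"
    if "x \<in> carrier_mat n n" "b \<in> carrier_mat n r" "c \<in> carrier_mat n n"
      "d \<in> carrier_mat r n" "w \<in> carrier_mat n n" for x b c d w
    using isometry_blocks[OF that, of s] by (simp add: form_mat_block3 J_def r_def s_def)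
  have form: "form_mat t n = block3 n r (0\<^sub>m n n) (0\<^sub>m n r) J
     (0\<^sub>m r n) (1\<^sub>m r) (0\<^sub>m r n) (s \<cdot>\<^sub>m J) (0\<^sub>m n r) (0\<^sub>m n n)"
    by (simp add: form_mat_block3 J_def r_def s_def)

  text \<open>With \<open>w\<close>, \<open>b\<close>, \<open>c\<close>, \<open>d\<close> as in the block description, the form is preserved up to the
    lower right block.\<close>
  have calc: "transpose_mat x * J * w = J" "transpose_mat (x * u) * J * w = transpose_mat u * J"
      "transpose_mat w * (s \<cdot>\<^sub>m J) * x = s \<cdot>\<^sub>m J"
      "transpose_mat w * (s \<cdot>\<^sub>m J) * (x * u) = s \<cdot>\<^sub>m (J * u)"
      "transpose_mat w * (s \<cdot>\<^sub>m J) * (x * z) + transpose_mat (- (transpose_mat u * J)) * (- (transpose_mat u * J))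
         + transpose_mat (x * z) * J * w = J * Q z u * J"
    if x: "x \<in> carrier_mat n n" and y: "y \<in> carrier_mat n n" and xy: "x * y = 1\<^sub>m n"
      and u: "u \<in> carrier_mat n r" and z: "z \<in> carrier_mat n n" and w: "w = J * transpose_mat y * J"
    for x y u z w
  proof -
    have yx: "y * x = 1\<^sub>m n" using mat_mult_left_right_inverse[OF x y xy] .
    have t1: "transpose_mat x * transpose_mat y = 1\<^sub>m n"
      using transpose_mult[OF y x] yx by (simp add: transpose_one)
    have wc: "w \<in> carrier_mat n n" using w J y by (simp add: mc)
    have 1: "transpose_mat x * (J * w) = J"
    proof -
      have "transpose_mat x * (J * w) = (transpose_mat x * transpose_mat y) * J"
        using x y J by (simp add: w mc as JJ[of _ n])
      then show ?thesis using t1 J by simp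
    qed
    show "transpose_mat x * J * w = J" using 1 x J wc by (simp add: as)
    have 2: "transpose_mat (x * M) * J * w = transpose_mat M * J" if M: "M \<in> carrier_mat n k" for M k
    proof -
      have "transpose_mat (x * M) * J * w = transpose_mat M * transpose_mat x * J * w"
        using x M by (simp add: transpose_mult[of _ n n _ k])
      also have "\<dots> = transpose_mat M * (transpose_mat x * (J * w))"
        using x M J wc by (simp add: assoc_mult_mat[of _ k n _ n _ n] mult_carrier_mat[of _ k n _ n] mc)
      finally show ?thesis by (simp add: 1)
    qed
    show "transpose_mat (x * u) * J * w = transpose_mat u * J" using 2[OF u] .
    have wT: "transpose_mat w = J * y * J" using y J by (simp add: w tr mc as)
    have 3: "transpose_mat w * (s \<cdot>\<^sub>m J) * (x * M) = s \<cdot>\<^sub>m (J * M)" if M: "M \<in> carrier_mat n k" for M k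
    proof -
      have "transpose_mat w * (s \<cdot>\<^sub>m J) = s \<cdot>\<^sub>m (J * y)"
        using y J by (simp add: wT as mc mult_smult_distrib[of _ n n _ n])
      then have "transpose_mat w * (s \<cdot>\<^sub>m J) * (x * M) = s \<cdot>\<^sub>m ((J * y) * (x * M))"
        using x y J M mult_smult_assoc_mat[of "J * y" n n "x * M" k s] by (simp add: mult_carrier_mat[of _ n n _ k] mc)
      also have "(J * y) * (x * M) = J * ((y * x) * M)"
        using x y J M by (simp add: assoc_mult_mat[of _ n n _ n _ k] mult_carrier_mat[of _ n n _ k] mc)
      finally show ?thesis using M by (simp add: yx)
    qed
    show "transpose_mat w * (s \<cdot>\<^sub>m J) * (x * u) = s \<cdot>\<^sub>m (J * u)" using 3[OF u] .
    show "transpose_mat w * (s \<cdot>\<^sub>m J) * x = s \<cdot>\<^sub>m J" using 3[of "1\<^sub>m n" n] x J by simp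
    have 4: "transpose_mat (- (transpose_mat u * J)) * (- (transpose_mat u * J)) = J * (u * transpose_mat u) * J"
    proof -
      have "transpose_mat (- (transpose_mat u * J)) = - (J * u)"
        using u J by (simp add: transpose_uminus tr)
      then show ?thesis
        using u J by (simp add: as mc assoc_mult_mat[of _ n r _ n _ n])
    qed
    have "J * Q z u * J = (J * (J * transpose_mat z) + J * (u * transpose_mat u) + J * (s \<cdot>\<^sub>m (z * J))) * J"
      using z u J by (simp add: Q_def mc mult_add_distrib_mat[of _ n n _ n])
    also have "\<dots> = (transpose_mat z * J + J * (u * transpose_mat u) * J + (s \<cdot>\<^sub>m (J * (z * J))) * J)"
      using z u J by (simp add: mc add_mult_distrib_mat[of _ n n _ _ n] JJ[of _ n] mult_smult_distrib[of _ n n _ n]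
          assoc_add_mat[of _ n n])
    also have "(s \<cdot>\<^sub>m (J * (z * J))) * J = s \<cdot>\<^sub>m (J * z)"
      using z J by (simp add: mc mult_smult_assoc_mat[of _ n n _ n] as)
    also have "transpose_mat z * J + J * (u * transpose_mat u) * J + s \<cdot>\<^sub>m (J * z)
       = s \<cdot>\<^sub>m (J * z) + J * (u * transpose_mat u) * J + transpose_mat z * J"
      using z u J by (intro eq_matI) (auto simp: mc)
    finally show "transpose_mat w * (s \<cdot>\<^sub>m J) * (x * z) + transpose_mat (- (transpose_mat u * J)) * (- (transpose_mat u * J))
         + transpose_mat (x * z) * J * w = J * Q z u * J"
      by (simp only: 2[OF z] 3[OF z] 4)
  qed

  show ?thesis
  proof
    assume "A \<in> unip t n"
    then have Ac: "A \<in> carrier_mat (n + r + n) (n + r + n)" and Au: "A \<in> unitriangular (n + r + n)"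
      and Ak: "transpose_mat A * form_mat t n * A = form_mat t n"
      by (auto simp: unip_def classical_group_def m)
    note a = unitriangularD[OF Au]
    define x where "x = mat n n (\<lambda>(i, j). A $$ (i, j))"
    define b where "b = mat n r (\<lambda>(i, j). A $$ (i, n + j))"
    define c where "c = mat n n (\<lambda>(i, j). A $$ (i, n + r + j))"
    define d where "d = mat r n (\<lambda>(i, j). A $$ (n + i, n + r + j))"
    define w where "w = mat n n (\<lambda>(i, j). A $$ (n + r + i, n + r + j))"
    have carr: "x \<in> carrier_mat n n" "b \<in> carrier_mat n r" "c \<in> carrier_mat n n"
      "d \<in> carrier_mat r n" "w \<in> carrier_mat n n"
      by (simp_all add: x_def b_def c_def d_def w_def)
    have A: "A = block3 n r x b c (0\<^sub>m r n) (1\<^sub>m r) d (0\<^sub>m n n) (0\<^sub>m n r) w"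
    proof (rule eq_matI)
      fix i j assume "i < dim_row (block3 n r x b c (0\<^sub>m r n) (1\<^sub>m r) d (0\<^sub>m n n) (0\<^sub>m n r) w)"
        "j < dim_col (block3 n r x b c (0\<^sub>m r n) (1\<^sub>m r) d (0\<^sub>m n n) (0\<^sub>m n r) w)"
      then have ij: "i < n + r + n" "j < n + r + n" by (auto simp: block3_def)
      have mid1: "i = j" if "n \<le> i" "i < n + r" "n \<le> j" "j < n + r"
        using that r1 by auto
      show "A $$ (i, j) = block3 n r x b c (0\<^sub>m r n) (1\<^sub>m r) d (0\<^sub>m n n) (0\<^sub>m n r) w $$ (i, j)"
        using ij mid1 a(2)[of j i] a(3)[of i]
        by (auto simp: block3_def x_def b_def c_def d_def w_def)
    qed (use Ac in \<open>auto simp: block3_def\<close>)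
    have xu: "x \<in> unitriangular n"
      using a by (auto simp: unitriangular_def x_def intro!: upper_triangularI)
    from Ak have E: "block3 n r (0\<^sub>m n n) (0\<^sub>m n r) (transpose_mat x * J * w)
      (0\<^sub>m r n) (1\<^sub>m r) (transpose_mat b * J * w + d)
      (transpose_mat w * (s \<cdot>\<^sub>m J) * x) (transpose_mat w * (s \<cdot>\<^sub>m J) * b + transpose_mat d)
      (transpose_mat w * (s \<cdot>\<^sub>m J) * c + transpose_mat d * d + transpose_mat c * J * w) =
      block3 n r (0\<^sub>m n n) (0\<^sub>m n r) J
     (0\<^sub>m r n) (1\<^sub>m r) (0\<^sub>m r n) (s \<cdot>\<^sub>m J) (0\<^sub>m n r) (0\<^sub>m n n)"
      unfolding A blocks[OF carr] unfolding form .
    have E1: "transpose_mat x * J * w = J"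
      using block3_eqD(2)[OF E] carr J by (simp add: mc)
    have E2: "transpose_mat b * J * w + d = 0\<^sub>m r n"
      using block3_eqD(3)[OF E] carr J by (simp add: mc)
    have E3: "transpose_mat w * (s \<cdot>\<^sub>m J) * c + transpose_mat d * d + transpose_mat c * J * w = 0\<^sub>m n n"
      using block3_eqD(4)[OF E] carr J by (simp add: mc)
    define y where "y = transpose_mat (J * w * J)"
    have yc: "y \<in> carrier_mat n n" using carr J by (simp add: y_def mc)
    have "transpose_mat x * (J * w * J) = (transpose_mat x * J * w) * J"
      using carr J by (simp add: as mc)
    also have "\<dots> = 1\<^sub>m n" by (simp add: E1 J)
    finally have "transpose_mat (transpose_mat x * (J * w * J)) = 1\<^sub>m n" by (simp add: transpose_one)
    then have yx: "y * x = 1\<^sub>m n"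
      using carr J by (subst (asm) transpose_mult[of _ n n _ n]) (auto simp: y_def mc)
    have xy: "x * y = 1\<^sub>m n" using mat_mult_left_right_inverse[OF yc carr(1) yx] .
    have w: "w = J * transpose_mat y * J"
      using carr J by (simp add: y_def mc as JJ[of _ n])
    define u where "u = y * b"
    define z where "z = y * c"
    have uz: "u \<in> carrier_mat n r" "z \<in> carrier_mat n n" using carr yc by (simp_all add: u_def z_def mc)
    have b: "b = x * u" and c: "c = x * z"
      using carr yc xy by (simp_all add: u_def z_def flip: assoc_mult_mat[of _ n n _ n _ r] assoc_mult_mat[of _ n n _ n _ n])
    have bw: "transpose_mat b * J * w = transpose_mat u * J"
      unfolding b using calc(2)[OF carr(1) yc xy uz w] .
    have d: "d = - (transpose_mat u * J)"
      using E2 carr J uz unfolding bw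
      by (auto simp: mat_eq_iff mc eq_neg_iff_add_eq_0 add.commute)
    have "J * Q z u * J = 0\<^sub>m n n"
      using E3 calc(5)[OF carr(1) yc xy uz w] by (simp add: b[symmetric] c[symmetric] d[symmetric])
    then have "J * (J * Q z u * J) * J = 0\<^sub>m n n" using J by simp
    then have "Q z u = 0\<^sub>m n n" using J Qc[OF uz(2,1)] by (simp add: as mc JJ[of _ n])
    then show ?R
      using xu yc xy uz cond[OF uz(2,1)] A b c d w by blast
  next
    assume ?R
    then obtain x y u z where xu: "x \<in> unitriangular n" and y: "y \<in> carrier_mat n n" and xy: "x * y = 1\<^sub>m n"
      and u: "u \<in> carrier_mat n r" and z: "z \<in> carrier_mat n n" and Q: "Q z u = 0\<^sub>m n n"
      and A: "A = block3 n r x (x * u) (x * z)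
             (0\<^sub>m r n) (1\<^sub>m r) (- (transpose_mat u * J))
             (0\<^sub>m n n) (0\<^sub>m n r) (J * transpose_mat y * J)"
      using cond by blast
    note x = unitriangularD(1)[OF xu]
    define w where "w = J * transpose_mat y * J"
    note cc = calc[OF x y xy u z w_def]
    have carr: "x * u \<in> carrier_mat n r" "x * z \<in> carrier_mat n n"
      "- (transpose_mat u * J) \<in> carrier_mat r n" "w \<in> carrier_mat n n"
      using x y u z J by (simp_all add: mc w_def)
    have h: "s \<cdot>\<^sub>m (J * u) + transpose_mat (- (transpose_mat u * J)) = 0\<^sub>m n r"
    proof -
      have "transpose_mat (- (transpose_mat u * J)) = - (J * u)"
        using u J by (simp add: transpose_uminus tr)
      moreover have "s \<cdot>\<^sub>m (J * u) + - (J * u) = 0\<^sub>m n r"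
        using u J by (intro eq_matI) (auto simp: s_def r_def mid_def split: if_splits)
      ultimately show ?thesis by simp
    qed
    have f: "transpose_mat u * J + - (transpose_mat u * J) = 0\<^sub>m r n"
      using u J by (intro eq_matI) auto
    have "transpose_mat A * form_mat t n * A = form_mat t n"
      unfolding A w_def[symmetric] blocks[OF x carr] cc h f Q
      using J by (simp add: form)
    moreover have "A \<in> unitriangular (n + r + n)"
    proof -
      have wu: "w \<in> unitriangular n"
        unfolding w_def J_def by (intro unitriangular_antitranspose unitriangular_inverse[OF xu y xy])
      show ?thesis
        using unitriangularD[OF xu] unitriangularD[OF wu]
        by (auto simp: unitriangular_def A w_def[symmetric] block3_def intro!: upper_triangularI)
    qed
    ultimately show "A \<in> unip t n"
      by (auto simp: unip_def classical_group_def m unitriangularD(1))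
  qed
qed

end

theory Submission
  imports Defs "HOL-Number_Theory.Residues"
begin

text \<open>Since \<open>p\<close> is odd, the Cayley transform \<open>g \<mapsto> (g - 1) (g + 1)\<^sup>-\<^sup>1\<close> is a bijection from \<open>U\<close> to the space
  of strictly upper triangular matrices that are skew for the form, and it commutes with conjugation
  by \<open>U\<close>. It turns the conditions defining \<open>U\<^sub>\<alpha>\<close> into linear ones and \<open>\<lambda>\<^sub>\<alpha>\<^sub>,\<^sub>r\<close> into an additive character,
  so writing the indicator function of \<open>U\<^sub>\<alpha>\<close> as a sum of additive characters expresses each elementary
  character, and hence each supercharacter, as a multiple of a sum of functions \<open>\<vartheta> \<circ> L\<close> for linear
  forms \<open>L\<close> on that space. These functions are orthogonal for distinct forms. Evaluated on the skew parts
  of matrices \<open>X Y\<^sup>T\<close>, the forms that occur in \<open>\<xi>\<^sub>D\<^sub>,\<^sub>\<phi>\<close> are sums of rank one forms whose corners are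
  the entries of \<open>D\<close>, with corner values given by \<open>\<phi>\<close>, and such a sum determines \<open>(D, \<phi>)\<close>.\<close>

text \<open>The map \<open>g -> g - 1\<close> does not send \<open>U\<close> onto a linear space,
  and an exponential would need a characteristic that is large compared with \<open>m\<close>; the
  Cayley transform only divides by 2. The conjugating elements in Frobenius' formula vary
  independently for the different roots, so the linear forms cannot be normalised simultaneously.
  What survives is triangularity: the form \<open>a |-> (x a x^-1)_ij\<close> takes
  \<open>X Y^T\<close> to (row \<open>i\<close> of \<open>x\<close>, applied to \<open>X\<close>)
  times (column \<open>j\<close> of \<open>x^-1\<close>, applied to \<open>Y\<close>), where the row
  begins and the column ends with a 1 on the diagonal. The zero conditions of
  \<open>unip_root\<close> in the row of a corner lie to its left and share its left factor, so they
  merge with the corner into one rank one form without disturbing its value. The mirror term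
  subtracted in the skew part accounts for the second entry of a root, which is why both entries
  count in the notion of a basic set. Thus every form from one pair differs from every form from the
  other, without any description of orbits of forms.\<close>

section \<open>Staircase sums of rank one forms\<close>

text \<open>Back substitution: the unknown attached to the member of largest rank \<open>f\<close> does not occur in
  the equations of the others, so it can be solved for last.\<close>

lemma triangular_kernel:
  fixes w :: "'p \<Rightarrow> 'i \<Rightarrow> 'a::field" and f :: "'p \<Rightarrow> int"
  assumes "finite S" "finite I" "a \<in> I" "inj_on l S" "l ` S \<subseteq> I - {a}"
    and "\<And>p. p \<in> S \<Longrightarrow> w p (l p) \<noteq> 0"
    and "\<And>p q. p \<in> S \<Longrightarrow> q \<in> S \<Longrightarrow> p \<noteq> q \<Longrightarrow> f p \<le> f q \<Longrightarrow> w p (l q) = 0"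
  shows "\<exists>X. X a = 1 \<and> (\<forall>k. k \<notin> insert a (l ` S) \<longrightarrow> X k = 0) \<and>
    (\<forall>p\<in>S. (\<Sum>k\<in>I. w p k * X k) = 0)"
  using assms(1,4-)
proof (induction rule: finite_ranking_induct[where f = f])
  case empty
  show ?case by (intro exI[of _ "\<lambda>k. if k = a then 1 else 0"]) auto
next
  case (insert x S)
  show ?case
  proof (cases "x \<in> S")
    case True
    with insert show ?thesis by (simp add: insert_absorb)
  next
    case False
    have "\<exists>X. X a = 1 \<and> (\<forall>k. k \<notin> insert a (l ` S) \<longrightarrow> X k = 0) \<and>
        (\<forall>p\<in>S. (\<Sum>k\<in>I. w p k * X k) = 0)"
      using insert.prems by (intro insert.IH) (auto dest: inj_on_subset)
    then obtain X where X: "X a = 1" "\<forall>k. k \<notin> insert a (l ` S) \<longrightarrow> X k = 0"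
        "\<forall>p\<in>S. (\<Sum>k\<in>I. w p k * X k) = 0" by blast
    define Y where "Y = X(l x := - (\<Sum>k\<in>I - {l x}. w x k * X k) / w x (l x))"
    have lx: "l x \<in> I" "l x \<noteq> a" "w x (l x) \<noteq> 0" using insert.prems by auto
    have split: "(\<Sum>k\<in>I. w p k * Y k) = w p (l x) * Y (l x) + (\<Sum>k\<in>I - {l x}. w p k * X k)" for p
    proof -
      have "(\<Sum>k\<in>I. w p k * Y k) = w p (l x) * Y (l x) + (\<Sum>k\<in>I - {l x}. w p k * Y k)"
        using lx assms(2) by (simp add: sum.remove)
      also have "(\<Sum>k\<in>I - {l x}. w p k * Y k) = (\<Sum>k\<in>I - {l x}. w p k * X k)"
        by (intro sum.cong) (auto simp: Y_def)
      finally show ?thesis .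
    qed
    have "(\<Sum>k\<in>I. w x k * Y k) = 0" using lx by (simp add: split) (simp add: Y_def)
    moreover have "(\<Sum>k\<in>I. w p k * Y k) = 0" if "p \<in> S" for p
    proof -
      have 0: "w p (l x) = 0" using insert.prems(4)[of p x] insert.hyps(2) that False by auto
      have "(\<Sum>k\<in>I. w p k * X k) = (\<Sum>k\<in>I - {l x}. w p k * X k)"
        using lx assms(2) 0 by (simp add: sum.remove)
      with X(3) that show ?thesis by (simp add: split 0)
    qed
    ultimately show ?thesis using X lx by (intro exI[of _ Y]) (auto simp: Y_def)
  qed
qed

text \<open>\<open>E \<alpha>\<close> is a set of matrix positions. Each \<open>e \<in> E \<alpha>\<close> contributes the rank one form
  \<open>w \<alpha> e \<otimes> v \<alpha> e\<close>, supported weakly below and to the left of the corner \<open>e\<close>, with value \<open>c \<alpha> e\<close> at \<open>e\<close>.\<close>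

definition staircase where
  "staircase E D c w v \<longleftrightarrow> (\<forall>\<alpha>\<in>D. \<forall>e\<in>E \<alpha>. w \<alpha> e (fst e) = 1 \<and> (\<forall>k<fst e. w \<alpha> e k = 0) \<and>
     v \<alpha> e (snd e) = c \<alpha> e \<and> (\<forall>k>snd e. v \<alpha> e k = 0))"
  for E :: "'r \<Rightarrow> (nat \<times> nat) set" and c :: "'r \<Rightarrow> nat \<times> nat \<Rightarrow> 'a::field"

definition placement where
  "placement E D \<longleftrightarrow> (\<forall>\<alpha>\<in>D. \<forall>\<beta>\<in>D. \<forall>e\<in>E \<alpha>. \<forall>e'\<in>E \<beta>.
     fst e = fst e' \<or> snd e = snd e' \<longrightarrow> e = e' \<and> \<alpha> = \<beta>)"
  for E :: "'r \<Rightarrow> (nat \<times> nat) set"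

lemma staircaseD:
  assumes "staircase E D c w v" "\<alpha> \<in> D" "e \<in> E \<alpha>"
  shows "w \<alpha> e (fst e) = 1" "k < fst e \<Longrightarrow> w \<alpha> e k = 0"
    "v \<alpha> e (snd e) = c \<alpha> e" "snd e < k \<Longrightarrow> v \<alpha> e k = 0"
  using assms unfolding staircase_def by blast+

lemma placement_eq:
  assumes "placement E D" "\<alpha> \<in> D" "\<beta> \<in> D" "e \<in> E \<alpha>" "e' \<in> E \<beta>" "fst e = fst e' \<or> snd e = snd e'"
  shows "e = e'" "\<alpha> = \<beta>"
  using assms unfolding placement_def by blast+

definition rank_sum where
  "rank_sum m E D w v X Y =
     (\<Sum>\<alpha>\<in>D. \<Sum>e\<in>E \<alpha>. (\<Sum>k<m. w \<alpha> e k * X k) * (\<Sum>k<m. v \<alpha> e k * Y k))"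
  for E :: "'r \<Rightarrow> (nat \<times> nat) set" and X :: "nat \<Rightarrow> 'a::field"

lemma rank_sum_single:
  assumes fin: "finite D" "\<And>\<alpha>. \<alpha> \<in> D \<Longrightarrow> finite (E \<alpha>)"
    and "\<And>\<beta> e'. \<beta> \<in> D \<Longrightarrow> e' \<in> E \<beta> \<Longrightarrow> (\<beta>, e') \<noteq> (\<alpha>, e) \<Longrightarrow>
      (\<Sum>k<m. w \<beta> e' k * X k) * (\<Sum>k<m. v \<beta> e' k * Y k) = 0"
  shows "rank_sum m E D w v X Y = (if \<alpha> \<in> D \<and> e \<in> E \<alpha>
    then (\<Sum>k<m. w \<alpha> e k * X k) * (\<Sum>k<m. v \<alpha> e k * Y k) else 0)"
proof -
  define g where "g = (\<lambda>(\<beta>, e'). (\<Sum>k<m. w \<beta> e' k * X k) * (\<Sum>k<m. v \<beta> e' k * Y k))"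
  have "rank_sum m E D w v X Y = sum g (Sigma D E)"
    unfolding rank_sum_def g_def using fin by (subst sum.Sigma) auto
  also have "\<dots> = sum g (Sigma D E \<inter> {(\<alpha>, e)})"
  proof (intro sum.mono_neutral_right ballI)
    fix p assume p: "p \<in> Sigma D E - Sigma D E \<inter> {(\<alpha>, e)}"
    obtain \<beta> e' where "p = (\<beta>, e')" by (cases p)
    with p assms(3)[of \<beta> e'] show "g p = 0" by (auto simp: g_def)
  qed (use fin in auto)
  also have "\<dots> = (if \<alpha> \<in> D \<and> e \<in> E \<alpha> then g (\<alpha>, e) else 0)"
    by auto
  finally show ?thesis by (simp add: g_def)
qed

text \<open>\<open>Y\<close> is chosen to kill the forms of \<open>D\<close> with corner to the right of \<open>e\<close>, and \<open>X\<close> those of \<open>D'\<close>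
  with corner above \<open>e\<close>; evaluating the two equal forms at \<open>(X, Y)\<close> leaves only the corner \<open>e\<close>.\<close>

lemma staircase_step:
  fixes c c' :: "'r \<Rightarrow> nat \<times> nat \<Rightarrow> 'a::field"
  assumes fin: "finite D" "finite D'" "\<And>\<alpha>. finite (E \<alpha>)"
    and sub: "\<And>\<alpha> e. \<alpha> \<in> D \<union> D' \<Longrightarrow> e \<in> E \<alpha> \<Longrightarrow> fst e < n \<and> fst e < snd e \<and> snd e < m"
    and disj: "\<And>\<alpha> \<beta> e. \<alpha> \<in> D \<union> D' \<Longrightarrow> \<beta> \<in> D \<union> D' \<Longrightarrow> e \<in> E \<alpha> \<Longrightarrow> e \<in> E \<beta> \<Longrightarrow> \<alpha> = \<beta>"
    and pl: "placement E D" "placement E D'"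
    and st: "staircase E D c w v" "staircase E D' c' w' v'"
    and c: "\<And>\<alpha> e. \<alpha> \<in> D \<Longrightarrow> e \<in> E \<alpha> \<Longrightarrow> c \<alpha> e \<noteq> 0"
    and eq: "\<And>a X Y. a < n \<Longrightarrow> (\<forall>k>a. X k = 0) \<Longrightarrow> (\<forall>k\<le>a. Y k = 0) \<Longrightarrow>
      rank_sum m E D w v X Y = rank_sum m E D' w' v' X Y"
    and \<alpha>: "\<alpha> \<in> D" "e \<in> E \<alpha>"
    and last: "\<And>\<beta> e'. \<beta> \<in> D' \<Longrightarrow> e' \<in> E \<beta> \<Longrightarrow> fst e' = fst e \<Longrightarrow> snd e' \<le> snd e"
  shows "\<alpha> \<in> D' \<and> c' \<alpha> e = c \<alpha> e"
proof -
  obtain a b where e: "e = (a, b)" by (cases e)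
  have ab: "a < n" "a < b" "b < m" using sub[of \<alpha> e] \<alpha> e by auto
  define S where "S = {(\<beta>, e') \<in> Sigma D E. b < snd e'}"
  define S' where "S' = {(\<beta>, e') \<in> Sigma D' E. fst e' < a}"
  have finS: "finite S" "finite S'"
    by (rule finite_subset[of _ "Sigma D E"] finite_subset[of _ "Sigma D' E"];
        use fin in \<open>auto simp: S_def S'_def\<close>)+
  have "\<exists>Y. Y b = 1 \<and> (\<forall>k. k \<notin> insert b ((\<lambda>(\<beta>, e'). snd e') ` S) \<longrightarrow> Y k = 0) \<and>
    (\<forall>p\<in>S. (\<Sum>k\<in>{..<m}. (\<lambda>(\<beta>, e'). v \<beta> e') p k * Y k) = 0)"
  proof (rule triangular_kernel[where f = "\<lambda>(\<beta>, e'). int (snd e')"])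
    show "inj_on (\<lambda>(\<beta>, e'). snd e') S"
    proof (rule inj_onI)
      fix p q assume "p \<in> S" "q \<in> S" "(case p of (\<beta>, e') \<Rightarrow> snd e') = (case q of (\<beta>, e') \<Rightarrow> snd e')"
      moreover obtain \<beta> e1 \<gamma> e2 where "p = (\<beta>, e1)" "q = (\<gamma>, e2)" by (cases p, cases q)
      ultimately show "p = q"
        using placement_eq[OF pl(1), of \<beta> \<gamma> e1 e2] by (simp add: S_def)
    qed
    show "(\<lambda>(\<beta>, e'). v \<beta> e') p ((\<lambda>(\<beta>, e'). snd e') q) = 0"
      if p: "p \<in> S" "q \<in> S" "p \<noteq> q" "(case p of (\<beta>, e') \<Rightarrow> int (snd e')) \<le> (case q of (\<beta>, e') \<Rightarrow> int (snd e'))" for p q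
    proof -
      obtain \<beta> e1 \<gamma> e2 where pq: "p = (\<beta>, e1)" "q = (\<gamma>, e2)" by (cases p, cases q)
      have "snd e1 \<noteq> snd e2"
        using placement_eq[OF pl(1), of \<beta> \<gamma> e1 e2] p pq by (auto simp: S_def)
      then have "snd e1 < snd e2" using p(4) pq by auto
      then show ?thesis using staircaseD[OF st(1), of \<beta> e1] p pq by (auto simp: S_def)
    qed
    show "(\<lambda>(\<beta>, e'). v \<beta> e') p ((\<lambda>(\<beta>, e'). snd e') p) \<noteq> 0" if "p \<in> S" for p
      using that c staircaseD[OF st(1), of "fst p" "snd p"] by (auto simp: S_def split_beta)
  qed (use finS ab sub in \<open>auto simp: S_def\<close>)
  then obtain Y where Y: "Y b = 1" "\<And>k. k \<notin> insert b ((\<lambda>(\<beta>, e'). snd e') ` S) \<Longrightarrow> Y k = 0"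
    "\<And>\<beta> e'. (\<beta>, e') \<in> S \<Longrightarrow> (\<Sum>k<m. v \<beta> e' k * Y k) = 0" by fastforce
  \<comment> \<open>All pivot columns exceed \<open>b\<close>, so \<open>Y\<close> lives on columns
    from \<open>b\<close> on; in the same way \<open>X\<close> will live on rows up to
    \<open>a\<close>. As \<open>a < b\<close>, this meets the support conditions of the hypothesis
    \<open>eq\<close>.\<close>
  have Y0: "Y k = 0" if "k < b" for k using that by (intro Y(2)) (auto simp: S_def)
  have "\<exists>X. X a = 1 \<and> (\<forall>k. k \<notin> insert a ((\<lambda>(\<beta>, e'). fst e') ` S') \<longrightarrow> X k = 0) \<and>
    (\<forall>p\<in>S'. (\<Sum>k\<in>{..<m}. (\<lambda>(\<beta>, e'). w' \<beta> e') p k * X k) = 0)"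
  \<comment> \<open>The rank is negated because left factors vanish before their corner, whereas
    right factors vanish after it.\<close>
  proof (rule triangular_kernel[where f = "\<lambda>(\<beta>, e'). - int (fst e')"])
    show "inj_on (\<lambda>(\<beta>, e'). fst e') S'"
    proof (rule inj_onI)
      fix p q assume "p \<in> S'" "q \<in> S'" "(case p of (\<beta>, e') \<Rightarrow> fst e') = (case q of (\<beta>, e') \<Rightarrow> fst e')"
      moreover obtain \<beta> e1 \<gamma> e2 where "p = (\<beta>, e1)" "q = (\<gamma>, e2)" by (cases p, cases q)
      ultimately show "p = q"
        using placement_eq[OF pl(2), of \<beta> \<gamma> e1 e2] by (simp add: S'_def)
    qed
    show "(\<lambda>(\<beta>, e'). w' \<beta> e') p ((\<lambda>(\<beta>, e'). fst e') q) = 0"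
      if p: "p \<in> S'" "q \<in> S'" "p \<noteq> q" "(case p of (\<beta>, e') \<Rightarrow> - int (fst e')) \<le> (case q of (\<beta>, e') \<Rightarrow> - int (fst e'))" for p q
    proof -
      obtain \<beta> e1 \<gamma> e2 where pq: "p = (\<beta>, e1)" "q = (\<gamma>, e2)" by (cases p, cases q)
      have "fst e1 \<noteq> fst e2"
        using placement_eq[OF pl(2), of \<beta> \<gamma> e1 e2] p pq by (auto simp: S'_def)
      then have "fst e2 < fst e1" using p(4) pq by auto
      then show ?thesis using staircaseD[OF st(2), of \<beta> e1] p pq by (auto simp: S'_def)
    qed
    show "(\<lambda>(\<beta>, e'). w' \<beta> e') p ((\<lambda>(\<beta>, e'). fst e') p) \<noteq> 0" if "p \<in> S'" for p
      using that c staircaseD[OF st(2), of "fst p" "snd p"] by (auto simp: S'_def split_beta)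
  qed (use finS ab sub in \<open>auto simp: S'_def\<close>)
  then obtain X where X: "X a = 1" "\<And>k. k \<notin> insert a ((\<lambda>(\<beta>, e'). fst e') ` S') \<Longrightarrow> X k = 0"
    "\<And>\<beta> e'. (\<beta>, e') \<in> S' \<Longrightarrow> (\<Sum>k<m. w' \<beta> e' k * X k) = 0" by fastforce
  have X0: "X k = 0" if "a < k" for k using that by (intro X(2)) (auto simp: S'_def)
  have vY: "(\<Sum>k<m. u k * Y k) = (if q = b then u b else 0)" if "\<forall>k>q. u k = 0" "q \<le> b" for u q
  proof -
    have "(\<Sum>k<m. u k * Y k) = (\<Sum>k<m. if k = b then u b else 0)"
      using that Y0 Y(1) by (intro sum.cong) (auto simp: neq_iff)
    also have "\<dots> = u b" using ab by simp
    finally show ?thesis using that by auto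
  qed
  have wX: "(\<Sum>k<m. u k * X k) = (if q = a then u a else 0)" if "\<forall>k<q. u k = 0" "a \<le> q" for u q
  proof -
    have "(\<Sum>k<m. u k * X k) = (\<Sum>k<m. if k = a then u a else 0)"
      using that X0 X(1) by (intro sum.cong) (auto simp: neq_iff)
    also have "\<dots> = u a" using ab by simp
    finally show ?thesis using that by auto
  qed
  have 1: "rank_sum m E D w v X Y = c \<alpha> e"
  proof -
    have "rank_sum m E D w v X Y = (\<Sum>k<m. w \<alpha> e k * X k) * (\<Sum>k<m. v \<alpha> e k * Y k)"
    proof (subst rank_sum_single[where \<alpha> = \<alpha> and e = e])
      fix \<beta> e' assume b: "\<beta> \<in> D" "e' \<in> E \<beta>" "(\<beta>, e') \<noteq> (\<alpha>, e)"
      \<comment> \<open>On the side of \<open>D\<close>, \<open>Y\<close> alone isolates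
        \<open>e\<close>: any other corner lies in another column, and its right factor is killed by
        construction or ends before the support of \<open>Y\<close> starts.\<close>
      have ne: "snd e' \<noteq> b"
        using placement_eq[OF pl(1) b(1) \<alpha>(1) b(2) \<alpha>(2)] b(3) e by auto
      have "(\<Sum>k<m. v \<beta> e' k * Y k) = 0"
      proof (cases "b < snd e'")
        case True
        then show ?thesis using b by (intro Y(3)) (auto simp: S_def)
      next
        case False
        then show ?thesis using vY[of "snd e'" "v \<beta> e'"] ne staircaseD[OF st(1) b(1,2)] by auto
      qed
      then show "(\<Sum>k<m. w \<beta> e' k * X k) * (\<Sum>k<m. v \<beta> e' k * Y k) = 0" by simp
    qed (use fin \<alpha> in auto)
    also have "\<dots> = c \<alpha> e"
      using vY[of b "v \<alpha> e"] wX[of a "w \<alpha> e"] staircaseD[OF st(1) \<alpha>] by (auto simp: e)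
    finally show ?thesis .
  qed
  have 2: "rank_sum m E D' w' v' X Y = (if \<alpha> \<in> D' \<and> e \<in> E \<alpha> then c' \<alpha> e else 0)"
  proof -
    have "rank_sum m E D' w' v' X Y = (if \<alpha> \<in> D' \<and> e \<in> E \<alpha> then
       (\<Sum>k<m. w' \<alpha> e k * X k) * (\<Sum>k<m. v' \<alpha> e k * Y k) else 0)"
    proof (rule rank_sum_single)
      fix \<beta> e' assume b: "\<beta> \<in> D'" "e' \<in> E \<beta>" "(\<beta>, e') \<noteq> (\<alpha>, e)"
      have ne: "e' \<noteq> e" using disj[of \<beta> \<alpha> e] b \<alpha> by auto
      \<comment> \<open>\<open>Y\<close> was not adapted to \<open>D'\<close>, so here the rows
        decide. Corners above are killed by \<open>X\<close>, and corners below have left factors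
        starting after the support of \<open>X\<close>. In the row \<open>a\<close> itself,
        \<open>last\<close> puts the corner left of \<open>b\<close>, where \<open>Y\<close>
        vanishes.\<close>
      consider "fst e' < a" | "fst e' = a" | "a < fst e'" by linarith
      then show "(\<Sum>k<m. w' \<beta> e' k * X k) * (\<Sum>k<m. v' \<beta> e' k * Y k) = 0"
      proof cases
        case 1
        then have "(\<Sum>k<m. w' \<beta> e' k * X k) = 0" using b by (intro X(3)) (auto simp: S'_def)
        then show ?thesis by simp
      next
        case 2
        then have "snd e' \<le> b" using last[OF b(1,2)] e by simp
        moreover have "snd e' \<noteq> b" using ne 2 e by (cases e') auto
        ultimately have "(\<Sum>k<m. v' \<beta> e' k * Y k) = 0"
          using vY[of "snd e'" "v' \<beta> e'"] staircaseD[OF st(2) b(1,2)] by auto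
        then show ?thesis by simp
      next
        case 3
        then have "(\<Sum>k<m. w' \<beta> e' k * X k) = 0"
          using wX[of "fst e'" "w' \<beta> e'"] staircaseD[OF st(2) b(1,2)] by auto
        then show ?thesis by simp
      qed
    qed (use fin in auto)
    moreover have "(\<Sum>k<m. w' \<alpha> e k * X k) * (\<Sum>k<m. v' \<alpha> e k * Y k) = c' \<alpha> e" if "\<alpha> \<in> D'"
      using vY[of b "v' \<alpha> e"] wX[of a "w' \<alpha> e"] staircaseD[OF st(2) that \<alpha>(2)] by (auto simp: e)
    ultimately show ?thesis by simp
  qed
  have "c \<alpha> e = (if \<alpha> \<in> D' \<and> e \<in> E \<alpha> then c' \<alpha> e else 0)"
    using eq[of a X Y] X0 Y0 ab 1 2 by auto
  then show ?thesis using c[OF \<alpha>] \<alpha> by (auto split: if_splits)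
qed

text \<open>By induction on columns from right to left, a corner of \<open>D'\<close> in the row of \<open>e\<close> further to the
  right would also belong to \<open>D\<close>, where that row is already taken.\<close>

lemma staircase_unique:
  fixes c c' :: "'r \<Rightarrow> nat \<times> nat \<Rightarrow> 'a::field"
  assumes fin: "finite D" "finite D'" "\<And>\<alpha>. finite (E \<alpha>)"
    and sub: "\<And>\<alpha> e. \<alpha> \<in> D \<union> D' \<Longrightarrow> e \<in> E \<alpha> \<Longrightarrow> fst e < n \<and> fst e < snd e \<and> snd e < m"
    and disj: "\<And>\<alpha> \<beta> e. \<alpha> \<in> D \<union> D' \<Longrightarrow> \<beta> \<in> D \<union> D' \<Longrightarrow> e \<in> E \<alpha> \<Longrightarrow> e \<in> E \<beta> \<Longrightarrow> \<alpha> = \<beta>"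
    and pl: "placement E D" "placement E D'"
    and st: "staircase E D c w v" "staircase E D' c' w' v'"
    and c: "\<And>\<alpha> e. \<alpha> \<in> D \<Longrightarrow> e \<in> E \<alpha> \<Longrightarrow> c \<alpha> e \<noteq> 0" "\<And>\<alpha> e. \<alpha> \<in> D' \<Longrightarrow> e \<in> E \<alpha> \<Longrightarrow> c' \<alpha> e \<noteq> 0"
    and eq: "\<And>a X Y. a < n \<Longrightarrow> (\<forall>k>a. X k = 0) \<Longrightarrow> (\<forall>k\<le>a. Y k = 0) \<Longrightarrow>
      rank_sum m E D w v X Y = rank_sum m E D' w' v' X Y"
    and e: "e \<in> E \<alpha>"
  shows "(\<alpha> \<in> D \<longrightarrow> \<alpha> \<in> D' \<and> c' \<alpha> e = c \<alpha> e) \<and> (\<alpha> \<in> D' \<longrightarrow> \<alpha> \<in> D)"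
  using e
proof (induction "m - snd e" arbitrary: \<alpha> e rule: less_induct)
  case less
  have IH: "\<beta> \<in> D \<longleftrightarrow> \<beta> \<in> D'" if "\<beta> \<in> D \<union> D'" "e' \<in> E \<beta>" "snd e < snd e'" for \<beta> e'
    using less.hyps[of e' \<beta>] that sub[of \<beta> e'] by auto
  have sub': "\<And>\<alpha> e. \<alpha> \<in> D' \<union> D \<Longrightarrow> e \<in> E \<alpha> \<Longrightarrow> fst e < n \<and> fst e < snd e \<and> snd e < m"
    using sub by blast
  have disj': "\<And>\<alpha> \<beta> e. \<alpha> \<in> D' \<union> D \<Longrightarrow> \<beta> \<in> D' \<union> D \<Longrightarrow> e \<in> E \<alpha> \<Longrightarrow> e \<in> E \<beta> \<Longrightarrow> \<alpha> = \<beta>"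
    using disj by blast
  show ?case
  proof (intro conjI impI)
    assume "\<alpha> \<in> D"
    have last: "snd e' \<le> snd e" if "\<beta> \<in> D'" "e' \<in> E \<beta>" "fst e' = fst e" for \<beta> e'
    proof (rule ccontr)
      assume "\<not> ?thesis"
      then have "\<beta> \<in> D" using IH[of \<beta> e'] that by auto
      then have "e' = e"
        using placement_eq(1)[OF pl(1) _ \<open>\<alpha> \<in> D\<close> _ less.prems] that by blast
      with \<open>\<not> ?thesis\<close> show False by simp
    qed
    have "\<alpha> \<in> D' \<and> c' \<alpha> e = c \<alpha> e"
      by (rule staircase_step[where E = E and D = D and D' = D' and c = c and c' = c' and w = w and v = v
        and w' = w' and v' = v' and n = n and m = m])
        (assumption | rule fin sub disj pl st c(1) eq \<open>\<alpha> \<in> D\<close> less.prems last)+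
    then show "\<alpha> \<in> D'" "c' \<alpha> e = c \<alpha> e" by auto
  next
    assume "\<alpha> \<in> D'"
    have last: "snd e' \<le> snd e" if "\<beta> \<in> D" "e' \<in> E \<beta>" "fst e' = fst e" for \<beta> e'
    proof (rule ccontr)
      assume "\<not> ?thesis"
      then have "\<beta> \<in> D'" using IH[of \<beta> e'] that by auto
      then have "e' = e"
        using placement_eq(1)[OF pl(2) _ \<open>\<alpha> \<in> D'\<close> _ less.prems] that by blast
      with \<open>\<not> ?thesis\<close> show False by simp
    qed
    have "\<alpha> \<in> D \<and> c \<alpha> e = c' \<alpha> e"
      by (rule staircase_step[where E = E and D = D' and D' = D and c = c' and c' = c and w = w' and v = v'
        and w' = w and v' = v and n = n and m = m])
        (assumption | rule fin sub' disj' pl st c(2) eq[symmetric] \<open>\<alpha> \<in> D'\<close> less.prems last)+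
    then show "\<alpha> \<in> D" by auto
  qed
qed

section \<open>The Cayley transform\<close>

text \<open>The nonzero entry in row \<open>i\<close> of \<open>form_mat\<close>.\<close>

definition form_sgn :: "ctype \<Rightarrow> nat \<Rightarrow> nat \<Rightarrow> 'a::field" where
  "form_sgn t n i = (if t = Symplectic \<and> n \<le> i then -1 else 1)"

lemma form_sgn_square [simp]: "form_sgn t n i * form_sgn t n i = 1"
  "form_sgn t n i * (form_sgn t n i * x) = x"
  by (auto simp: form_sgn_def)

text \<open>In the symplectic case reflection swaps the two halves and so flips both signs;
  otherwise all signs are 1.\<close>

lemma form_sgn_mirror:
  "i < msize t n \<Longrightarrow> j < msize t n \<Longrightarrow>
    form_sgn t n (msize t n - Suc i) * form_sgn t n (msize t n - Suc j) = (form_sgn t n i * form_sgn t n j :: 'a::field)"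
  by (auto simp: form_sgn_def msize_def mid_def)

lemma form_mat_carrier [simp]: "form_mat t n \<in> carrier_mat (msize t n) (msize t n)"
  by (simp add: form_mat_def)

lemma form_mat_dim [simp]: "dim_row (form_mat t n) = msize t n" "dim_col (form_mat t n) = msize t n"
  by (simp_all add: form_mat_def)

lemma form_mat_mult_entry:
  assumes "A \<in> carrier_mat (msize t n) (msize t n)" "i < msize t n" "j < msize t n"
  shows "(form_mat t n * A) $$ (i, j) = form_sgn t n i * (A $$ (msize t n - Suc i, j) :: 'a::field)"
proof -
  have "(form_mat t n * A) $$ (i, j) = (\<Sum>k<msize t n. form_mat t n $$ (i, k) * A $$ (k, j))"
    using assms by (simp add: form_mat_def scalar_prod_def lessThan_atLeast0)
  also have "\<dots> = (\<Sum>k<msize t n. if k = msize t n - Suc i then form_sgn t n i * A $$ (k, j) else 0)"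
    using assms by (intro sum.cong) (auto simp: form_mat_def form_sgn_def)
  finally show ?thesis using assms by simp
qed

lemma mult_form_mat_entry:
  assumes "A \<in> carrier_mat (msize t n) (msize t n)" "i < msize t n" "j < msize t n"
  shows "(A * form_mat t n) $$ (i, j) = (A $$ (i, msize t n - Suc j) * form_sgn t n (msize t n - Suc j) :: 'a::field)"
proof -
  have "(A * form_mat t n) $$ (i, j) = (\<Sum>k<msize t n. A $$ (i, k) * form_mat t n $$ (k, j))"
    using assms by (simp add: form_mat_def scalar_prod_def lessThan_atLeast0)
  also have "\<dots> = (\<Sum>k<msize t n. if k = msize t n - Suc j then A $$ (i, k) * form_sgn t n k else 0)"
    using assms by (intro sum.cong) (auto simp: form_mat_def form_sgn_def)
  finally show ?thesis using assms by simp
qed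

section \<open>Entries of inverses and skewness for the form\<close>

lemma unip_carrier: "x \<in> unip t n \<Longrightarrow> x \<in> carrier_mat (msize t n) (msize t n)"
  by (simp add: unip_def classical_group_def)

text \<open>An isometry satisfies \<open>K x^-1 = x^T K\<close>, and \<open>K\<close> is
  anti-diagonal with signs, so inversion is reflection in the anti-diagonal up to signs.\<close>

lemma unip_inverse_entry:
  assumes x: "x \<in> unip t n" and y: "y \<in> carrier_mat (msize t n) (msize t n)" and xy: "x * y = 1\<^sub>m (msize t n)"
    and kl: "k < msize t n" "l < msize t n"
  shows "y $$ (k, l) = form_sgn t n k * form_sgn t n l * (x $$ (msize t n - Suc l, msize t n - Suc k) :: 'a::field)"
proof -
  let ?m = "msize t n" and ?K = "form_mat t n :: 'a mat"
  have xc: "x \<in> carrier_mat ?m ?m" and eq: "transpose_mat x * ?K * x = ?K"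
    using x by (auto simp: unip_def classical_group_def)
  have "?K * y = transpose_mat x * ?K * x * y" by (simp add: eq)
  also have "\<dots> = transpose_mat x * ?K * (x * y)"
    using xc y by (intro assoc_mult_mat[of _ ?m ?m _ ?m _ ?m]) auto
  also have "\<dots> = transpose_mat x * ?K" using xc by (simp add: xy right_mult_one_mat[of _ ?m ?m] mult_carrier_mat[of _ ?m ?m _ ?m])
  finally have e: "?K * y = transpose_mat x * ?K" .
  let ?i = "?m - Suc k"
  have i: "?i < ?m" "?m - Suc ?i = k" using kl by auto
  have "form_sgn t n ?i * y $$ (k, l) = (?K * y) $$ (?i, l)"
    using form_mat_mult_entry[OF y i(1) kl(2)] i by simp
  also have "\<dots> = transpose_mat x $$ (?i, ?m - Suc l) * form_sgn t n (?m - Suc l)"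
    unfolding e using mult_form_mat_entry[of "transpose_mat x" t n ?i l] xc i kl by simp
  also have "\<dots> = x $$ (?m - Suc l, ?i) * form_sgn t n (?m - Suc l)"
    using xc i kl by simp
  finally have "form_sgn t n ?i * (form_sgn t n ?i * y $$ (k, l)) =
      form_sgn t n ?i * form_sgn t n (?m - Suc l) * x $$ (?m - Suc l, ?i)"
    by (simp add: mult_ac)
  then show ?thesis using form_sgn_mirror[OF kl, where 'a='a] by simp
qed

definition lie :: "ctype \<Rightarrow> nat \<Rightarrow> 'a::field mat set" where
  "lie t n = {a \<in> carrier_mat (msize t n) (msize t n). (\<forall>i<msize t n. \<forall>j\<le>i. a $$ (i, j) = 0) \<and>
     transpose_mat a * form_mat t n + form_mat t n * a = 0\<^sub>m (msize t n) (msize t n)}"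

lemma lie_skew_iff:
  fixes a :: "'a::field mat"
  assumes a: "a \<in> carrier_mat (msize t n) (msize t n)"
  shows "transpose_mat a * form_mat t n + form_mat t n * a = 0\<^sub>m (msize t n) (msize t n) \<longleftrightarrow>
    (\<forall>i<msize t n. \<forall>j<msize t n.
      a $$ (msize t n - Suc j, i) * form_sgn t n (msize t n - Suc j) + form_sgn t n i * a $$ (msize t n - Suc i, j) = 0)"
    (is "?M = 0\<^sub>m _ _ \<longleftrightarrow> _")
proof -
  let ?m = "msize t n"
  have "?M $$ (i, j) = a $$ (?m - Suc j, i) * form_sgn t n (?m - Suc j) + form_sgn t n i * a $$ (?m - Suc i, j)"
    if "i < ?m" "j < ?m" for i j
    using that a form_mat_mult_entry[OF a that] mult_form_mat_entry[of "transpose_mat a" t n i j]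
    by (simp del: index_mult_mat(1))
  moreover have "?M = 0\<^sub>m ?m ?m \<longleftrightarrow> (\<forall>i<?m. \<forall>j<?m. ?M $$ (i, j) = 0)"
    using a by (auto simp: mat_eq_iff simp del: index_mult_mat(1) index_add_mat(1))
  ultimately show ?thesis by auto
qed

lemma lie_carrier: "a \<in> lie t n \<Longrightarrow> a \<in> carrier_mat (msize t n) (msize t n)"
  by (simp add: lie_def)

text \<open>The relation \<open>a (g + 1) = g - 1 = (g + 1) a\<close> without the inverse. It can be
  solved for either matrix, and its two sides expand entries of \<open>g\<close> along rows of
  \<open>a\<close> or along rows of \<open>g\<close>.\<close>

definition cayley_pair :: "nat \<Rightarrow> 'a::field mat \<Rightarrow> 'a mat \<Rightarrow> bool" where
  "cayley_pair m g a \<longleftrightarrow> g \<in> carrier_mat m m \<and> a \<in> carrier_mat m m \<and>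
     a * g + a = g - 1\<^sub>m m \<and> g * a + a = g - 1\<^sub>m m"

lemma cayley_pair_left_unique:
  assumes 2: "(2::'a::field) \<noteq> 0" and g: "g \<in> unitriangular m" and a: "cayley_pair m g a" "cayley_pair m g (b :: 'a mat)"
  shows "a = b"
proof -
  note gD = unitriangularD[OF g]
  have c: "g \<in> carrier_mat m m" "a \<in> carrier_mat m m" "b \<in> carrier_mat m m"
    using a by (auto simp: cayley_pair_def)
  \<comment> \<open>Halving turns the diagonal entries 2 of \<open>g + 1\<close> into 1, so the
    inverse of a unitriangular matrix can be used.\<close>
  have "inverse 2 \<cdot>\<^sub>m (g + 1\<^sub>m m) \<in> unitriangular m"
    using 2 gD by (auto simp: unitriangular_def field_simps intro!: upper_triangularI)
  then obtain C where C: "C \<in> carrier_mat m m" "C * (inverse 2 \<cdot>\<^sub>m (g + 1\<^sub>m m)) = 1\<^sub>m m"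
    using unitriangular_invertible by blast
  have *: "u = C * (inverse 2 \<cdot>\<^sub>m (g - 1\<^sub>m m))" if "cayley_pair m g u" for u
  proof -
    have u: "u \<in> carrier_mat m m" "g * u + u = g - 1\<^sub>m m" using that by (auto simp: cayley_pair_def)
    have "(inverse 2 \<cdot>\<^sub>m (g + 1\<^sub>m m)) * u = inverse 2 \<cdot>\<^sub>m (g * u + u)"
      using c u by (simp add: mult_smult_assoc_mat[of _ m m _ m] add_mult_distrib_mat[of _ m m _ _ m])
    then have "C * ((inverse 2 \<cdot>\<^sub>m (g + 1\<^sub>m m)) * u) = C * (inverse 2 \<cdot>\<^sub>m (g - 1\<^sub>m m))"
      by (simp add: u)
    then show ?thesis
      using assoc_mult_mat[OF C(1) _ u(1), of "inverse 2 \<cdot>\<^sub>m (g + 1\<^sub>m m)"] C c u by simp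
  qed
  show ?thesis using *[OF a(1)] *[OF a(2)] by simp
qed

lemma one_minus_unitriangular:
  assumes "a \<in> carrier_mat m m" "\<And>i j. i < m \<Longrightarrow> j \<le> i \<Longrightarrow> a $$ (i, j) = 0"
  shows "1\<^sub>m m - a \<in> unitriangular m"
  using assms by (auto simp: unitriangular_def intro!: upper_triangularI)

text \<open>Rearranged, the relation reads \<open>(1 - a) g = 1 + a\<close>, and
  \<open>1 - a\<close> is unitriangular; this direction needs no division by 2.\<close>

lemma cayley_pair_right_unique:
  assumes a: "a \<in> carrier_mat m m" "\<And>i j. i < m \<Longrightarrow> j \<le> i \<Longrightarrow> a $$ (i, j) = 0"
    and g: "cayley_pair m g a" "cayley_pair m h a"
  shows "g = h"
proof -
  obtain B where B: "B \<in> carrier_mat m m" "B * (1\<^sub>m m - a) = 1\<^sub>m m"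
    using unitriangular_invertible[OF one_minus_unitriangular[OF a]] by blast
  have *: "u = B * (1\<^sub>m m + a)" if "cayley_pair m u a" for u
  proof -
    have u: "u \<in> carrier_mat m m" "a * u + a = u - 1\<^sub>m m" using that by (auto simp: cayley_pair_def)
    have "a $$ (i, j) + (a * u) $$ (i, j) = u $$ (i, j) - 1\<^sub>m m $$ (i, j)" if "i < m" "j < m" for i j
      using arg_cong[OF u(2), of "\<lambda>M. M $$ (i, j)"] u(1) a(1) that
      by (simp del: index_mult_mat(1) add: add.commute)
    then have "u - a * u = 1\<^sub>m m + a"
      using u a by (intro eq_matI) (auto simp del: index_mult_mat(1) simp: algebra_simps)
    then have "(1\<^sub>m m - a) * u = 1\<^sub>m m + a"
      using u a by (simp add: minus_mult_distrib_mat[of _ m m _ _ m])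
    then have "B * ((1\<^sub>m m - a) * u) = B * (1\<^sub>m m + a)" by simp
    then show ?thesis
      using assoc_mult_mat[OF B(1) _ u(1), of "1\<^sub>m m - a"] B a u
      by (simp add: minus_carrier_mat)
  qed
  show ?thesis using *[OF g(1)] *[OF g(2)] by simp
qed

lemma lie_strict: "a \<in> lie t n \<Longrightarrow> i < msize t n \<Longrightarrow> j \<le> i \<Longrightarrow> a $$ (i, j) = 0"
  by (simp add: lie_def)

text \<open>For \<open>C = 2 (g + 1)^-1\<close> one has \<open>g C = 2 - C\<close>. Since
  \<open>g\<close> is an isometry, the quadratic term below cancels against \<open>C^T K C\<close>,
  leaving a linear relation for \<open>C\<close>.\<close>

lemma two_one_minus_congruence:
  fixes C K :: "'a::field mat"
  assumes "C \<in> carrier_mat m m" "K \<in> carrier_mat m m"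
  shows "transpose_mat (2 \<cdot>\<^sub>m 1\<^sub>m m - C) * K * (2 \<cdot>\<^sub>m 1\<^sub>m m - C) =
    4 \<cdot>\<^sub>m K - 2 \<cdot>\<^sub>m (transpose_mat C * K + K * C) + transpose_mat C * K * C"
proof -
  have t: "transpose_mat (2 \<cdot>\<^sub>m 1\<^sub>m m - C) = 2 \<cdot>\<^sub>m 1\<^sub>m m - transpose_mat C"
    using assms by (intro eq_matI) auto
  have 1: "(2 \<cdot>\<^sub>m 1\<^sub>m m - transpose_mat C) * K = 2 \<cdot>\<^sub>m K - transpose_mat C * K"
    using assms by (simp add: minus_mult_distrib_mat[of _ m m _ _ m] mult_smult_assoc_mat[of _ m m _ m])
  have 2: "M * (2 \<cdot>\<^sub>m 1\<^sub>m m - C) = 2 \<cdot>\<^sub>m M - M * C" if "M \<in> carrier_mat m m" for M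
    using assms that by (simp add: mult_minus_distrib_mat[of _ m m _ m] mult_smult_distrib[of _ m m _ m] right_mult_one_mat[of _ m m])
  have "(2 \<cdot>\<^sub>m K - transpose_mat C * K) * (2 \<cdot>\<^sub>m 1\<^sub>m m - C) =
    2 \<cdot>\<^sub>m (2 \<cdot>\<^sub>m K - transpose_mat C * K) - (2 \<cdot>\<^sub>m K - transpose_mat C * K) * C"
    using assms by (intro 2) (auto intro!: mult_carrier_mat minus_carrier_mat)
  also have "(2 \<cdot>\<^sub>m K - transpose_mat C * K) * C = 2 \<cdot>\<^sub>m (K * C) - transpose_mat C * K * C"
    using assms by (simp add: minus_mult_distrib_mat[of _ m m _ _ m] mult_smult_assoc_mat[of _ m m _ m]
        mult_carrier_mat[of _ m m _ m])
  finally show ?thesis unfolding t 1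
    using assms by (intro eq_matI) (auto simp del: index_mult_mat(1) simp: algebra_simps)
qed

lemma mat_entry_eq: "A = B \<Longrightarrow> A $$ k = B $$ k" by simp

text \<open>With \<open>C = 2 (g + 1)\<^sup>-\<^sup>1\<close> the Cayley transform \<open>(g - 1) (g + 1)\<^sup>-\<^sup>1\<close> is \<open>1 - C\<close>; conversely
  \<open>(1 + a) (1 - a)\<^sup>-\<^sup>1 = 2 B - 1\<close> with \<open>B = (1 - a)\<^sup>-\<^sup>1\<close>.\<close>

lemma cayley_exists_lie:
  fixes g :: "'a::field mat"
  assumes 2: "(2::'a) \<noteq> 0" and g: "g \<in> unip t n"
  shows "\<exists>a\<in>lie t n. cayley_pair (msize t n) g a"
proof -
  let ?m = "msize t n" and ?K = "form_mat t n :: 'a mat"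
  have gu: "g \<in> unitriangular ?m" and gK: "transpose_mat g * ?K * g = ?K"
    using g by (auto simp: unip_def classical_group_def)
  note gD = unitriangularD[OF gu]
  have h: "inverse 2 \<cdot>\<^sub>m (g + 1\<^sub>m ?m) \<in> unitriangular ?m" (is "?h \<in> _")
    using 2 gD by (auto simp: unitriangular_def field_simps intro!: upper_triangularI)
  then obtain C where C: "C \<in> carrier_mat ?m ?m" "C * ?h = 1\<^sub>m ?m" "?h * C = 1\<^sub>m ?m"
    using unitriangular_invertible by blast
  have Cu: "C \<in> unitriangular ?m" using unitriangular_inverse[OF h C(1,3)] .
  note CD = unitriangularD[OF Cu]
  have "?h * C = inverse 2 \<cdot>\<^sub>m (g * C + C)" "C * ?h = inverse 2 \<cdot>\<^sub>m (C * g + C)"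
    using gD(1) C(1) by (simp_all add: mult_smult_assoc_mat[of _ ?m ?m _ ?m] mult_smult_distrib[of _ ?m ?m _ ?m]
        add_mult_distrib_mat[of _ ?m ?m _ _ ?m] mult_add_distrib_mat[of _ ?m ?m _ ?m] right_mult_one_mat[of _ ?m ?m] left_mult_one_mat[of _ ?m ?m])
  with C have e: "inverse 2 \<cdot>\<^sub>m (g * C + C) = 1\<^sub>m ?m" "inverse 2 \<cdot>\<^sub>m (C * g + C) = 1\<^sub>m ?m" by auto
  have gC: "g * C = 2 \<cdot>\<^sub>m 1\<^sub>m ?m - C"
  proof (rule eq_matI)
    fix i j assume "i < dim_row (2 \<cdot>\<^sub>m 1\<^sub>m ?m - C)" "j < dim_col (2 \<cdot>\<^sub>m 1\<^sub>m ?m - C)"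
    then show "(g * C) $$ (i, j) = (2 \<cdot>\<^sub>m 1\<^sub>m ?m - C) $$ (i, j)"
      using mat_entry_eq[OF e(1), of "(i, j)"] 2 C(1) gD(1)
      by (simp del: index_mult_mat(1) add: field_simps split: if_splits)
  qed (use C(1) gD(1) in auto)
  have Cg: "C * g = 2 \<cdot>\<^sub>m 1\<^sub>m ?m - C"
  proof (rule eq_matI)
    fix i j assume "i < dim_row (2 \<cdot>\<^sub>m 1\<^sub>m ?m - C)" "j < dim_col (2 \<cdot>\<^sub>m 1\<^sub>m ?m - C)"
    then show "(C * g) $$ (i, j) = (2 \<cdot>\<^sub>m 1\<^sub>m ?m - C) $$ (i, j)"
      using mat_entry_eq[OF e(2), of "(i, j)"] 2 C(1) gD(1)
      by (simp del: index_mult_mat(1) add: field_simps split: if_splits)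
  qed (use C(1) gD(1) in auto)
  define a where "a = 1\<^sub>m ?m - C"
  have ac: "a \<in> carrier_mat ?m ?m" using C(1) by (simp add: a_def minus_carrier_mat)
  have "a * g + a = g - 1\<^sub>m ?m" "g * a + a = g - 1\<^sub>m ?m"
    unfolding a_def using C(1) gD(1)
    by (simp_all add: minus_mult_distrib_mat[of _ ?m ?m _ _ ?m] mult_minus_distrib_mat[of _ ?m ?m _ ?m]
        right_mult_one_mat[of _ ?m ?m] left_mult_one_mat[of _ ?m ?m] minus_carrier_mat gC Cg) (auto intro!: eq_matI)
  then have pair: "cayley_pair ?m g a" using ac gD(1) by (simp add: cayley_pair_def)
  \<comment> \<open>This is precisely the skewness of \<open>1 - C\<close>.\<close>
  have KC: "transpose_mat C * ?K + ?K * C = 2 \<cdot>\<^sub>m ?K"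
  proof -
    have "transpose_mat (g * C) * ?K * (g * C) = transpose_mat C * (transpose_mat g * ?K * g) * C"
      using C(1) gD(1) by (simp add: transpose_mult[of _ ?m ?m _ ?m] assoc_mult_mat[of _ ?m ?m _ ?m _ ?m]
          mult_carrier_mat[of _ ?m ?m _ ?m])
    then have *: "4 \<cdot>\<^sub>m ?K - 2 \<cdot>\<^sub>m (transpose_mat C * ?K + ?K * C) + transpose_mat C * ?K * C = transpose_mat C * ?K * C"
      unfolding gC gK two_one_minus_congruence[OF C(1) form_mat_carrier] .
    show ?thesis
    proof (rule eq_matI)
      fix i j assume ij: "i < dim_row (2 \<cdot>\<^sub>m ?K)" "j < dim_col (2 \<cdot>\<^sub>m ?K)"
      have "4 * ?K $$ (i, j) = 2 * ((transpose_mat C * ?K) $$ (i, j) + (?K * C) $$ (i, j))"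
        using mat_entry_eq[OF *, of "(i, j)"] ij C(1) by (simp del: index_mult_mat(1))
      then have "2 * (2 * ?K $$ (i, j)) = 2 * ((transpose_mat C * ?K) $$ (i, j) + (?K * C) $$ (i, j))"
        by simp
      then have "2 * ?K $$ (i, j) = (transpose_mat C * ?K) $$ (i, j) + (?K * C) $$ (i, j)"
        using 2 mult_left_cancel[OF 2] by blast
      then show "(transpose_mat C * ?K + ?K * C) $$ (i, j) = (2 \<cdot>\<^sub>m ?K) $$ (i, j)"
        using ij C(1) by (simp del: index_mult_mat(1))
    qed (use C(1) in auto)
  qed
  have ta: "transpose_mat a = 1\<^sub>m ?m - transpose_mat C"
    using C(1) unfolding a_def by (intro eq_matI) auto
  have "transpose_mat a * ?K + ?K * a = (?K - transpose_mat C * ?K) + (?K - ?K * C)"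
    unfolding ta unfolding a_def using C(1)
    by (simp add: minus_mult_distrib_mat[of _ ?m ?m _ _ ?m] mult_minus_distrib_mat[of _ ?m ?m _ ?m]
        right_mult_one_mat[of _ ?m ?m] left_mult_one_mat[of _ ?m ?m])
  also have "\<dots> = 2 \<cdot>\<^sub>m ?K - (transpose_mat C * ?K + ?K * C)"
    using C(1) by (intro eq_matI) (auto simp del: index_mult_mat(1))
  also have "\<dots> = 0\<^sub>m ?m ?m" unfolding KC by (rule minus_r_inv_mat) simp
  finally have "a \<in> lie t n"
    using ac CD by (auto simp: lie_def a_def)
  with pair show ?thesis by blast
qed

lemma cayley_exists_unip:
  fixes a :: "'a::field mat"
  assumes a: "a \<in> lie t n"
  shows "\<exists>g\<in>unip t n. cayley_pair (msize t n) g a"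
proof -
  let ?m = "msize t n" and ?K = "form_mat t n :: 'a mat"
  note ac = lie_carrier[OF a] and as = lie_strict[OF a]
  have aK: "transpose_mat a * ?K + ?K * a = 0\<^sub>m ?m ?m" using a by (simp add: lie_def)
  have h: "1\<^sub>m ?m - a \<in> unitriangular ?m" using one_minus_unitriangular[OF ac as] .
  then obtain B where B: "B \<in> carrier_mat ?m ?m" "B * (1\<^sub>m ?m - a) = 1\<^sub>m ?m" "(1\<^sub>m ?m - a) * B = 1\<^sub>m ?m"
    using unitriangular_invertible by blast
  have Bu: "B \<in> unitriangular ?m" using unitriangular_inverse[OF h B(1,3)] .
  note BD = unitriangularD[OF Bu]
  have e: "B - a * B = 1\<^sub>m ?m" "B - B * a = 1\<^sub>m ?m"
    using B ac by (simp_all add: minus_mult_distrib_mat[of _ ?m ?m _ _ ?m] mult_minus_distrib_mat[of _ ?m ?m _ ?m]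
        right_mult_one_mat[of _ ?m ?m] left_mult_one_mat[of _ ?m ?m])
  have aB: "a * B = B - 1\<^sub>m ?m"
  proof (rule eq_matI)
    fix i j assume "i < dim_row (B - 1\<^sub>m ?m)" "j < dim_col (B - 1\<^sub>m ?m)"
    then show "(a * B) $$ (i, j) = (B - 1\<^sub>m ?m) $$ (i, j)"
      using mat_entry_eq[OF e(1), of "(i, j)"] B(1) ac
      by (simp del: index_mult_mat(1) add: algebra_simps split: if_splits)
  qed (use B(1) ac in auto)
  have Ba: "B * a = B - 1\<^sub>m ?m"
  proof (rule eq_matI)
    fix i j assume "i < dim_row (B - 1\<^sub>m ?m)" "j < dim_col (B - 1\<^sub>m ?m)"
    then show "(B * a) $$ (i, j) = (B - 1\<^sub>m ?m) $$ (i, j)"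
      using mat_entry_eq[OF e(2), of "(i, j)"] B(1) ac
      by (simp del: index_mult_mat(1) add: algebra_simps split: if_splits)
  qed (use B(1) ac in auto)
  define g where "g = 2 \<cdot>\<^sub>m B - 1\<^sub>m ?m"
  have gc: "g \<in> carrier_mat ?m ?m" using B(1) by (simp add: g_def minus_carrier_mat)
  have "a * g + a = g - 1\<^sub>m ?m" "g * a + a = g - 1\<^sub>m ?m"
    unfolding g_def using B(1) ac
    by (simp_all add: minus_mult_distrib_mat[of _ ?m ?m _ _ ?m] mult_minus_distrib_mat[of _ ?m ?m _ ?m]
        mult_smult_assoc_mat[of _ ?m ?m _ ?m] mult_smult_distrib[of _ ?m ?m _ ?m]
        right_mult_one_mat[of _ ?m ?m] left_mult_one_mat[of _ ?m ?m] minus_carrier_mat aB Ba) (auto intro!: eq_matI)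
  then have pair: "cayley_pair ?m g a" using ac gc by (simp add: cayley_pair_def)
  \<comment> \<open>Multiply the skewness relation by \<open>B^T\<close> and \<open>B\<close> and
    replace \<open>a B\<close> by \<open>B - 1\<close>. The result is what makes the expansion of
    the congruence by \<open>2 B - 1\<close> collapse to \<open>K\<close>.\<close>
  have KB: "2 \<cdot>\<^sub>m (transpose_mat B * ?K * B) = transpose_mat B * ?K + ?K * B"
  proof -
    have "0\<^sub>m ?m ?m = transpose_mat B * (transpose_mat a * ?K + ?K * a) * B"
      unfolding aK using B(1) by simp
    also have "\<dots> = transpose_mat (a * B) * ?K * B + transpose_mat B * ?K * (a * B)"
      using B(1) ac by (simp add: transpose_mult[of _ ?m ?m _ ?m] assoc_mult_mat[of _ ?m ?m _ ?m _ ?m]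
          mult_carrier_mat[of _ ?m ?m _ ?m] mult_add_distrib_mat[of _ ?m ?m _ ?m] add_mult_distrib_mat[of _ ?m ?m _ _ ?m])
    also have "transpose_mat (a * B) = transpose_mat B - 1\<^sub>m ?m"
      unfolding aB using B(1) by (intro eq_matI) auto
    also have "(transpose_mat B - 1\<^sub>m ?m) * ?K * B + transpose_mat B * ?K * (a * B)
       = (transpose_mat B * ?K * B - ?K * B) + (transpose_mat B * ?K * B - transpose_mat B * ?K)"
      unfolding aB using B(1) 
      by (simp add: minus_mult_distrib_mat[of _ ?m ?m _ _ ?m] mult_minus_distrib_mat[of _ ?m ?m _ ?m]
        mult_carrier_mat[of _ ?m ?m _ ?m] right_mult_one_mat[of _ ?m ?m] left_mult_one_mat[of _ ?m ?m])
    finally have *: "0\<^sub>m ?m ?m = \<dots>" .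
    show ?thesis
    proof (rule eq_matI)
      fix i j assume "i < dim_row (transpose_mat B * ?K + ?K * B)" "j < dim_col (transpose_mat B * ?K + ?K * B)"
      then show "(2 \<cdot>\<^sub>m (transpose_mat B * ?K * B)) $$ (i, j) = (transpose_mat B * ?K + ?K * B) $$ (i, j)"
        using mat_entry_eq[OF *, of "(i, j)"] B(1)
        by (simp del: index_mult_mat(1) add: algebra_simps)
    qed (use B(1) in auto)
  qed
  have "transpose_mat g * ?K * g = ?K"
  proof -
    have tg: "transpose_mat g = 2 \<cdot>\<^sub>m transpose_mat B - 1\<^sub>m ?m"
      unfolding g_def using B(1) by (intro eq_matI) auto
    have "transpose_mat g * ?K * g = (2 \<cdot>\<^sub>m transpose_mat B - 1\<^sub>m ?m) * ?K * (2 \<cdot>\<^sub>m B - 1\<^sub>m ?m)"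
      unfolding tg by (simp add: g_def)
    also have "\<dots> = 2 \<cdot>\<^sub>m (2 \<cdot>\<^sub>m (transpose_mat B * ?K * B) - ?K * B) - (2 \<cdot>\<^sub>m (transpose_mat B * ?K) - ?K)"
      using B(1)
      by (simp add: minus_mult_distrib_mat[of _ ?m ?m _ _ ?m] mult_minus_distrib_mat[of _ ?m ?m _ ?m]
        mult_smult_assoc_mat[of _ ?m ?m _ ?m] mult_smult_distrib[of _ ?m ?m _ ?m]
        mult_carrier_mat[of _ ?m ?m _ ?m] right_mult_one_mat[of _ ?m ?m] left_mult_one_mat[of _ ?m ?m] minus_carrier_mat)
    also have "\<dots> = ?K"
      unfolding KB using B(1) by (intro eq_matI) (auto simp del: index_mult_mat(1) simp: algebra_simps)
    finally show ?thesis .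
  qed
  moreover have "g \<in> unitriangular ?m"
    using BD gc by (auto simp: unitriangular_def g_def intro!: upper_triangularI)
  ultimately have "g \<in> unip t n" using gc by (auto simp: unip_def classical_group_def)
  with pair show ?thesis by blast
qed

section \<open>The Cayley transform as a bijection compatible with conjugation\<close>

definition cayley :: "ctype \<Rightarrow> nat \<Rightarrow> 'a::field mat \<Rightarrow> 'a mat" where
  "cayley t n g = (THE a. cayley_pair (msize t n) g a)"

lemma unip_unitriangular: "g \<in> unip t n \<Longrightarrow> g \<in> unitriangular (msize t n)"
  by (simp add: unip_def)

lemma cayley_eqI:
  fixes a :: "'a::field mat"
  assumes "(2::'a) \<noteq> 0" "g \<in> unip t n" "cayley_pair (msize t n) g a"
  shows "cayley t n g = a"
  unfolding cayley_def using assms cayley_pair_left_unique[OF assms(1) unip_unitriangular[OF assms(2)]] by blast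

lemma cayley:
  fixes g :: "'a::field mat"
  assumes "(2::'a) \<noteq> 0" "g \<in> unip t n"
  shows "cayley t n g \<in> lie t n" "cayley_pair (msize t n) g (cayley t n g)"
  using cayley_exists_lie[OF assms] cayley_eqI[OF assms] by auto

lemma bij_betw_cayley:
  assumes "(2::'a::field) \<noteq> 0"
  shows "bij_betw (cayley t n :: 'a mat \<Rightarrow> _) (unip t n) (lie t n)"
  unfolding bij_betw_def
proof
  show "inj_on (cayley t n :: 'a mat \<Rightarrow> _) (unip t n)"
  proof (rule inj_onI)
    fix g h :: "'a mat" assume gh: "g \<in> unip t n" "h \<in> unip t n" "cayley t n g = cayley t n h"
    show "g = h"
      using cayley[OF assms gh(1)] cayley[OF assms gh(2)] gh(3)
      by (intro cayley_pair_right_unique[OF lie_carrier lie_strict, of "cayley t n g" t n]) auto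
  qed
  show "cayley t n ` unip t n = (lie t n :: 'a mat set)"
    using cayley[OF assms] cayley_exists_unip[of _ t n] cayley_eqI[OF assms] by (fast intro: rev_image_eqI)
qed

text \<open>The relation between \<open>g\<close> and its transform is polynomial, so conjugation
  preserves it; uniqueness then identifies the transform of the conjugate.\<close>

lemma cayley_conj:
  fixes g :: "'a::field mat"
  assumes 2: "(2::'a) \<noteq> 0" and g: "g \<in> unip t n" "x * g * y \<in> unip t n"
    and x: "x \<in> carrier_mat (msize t n) (msize t n)" and y: "y \<in> carrier_mat (msize t n) (msize t n)"
    and yx: "y * x = 1\<^sub>m (msize t n)" "x * y = 1\<^sub>m (msize t n)"
  shows "cayley t n (x * g * y) = x * cayley t n g * y"
proof (rule cayley_eqI[OF 2 g(2)])
  let ?m = "msize t n"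
  define a where "a = cayley t n g"
  have a: "a \<in> carrier_mat ?m ?m" "g \<in> carrier_mat ?m ?m" "a * g + a = g - 1\<^sub>m ?m" "g * a + a = g - 1\<^sub>m ?m"
    using cayley(2)[OF 2 g(1)] by (auto simp: cayley_pair_def a_def)
  note s = assoc_mult_mat[of _ ?m ?m _ ?m _ ?m] mult_carrier_mat[of _ ?m ?m _ ?m]
  have yx': "y * (x * M) = M" if "M \<in> carrier_mat ?m ?m" for M
    using assoc_mult_mat[OF y x that] yx that by simp
  have "x * a * y * (x * g * y) + x * a * y = x * (a * g + a) * y"
    using a(1,2) x y by (simp add: s yx' mult_add_distrib_mat[of _ ?m ?m _ ?m] add_mult_distrib_mat[of _ ?m ?m _ _ ?m])
  moreover have "x * g * y * (x * a * y) + x * a * y = x * (g * a + a) * y"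
    using a(1,2) x y by (simp add: s yx' mult_add_distrib_mat[of _ ?m ?m _ ?m] add_mult_distrib_mat[of _ ?m ?m _ _ ?m])
  moreover have "x * (g - 1\<^sub>m ?m) * y = x * g * y - 1\<^sub>m ?m"
    using a x y yx by (simp add: s mult_minus_distrib_mat[of _ ?m ?m _ ?m] minus_mult_distrib_mat[of _ ?m ?m _ _ ?m]
       right_mult_one_mat[of _ ?m ?m] left_mult_one_mat[of _ ?m ?m])
  ultimately show "cayley_pair ?m (x * g * y) (x * cayley t n g * y)"
    unfolding cayley_pair_def a_def[symmetric] using a x y by (simp add: s)
qed

section \<open>Skew matrices of rank two\<close>

text \<open>The rank one matrix \<open>X Y\<^sup>T\<close>, made skew for the form.\<close>

definition test_mat :: "ctype \<Rightarrow> nat \<Rightarrow> (nat \<Rightarrow> 'a::field) \<Rightarrow> (nat \<Rightarrow> 'a) \<Rightarrow> 'a mat" where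
  "test_mat t n X Y = mat (msize t n) (msize t n) (\<lambda>(k, l).
     X k * Y l - form_sgn t n k * form_sgn t n l * X (msize t n - Suc l) * Y (msize t n - Suc k))"

lemma test_mat_carrier [simp]: "test_mat t n X Y \<in> carrier_mat (msize t n) (msize t n)"
  by (simp add: test_mat_def)

text \<open>With \<open>X\<close> supported up to \<open>a\<close> and \<open>Y\<close> beyond
  \<open>a\<close>, the matrix \<open>X Y^T\<close> is strictly upper triangular, and reflection in
  the anti-diagonal preserves this. This is the origin of the support conditions in
  \<open>staircase_unique\<close>.\<close>

lemma test_mat_lie:
  fixes X Y :: "nat \<Rightarrow> 'a::field"
  assumes X: "\<forall>k>a. X k = 0" and Y: "\<forall>k\<le>a. Y k = 0"
  shows "test_mat t n X Y \<in> lie t n"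
proof -
  let ?m = "msize t n" and ?s = "form_sgn t n :: nat \<Rightarrow> 'a"
  have "test_mat t n X Y $$ (k, l) = 0" if "k < ?m" "l \<le> k" for k l
  proof -
    have "X k * Y l = 0" using X Y that by (cases "k \<le> a") auto
    moreover have "X (?m - Suc l) * Y (?m - Suc k) = 0" using X Y that by (cases "?m - Suc l \<le> a") auto
    ultimately show ?thesis using that by (auto simp: test_mat_def)
  qed
  moreover have "test_mat t n X Y $$ (?m - Suc j, i) * ?s (?m - Suc j) + ?s i * test_mat t n X Y $$ (?m - Suc i, j) = 0"
    if ij: "i < ?m" "j < ?m" for i j
  proof -
    have "?s i * (?s (?m - Suc i) * ?s j) = ?s (?m - Suc j)"
    proof -
      have "?s i * (?s (?m - Suc i) * ?s j) = ?s (?m - Suc i) * (?s i * ?s j)" by (simp only: mult_ac)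
      also have "\<dots> = ?s (?m - Suc i) * (?s (?m - Suc i) * ?s (?m - Suc j))"
        by (simp only: form_sgn_mirror[OF ij])
      finally show ?thesis by simp
    qed
    then have "?s i * (?s (?m - Suc i) * ?s j * X (?m - Suc j) * Y i) = ?s (?m - Suc j) * (X (?m - Suc j) * Y i)"
      by (metis mult.assoc)
    moreover have "?s (?m - Suc j) * (?s (?m - Suc j) * ?s i * X (?m - Suc i) * Y j) = ?s i * (X (?m - Suc i) * Y j)"
      by (simp add: mult.assoc)
    ultimately show ?thesis using ij by (auto simp: test_mat_def algebra_simps)
  qed
  ultimately show ?thesis
    using lie_skew_iff[OF test_mat_carrier, of t n X Y] by (simp add: lie_def)
qed

lemma mult_mat_entry:
  assumes "A \<in> carrier_mat m m" "B \<in> carrier_mat m m" "i < m" "j < m"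
  shows "(A * B) $$ (i, j) = (\<Sum>k<m. A $$ (i, k) * B $$ (k, j))"
  using assms by (simp add: scalar_prod_def lessThan_atLeast0)

text \<open>Conjugation by an isometry commutes with taking the skew part, and it maps
  \<open>X Y^T\<close> to \<open>V W^T\<close> with \<open>V = x X\<close> and
  \<open>W = x^-T Y\<close>.\<close>

lemma conj_test_mat_entry:
  fixes x :: "'a::field mat" and X Y :: "nat \<Rightarrow> 'a"
  assumes x: "x \<in> unip t n" and y: "y \<in> carrier_mat (msize t n) (msize t n)" and xy: "x * y = 1\<^sub>m (msize t n)"
    and pq: "p < msize t n" "q < msize t n"
  defines "V \<equiv> \<lambda>p. \<Sum>k<msize t n. x $$ (p, k) * X k" and "W \<equiv> \<lambda>q. \<Sum>k<msize t n. y $$ (k, q) * Y k"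
  shows "(x * test_mat t n X Y * y) $$ (p, q) = V p * W q -
    form_sgn t n p * form_sgn t n q * V (msize t n - Suc q) * W (msize t n - Suc p)"
proof -
  let ?m = "msize t n" and ?s = "form_sgn t n :: nat \<Rightarrow> 'a" and ?T = "test_mat t n X Y"
  note xc = unip_carrier[OF x]
  note inv = unip_inverse_entry[OF x y xy]
  have xT: "(x * ?T) $$ (p, l) = (\<Sum>k<?m. x $$ (p, k) * ?T $$ (k, l))" if "l < ?m" for l
    using xc pq that by (intro mult_mat_entry) auto
  have "(x * ?T * y) $$ (p, q) = (\<Sum>l<?m. (x * ?T) $$ (p, l) * y $$ (l, q))"
    using xc y pq by (intro mult_mat_entry) (auto intro!: mult_carrier_mat)
  also have "\<dots> = (\<Sum>l<?m. \<Sum>k<?m. x $$ (p, k) * X k * (y $$ (l, q) * Y l) -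
     ?s p * ?s q * (x $$ (?m - Suc q, ?m - Suc l) * X (?m - Suc l) * (y $$ (?m - Suc k, ?m - Suc p) * Y (?m - Suc k))))"
  proof (intro sum.cong refl)
    fix l assume l: "l \<in> {..<?m}"
    have "(x * ?T) $$ (p, l) * y $$ (l, q) = (\<Sum>k<?m. x $$ (p, k) * ?T $$ (k, l) * y $$ (l, q))"
      using l xT by (simp add: sum_distrib_right)
    also have "\<dots> = (\<Sum>k<?m. x $$ (p, k) * X k * (y $$ (l, q) * Y l) -
     ?s p * ?s q * (x $$ (?m - Suc q, ?m - Suc l) * X (?m - Suc l) * (y $$ (?m - Suc k, ?m - Suc p) * Y (?m - Suc k))))"
    proof (intro sum.cong refl)
      fix k assume k: "k \<in> {..<?m}"
      have kl: "k < ?m" "l < ?m" using k l by auto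
      have 1: "y $$ (?m - Suc k, ?m - Suc p) = ?s k * ?s p * x $$ (p, k)"
        using inv[of "?m - Suc k" "?m - Suc p"] kl pq form_sgn_mirror[of k t n p, where 'a='a] by simp
      have 2: "y $$ (l, q) = ?s l * ?s q * x $$ (?m - Suc q, ?m - Suc l)"
        using inv[of l q] kl pq by simp
      \<comment> \<open>The inverse formula trades the entries of \<open>x\<close> and
        \<open>y\<close> for mirrored entries of \<open>y\<close> and \<open>x\<close>: the signs at
        the summation indices disappear and those at the outer indices appear.\<close>
      have "x $$ (p, k) * (?s k * ?s l) * y $$ (l, q) =
          ?s p * ?s q * (x $$ (?m - Suc q, ?m - Suc l) * y $$ (?m - Suc k, ?m - Suc p))"
      proof -
        have "x $$ (p, k) * (?s k * ?s l) * y $$ (l, q) =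
            (?s l * ?s l) * (x $$ (p, k) * ?s k * ?s q * x $$ (?m - Suc q, ?m - Suc l))"
          unfolding 2 by (simp only: mult_ac)
        moreover have "?s p * ?s q * (x $$ (?m - Suc q, ?m - Suc l) * y $$ (?m - Suc k, ?m - Suc p)) =
            (?s p * ?s p) * (x $$ (p, k) * ?s k * ?s q * x $$ (?m - Suc q, ?m - Suc l))"
          unfolding 1 by (simp only: mult_ac)
        ultimately show ?thesis by (simp only: form_sgn_square)
      qed
      then have "x $$ (p, k) * (?s k * ?s l) * y $$ (l, q) * (X (?m - Suc l) * Y (?m - Suc k)) =
          ?s p * ?s q * (x $$ (?m - Suc q, ?m - Suc l) * y $$ (?m - Suc k, ?m - Suc p)) * (X (?m - Suc l) * Y (?m - Suc k))"
        by simp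
      moreover have "x $$ (p, k) * ?T $$ (k, l) * y $$ (l, q) =
        x $$ (p, k) * X k * (y $$ (l, q) * Y l) - x $$ (p, k) * (?s k * ?s l) * y $$ (l, q) * (X (?m - Suc l) * Y (?m - Suc k))"
        using kl by (simp add: test_mat_def algebra_simps)
      ultimately show "x $$ (p, k) * ?T $$ (k, l) * y $$ (l, q) = x $$ (p, k) * X k * (y $$ (l, q) * Y l) -
     ?s p * ?s q * (x $$ (?m - Suc q, ?m - Suc l) * X (?m - Suc l) * (y $$ (?m - Suc k, ?m - Suc p) * Y (?m - Suc k)))"
        by (simp only: mult_ac)
    qed
    finally show "(x * ?T) $$ (p, l) * y $$ (l, q) = (\<Sum>k<?m. x $$ (p, k) * X k * (y $$ (l, q) * Y l) -
     ?s p * ?s q * (x $$ (?m - Suc q, ?m - Suc l) * X (?m - Suc l) * (y $$ (?m - Suc k, ?m - Suc p) * Y (?m - Suc k))))" .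
  qed
  also have "\<dots> = (\<Sum>l<?m. \<Sum>k<?m. x $$ (p, k) * X k * (y $$ (l, q) * Y l)) -
     ?s p * ?s q * (\<Sum>l<?m. \<Sum>k<?m. x $$ (?m - Suc q, ?m - Suc l) * X (?m - Suc l) * (y $$ (?m - Suc k, ?m - Suc p) * Y (?m - Suc k)))"
    by (simp only: sum_subtractf sum_distrib_left)
  also have "(\<Sum>l<?m. \<Sum>k<?m. x $$ (p, k) * X k * (y $$ (l, q) * Y l)) = V p * W q"
    unfolding V_def W_def by (subst sum.swap) (simp only: sum_product)
  also have "(\<Sum>l<?m. \<Sum>k<?m. x $$ (?m - Suc q, ?m - Suc l) * X (?m - Suc l) * (y $$ (?m - Suc k, ?m - Suc p) * Y (?m - Suc k)))
     = (\<Sum>l<?m. x $$ (?m - Suc q, ?m - Suc l) * X (?m - Suc l)) * (\<Sum>k<?m. y $$ (?m - Suc k, ?m - Suc p) * Y (?m - Suc k))"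
    by (simp only: sum_product)
  also have "(\<Sum>l<?m. x $$ (?m - Suc q, ?m - Suc l) * X (?m - Suc l)) = V (?m - Suc q)"
    unfolding V_def by (rule sum.nat_diff_reindex)
  also have "(\<Sum>k<?m. y $$ (?m - Suc k, ?m - Suc p) * Y (?m - Suc k)) = W (?m - Suc p)"
    unfolding W_def by (rule sum.nat_diff_reindex[where g = "\<lambda>k. y $$ (k, ?m - Suc p) * Y k"])
  finally show ?thesis by (simp add: mult.assoc)
qed

text \<open>Triangularity cuts the matrix product down to indices between \<open>i\<close> and
  \<open>j\<close>, apart from one extreme term, which supplies the second copy of the entry of
  \<open>a\<close> and hence the factor 2.\<close>

lemma cayley_entry:
  fixes g :: "'a::field mat"
  assumes 2: "(2::'a) \<noteq> 0" and g: "g \<in> unip t n" and ij: "i < j" "j < msize t n"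
  defines "a \<equiv> cayley t n g"
  shows "g $$ (i, j) = 2 * a $$ (i, j) + (\<Sum>k\<in>{i<..<j}. a $$ (i, k) * g $$ (k, j))"
    and "g $$ (i, j) = 2 * a $$ (i, j) + (\<Sum>k\<in>{i<..<j}. g $$ (i, k) * a $$ (k, j))"
proof -
  let ?m = "msize t n"
  note gD = unitriangularD[OF unip_unitriangular[OF g]]
  have al: "a \<in> lie t n" and p: "a * g + a = g - 1\<^sub>m ?m" "g * a + a = g - 1\<^sub>m ?m"
    using cayley[OF 2 g] by (auto simp: a_def cayley_pair_def)
  note ac = lie_carrier[OF al] and as = lie_strict[OF al]
  have ins: "{i<..j} = insert j {i<..<j}" "{i..<j} = insert i {i<..<j}" using ij by auto
  have "(a * g) $$ (i, j) = (\<Sum>k<?m. a $$ (i, k) * g $$ (k, j))"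
    using ac gD(1) ij by (intro mult_mat_entry) auto
  also have "\<dots> = (\<Sum>k\<in>{i<..j}. a $$ (i, k) * g $$ (k, j))"
    using ij by (intro sum.mono_neutral_right) (auto simp: not_less gD as)
  also have "\<dots> = a $$ (i, j) + (\<Sum>k\<in>{i<..<j}. a $$ (i, k) * g $$ (k, j))"
    unfolding ins using ij gD by simp
  finally show "g $$ (i, j) = 2 * a $$ (i, j) + (\<Sum>k\<in>{i<..<j}. a $$ (i, k) * g $$ (k, j))"
    using mat_entry_eq[OF p(1), of "(i, j)"] ac gD(1) ij by (simp del: index_mult_mat(1))
  have "(g * a) $$ (i, j) = (\<Sum>k<?m. g $$ (i, k) * a $$ (k, j))"
    using ac gD(1) ij by (intro mult_mat_entry) auto
  also have "\<dots> = (\<Sum>k\<in>{i..<j}. g $$ (i, k) * a $$ (k, j))"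
    using ij by (intro sum.mono_neutral_right) (auto simp: not_less not_le gD as)
  also have "\<dots> = a $$ (i, j) + (\<Sum>k\<in>{i<..<j}. g $$ (i, k) * a $$ (k, j))"
    unfolding ins using ij gD by simp
  finally show "g $$ (i, j) = 2 * a $$ (i, j) + (\<Sum>k\<in>{i<..<j}. g $$ (i, k) * a $$ (k, j))"
    using mat_entry_eq[OF p(2), of "(i, j)"] ac gD(1) ij by (simp del: index_mult_mat(1))
qed

text \<open>The middle terms in \<open>cayley_entry\<close> only involve earlier entries of the same
  row. In an initial segment of zeros they vanish, so there the entries of \<open>g\<close> are
  twice those of its transform.\<close>

lemma cayley_row_zero_iff:
  fixes g :: "'a::field mat"
  assumes 2: "(2::'a) \<noteq> 0" and g: "g \<in> unip t n" and b: "b \<le> msize t n"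
  shows "(\<forall>k\<in>{i<..<b}. g $$ (i, k) = 0) \<longleftrightarrow> (\<forall>k\<in>{i<..<b}. cayley t n g $$ (i, k) = 0)"
proof
  assume z: "\<forall>k\<in>{i<..<b}. g $$ (i, k) = 0"
  show "\<forall>k\<in>{i<..<b}. cayley t n g $$ (i, k) = 0"
  proof
    fix k assume k: "k \<in> {i<..<b}"
    have "(\<Sum>l\<in>{i<..<k}. g $$ (i, l) * cayley t n g $$ (l, k)) = 0"
      using z k by (intro sum.neutral) auto
    then show "cayley t n g $$ (i, k) = 0" using cayley_entry(2)[OF 2 g, of i k] z k b 2 by auto
  qed
next
  assume z: "\<forall>k\<in>{i<..<b}. cayley t n g $$ (i, k) = 0"
  show "\<forall>k\<in>{i<..<b}. g $$ (i, k) = 0"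
  proof
    fix k assume k: "k \<in> {i<..<b}"
    have "(\<Sum>l\<in>{i<..<k}. cayley t n g $$ (i, l) * g $$ (l, k)) = 0"
      using z k by (intro sum.neutral) auto
    then show "g $$ (i, k) = 0" using cayley_entry(1)[OF 2 g, of i k] z k b by auto
  qed
qed

section \<open>Positions attached to a root\<close>

lemma roots_cases [consumes 1, case_names Minus Plus Long Short]:
  assumes "\<alpha> \<in> roots t n"
  obtains i j where "\<alpha> = Minus (int i) (int j)" "1 \<le> i" "i < j" "j \<le> n"
  | i j where "\<alpha> = Plus (int i) (int j)" "1 \<le> i" "i < j" "j \<le> n"
  | i where "\<alpha> = Long (int i)" "1 \<le> i" "i \<le> n" "t = Symplectic"
  | i where "\<alpha> = Short (int i)" "1 \<le> i" "i \<le> n" "t = OddOrthogonal"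
proof -
  have nat: "\<exists>k. l = int k \<and> 1 \<le> k" if "1 \<le> l" for l
    using that by (intro exI[of _ "nat l"]) auto
  consider i j where "\<alpha> = Minus i j" "1 \<le> i" "i < j" "j \<le> int n"
    | i j where "\<alpha> = Plus i j" "1 \<le> i" "i < j" "j \<le> int n"
    | i where "\<alpha> = Long i" "1 \<le> i" "i \<le> int n" "t = Symplectic"
    | i where "\<alpha> = Short i" "1 \<le> i" "i \<le> int n" "t = OddOrthogonal"
    using assms by (auto simp: roots_def split: ctype.splits)
  then show thesis
  proof cases
    case (1 i j)
    then show thesis using nat[of i] nat[of j] that(1) by force
  next
    case (2 i j)
    then show thesis using nat[of i] nat[of j] that(2) by force
  next
    case (3 i)
    then show thesis using nat[of i] that(3) by force
  next
    case (4 i)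
    then show thesis using nat[of i] that(4) by force
  qed
qed

text \<open>The conditions defining \<open>U\<^sub>\<alpha>\<close> are zeros in initial segments of rows: \<open>(p, b)\<close> stands for
  \<open>x\<^sub>p\<^sub>q = 0\<close> whenever \<open>p < q < b\<close> (positions counted from \<open>0\<close>).\<close>

fun root_rows :: "ctype \<Rightarrow> nat \<Rightarrow> root \<Rightarrow> (nat \<times> nat) set" where
  "root_rows t n (Minus i j) = {(nat i - 1, nat j - 1)}"
| "root_rows t n (Plus i j) = {(nat i - 1, n), (nat j - 1, n + mid t)}"
| "root_rows t n (Long i) = {(nat i - 1, n)}"
| "root_rows t n (Short i) = {(nat i - 1, n)}"

definition root_zeros :: "ctype \<Rightarrow> nat \<Rightarrow> root \<Rightarrow> (nat \<times> nat) set" where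
  "root_zeros t n \<alpha> = {(p, q). \<exists>b. (p, b) \<in> root_rows t n \<alpha> \<and> p < q \<and> q < b}"

definition dist_pos :: "ctype \<Rightarrow> nat \<Rightarrow> root \<Rightarrow> nat \<times> nat" where
  "dist_pos t n \<alpha> = (pos t n (fst (dist_entry \<alpha>)), pos t n (snd (dist_entry \<alpha>)))"

text \<open>On labels this is \<open>(i, j) |-> (-j, -i)\<close>: it exchanges the two entries of a
  root and fixes the single entry of \<open>Long i\<close>.\<close>

definition mirror :: "ctype \<Rightarrow> nat \<Rightarrow> nat \<times> nat \<Rightarrow> nat \<times> nat" where
  "mirror t n e = (msize t n - Suc (snd e), msize t n - Suc (fst e))"

text \<open>Test matrices \<open>X Y\<^sup>T\<close> with \<open>X\<close> supported in the first \<open>n\<close> rows suffice, so only the entries of a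
  root in these rows matter.\<close>

definition upper_entries :: "ctype \<Rightarrow> nat \<Rightarrow> root \<Rightarrow> (nat \<times> nat) set" where
  "upper_entries t n \<alpha> = {e \<in> {dist_pos t n \<alpha>, mirror t n (dist_pos t n \<alpha>)}. fst e < n}"

lemma dist_pos_simps:
  "1 \<le> i \<Longrightarrow> 1 \<le> j \<Longrightarrow> dist_pos t n (Minus (int i) (int j)) = (i - 1, j - 1)"
  "1 \<le> i \<Longrightarrow> 1 \<le> j \<Longrightarrow> j \<le> n \<Longrightarrow> dist_pos t n (Plus (int i) (int j)) = (i - 1, msize t n - j)"
  "1 \<le> i \<Longrightarrow> i \<le> n \<Longrightarrow> dist_pos t n (Long (int i)) = (i - 1, msize t n - i)"
  "1 \<le> i \<Longrightarrow> dist_pos t n (Short (int i)) = (i - 1, n)"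
  by (auto simp: dist_pos_def pos_def msize_def nat_diff_distrib)

lemma finite_upper_entries: "finite (upper_entries t n \<alpha>)"
  by (simp add: upper_entries_def)

lemma root_zeros_simps:
  "root_zeros t n (Minus i j) = {(p, q). p = nat i - 1 \<and> p < q \<and> q < nat j - 1}"
  "root_zeros t n (Plus i j) = {(p, q). p < q \<and> (p = nat i - 1 \<and> q < n \<or> p = nat j - 1 \<and> q < n + mid t)}"
  "root_zeros t n (Long i) = {(p, q). p = nat i - 1 \<and> p < q \<and> q < n}"
  "root_zeros t n (Short i) = {(p, q). p = nat i - 1 \<and> p < q \<and> q < n}"
  unfolding root_zeros_def by auto

lemma root_zeros_rows: "root_zeros t n \<alpha> = (\<Union>e\<in>root_rows t n \<alpha>. Pair (fst e) ` {fst e<..<snd e})"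
  by (force simp: root_zeros_def)

lemma finite_root_zeros: "finite (root_zeros t n \<alpha>)"
proof -
  have "finite (root_rows t n \<alpha>)" by (cases \<alpha>) auto
  then show ?thesis by (simp add: root_zeros_rows)
qed

lemma dist_pos_bounds:
  "\<alpha> \<in> roots t n \<Longrightarrow> fst (dist_pos t n \<alpha>) < n \<and> fst (dist_pos t n \<alpha>) < snd (dist_pos t n \<alpha>) \<and>
    snd (dist_pos t n \<alpha>) < msize t n"
  by (cases rule: roots_cases, assumption) (auto simp: dist_pos_simps msize_def mid_def)

lemma upper_entries_bounds:
  "\<alpha> \<in> roots t n \<Longrightarrow> e \<in> upper_entries t n \<alpha> \<Longrightarrow> fst e < n \<and> fst e < snd e \<and> snd e < msize t n"
  using dist_pos_bounds[of \<alpha> t n] by (auto simp: upper_entries_def mirror_def)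

lemma dist_pos_upper: "\<alpha> \<in> roots t n \<Longrightarrow> dist_pos t n \<alpha> \<in> upper_entries t n \<alpha>"
  using dist_pos_bounds[of \<alpha> t n] by (auto simp: upper_entries_def)

lemma upper_entries_rows:
  "\<alpha> \<in> roots t n \<Longrightarrow> e \<in> upper_entries t n \<alpha> \<Longrightarrow> e' \<in> upper_entries t n \<alpha> \<Longrightarrow> fst e = fst e' \<Longrightarrow> e = e'"
  by (cases rule: roots_cases, assumption)
     (auto simp: upper_entries_def mirror_def dist_pos_simps msize_def mid_def)

lemma root_rows_upper:
  assumes "\<alpha> \<in> roots t n" "(p, b) \<in> root_rows t n \<alpha>"
  shows "p < n" "b \<le> n + mid t" "\<exists>c. (p, c) \<in> upper_entries t n \<alpha> \<and> b \<le> c"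
  using assms(2)
  by (cases rule: roots_cases[OF assms(1)]; force simp: upper_entries_def mirror_def dist_pos_simps msize_def mid_def)+

text \<open>Each zero condition lies left of a corner of the same root in the same row, so it can be
  absorbed into the right factor there. The column bound sends its mirror image below row
  \<open>n\<close>, where test vectors vanish.\<close>

lemma root_zeros_upper:
  assumes "\<alpha> \<in> roots t n" "(p, q) \<in> root_zeros t n \<alpha>"
  shows "p < n" "q < n + mid t" "\<exists>c. (p, c) \<in> upper_entries t n \<alpha> \<and> q < c"
  using assms root_rows_upper[OF assms(1), of p] by (fastforce simp: root_zeros_def)+

text \<open>The second alternative, a zero of the mirrored column, is the reason why the \<open>(i, -i)\<close> and
  \<open>(i, -j)\<close> entries of \<open>g\<close> and of its Cayley transform remain proportional on \<open>U\<^sub>\<alpha>\<close>.\<close>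

lemma dist_row_zeros:
  assumes "\<alpha> \<in> roots t n" "fst (dist_pos t n \<alpha>) < k" "k < snd (dist_pos t n \<alpha>)"
  shows "(fst (dist_pos t n \<alpha>), k) \<in> root_zeros t n \<alpha> \<or>
    (msize t n - Suc (snd (dist_pos t n \<alpha>)), msize t n - Suc k) \<in> root_zeros t n \<alpha>"
  using assms(1)
proof (cases rule: roots_cases)
  case (Minus i j)
  with assms(2,3) show ?thesis by (simp add: dist_pos_simps root_zeros_simps)
next
  case (Plus i j)
  with assms(2,3) show ?thesis by (simp add: dist_pos_simps root_zeros_simps msize_def) linarith
next
  case (Long i)
  with assms(2,3) show ?thesis by (simp add: dist_pos_simps root_zeros_simps msize_def mid_def) linarith
next
  case (Short i)
  with assms(2,3) show ?thesis by (simp add: dist_pos_simps root_zeros_simps)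
qed

section \<open>The root subgroups and their linear characters under the Cayley transform\<close>

lemma unip_root_eq:
  assumes "\<alpha> \<in> roots t n"
  shows "unip_root t n \<alpha> = {x \<in> unip t n. \<forall>z\<in>root_zeros t n \<alpha>. x $$ z = (0 :: 'a::field)}"
proof -
  have row: "(\<forall>k. int i < k \<and> k < b \<longrightarrow> entry t n x (int i) k = 0) \<longleftrightarrow>
      (\<forall>q. i - 1 < q \<and> q < nat b - 1 \<longrightarrow> x $$ (i - 1, q) = 0)" (is "?A \<longleftrightarrow> ?B") if "1 \<le> i" for i b and x :: "'a mat"
  proof
    assume A: ?A
    show ?B
    proof (intro allI impI)
      fix q assume "i - 1 < q \<and> q < nat b - 1"
      then show "x $$ (i - 1, q) = 0" using A[rule_format, of "int q + 1"] that
        by (auto simp: entry_def pos_def nat_add_distrib less_diff_conv zless_nat_conj zless_nat_eq_int_zless)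
    qed
  next
    assume B: ?B
    show ?A
    proof (intro allI impI)
      fix k assume k: "int i < k \<and> k < b"
      then have "i - 1 < nat k - 1" "nat k - 1 < nat b - 1" using that by linarith+
      with k show "entry t n x (int i) k = 0" using B[rule_format, of "nat k - 1"] that
        by (simp add: entry_def pos_def)
    qed
  qed
  have row': "(\<forall>k. int i < k \<and> k \<le> int n \<longrightarrow> entry t n x (int i) k = 0) \<longleftrightarrow>
      (\<forall>q. i - 1 < q \<and> q < n \<longrightarrow> x $$ (i - 1, q) = 0)" if "1 \<le> i" for i and x :: "'a mat"
    using row[OF that, of "int n + 1" x] by (simp add: nat_add_distrib)
  \<comment> \<open>Label 0 sits at position \<open>n\<close> and exists only if
    \<open>mid t\<close> is 1, hence the bound \<open>n + mid t\<close>.\<close>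
  have row0: "(\<forall>l\<in>labels t n. int j \<prec> l \<and> l \<preceq> 0 \<longrightarrow> entry t n x (int j) l = 0) \<longleftrightarrow>
      (\<forall>q. j - 1 < q \<and> q < n + mid t \<longrightarrow> x $$ (j - 1, q) = 0)" if j: "1 \<le> j" "j \<le> n" for j and x :: "'a mat"
  proof -
    have "(\<forall>l\<in>labels t n. int j \<prec> l \<and> l \<preceq> 0 \<longrightarrow> entry t n x (int j) l = 0) \<longleftrightarrow>
      (\<forall>k. int j < k \<and> k \<le> int n \<longrightarrow> entry t n x (int j) k = 0) \<and> (t = OddOrthogonal \<longrightarrow> entry t n x (int j) 0 = 0)"
      using j by (auto simp: labels_def prec_def preceq_def)
    also have "\<dots> \<longleftrightarrow> (\<forall>q. j - 1 < q \<and> q < n \<longrightarrow> x $$ (j - 1, q) = 0) \<and> (t = OddOrthogonal \<longrightarrow> x $$ (j - 1, n) = 0)"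
      unfolding row'[OF j(1)] using j by (auto simp: entry_def pos_def)
    also have "\<dots> \<longleftrightarrow> (\<forall>q. j - 1 < q \<and> q < n + mid t \<longrightarrow> x $$ (j - 1, q) = 0)"
      using j by (auto simp: mid_def less_Suc_eq)
    finally show ?thesis .
  qed
  show ?thesis using assms
  proof (cases rule: roots_cases)
    case (Minus i j)
    from Minus show ?thesis by (auto simp: root_zeros_simps row)
  next
    case (Plus i j)
    from Plus show ?thesis by (auto simp: root_zeros_simps row' row0)
  next
    case (Long i)
    from Long(1-3) show ?thesis by (auto simp: root_zeros_simps row')
  next
    case (Short i)
    from Short(1-3) show ?thesis by (auto simp: root_zeros_simps row')
  qed
qed

lemma cayley_root_zeros_iff:
  fixes g :: "'a::field mat"
  assumes 2: "(2::'a) \<noteq> 0" and g: "g \<in> unip t n" and \<alpha>: "\<alpha> \<in> roots t n"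
  shows "(\<forall>z\<in>root_zeros t n \<alpha>. g $$ z = 0) \<longleftrightarrow> (\<forall>z\<in>root_zeros t n \<alpha>. cayley t n g $$ z = 0)"
proof -
  have *: "(\<forall>z\<in>root_zeros t n \<alpha>. M $$ z = 0) \<longleftrightarrow>
      (\<forall>e\<in>root_rows t n \<alpha>. \<forall>q\<in>{fst e<..<snd e}. M $$ (fst e, q) = 0)" for M :: "'a mat"
    by (simp add: root_zeros_rows)
  show ?thesis unfolding *
  proof (rule ball_cong[OF refl])
    fix e assume "e \<in> root_rows t n \<alpha>"
    then have "snd e \<le> msize t n" using root_rows_upper(2)[OF \<alpha>, of "fst e" "snd e"] by (simp add: msize_def)
    then show "(\<forall>q\<in>{fst e<..<snd e}. g $$ (fst e, q) = 0) \<longleftrightarrow>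
        (\<forall>q\<in>{fst e<..<snd e}. cayley t n g $$ (fst e, q) = 0)"
      by (rule cayley_row_zero_iff[OF 2 g])
  qed
qed

text \<open>In the expansion of the distinguished entry every middle term has a vanishing factor:
  either the entry of \<open>g\<close> is one of the required zeros, or skewness carries a mirrored
  zero to the entry of the transform.\<close>

lemma cayley_dist_pos:
  fixes g :: "'a::field mat"
  assumes 2: "(2::'a) \<noteq> 0" and g: "g \<in> unip t n" and \<alpha>: "\<alpha> \<in> roots t n"
    and z: "\<forall>z\<in>root_zeros t n \<alpha>. g $$ z = 0"
  shows "g $$ dist_pos t n \<alpha> = 2 * cayley t n g $$ dist_pos t n \<alpha>"
proof -
  obtain i j where d: "dist_pos t n \<alpha> = (i, j)" by (cases "dist_pos t n \<alpha>")
  have ij: "i < j" "j < msize t n" using dist_pos_bounds[OF \<alpha>] d by auto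
  note al = cayley(1)[OF 2 g]
  have z': "\<forall>z\<in>root_zeros t n \<alpha>. cayley t n g $$ z = 0"
    using z cayley_root_zeros_iff[OF 2 g \<alpha>] by blast
  have "g $$ (i, k) * cayley t n g $$ (k, j) = 0" if k: "k \<in> {i<..<j}" for k
  proof -
    have "(i, k) \<in> root_zeros t n \<alpha> \<or> (msize t n - Suc j, msize t n - Suc k) \<in> root_zeros t n \<alpha>"
      using dist_row_zeros[OF \<alpha>, of k] d k by auto
    then show ?thesis
    proof
      assume "(msize t n - Suc j, msize t n - Suc k) \<in> root_zeros t n \<alpha>"
      with z' have a0: "cayley t n g $$ (msize t n - Suc j, msize t n - Suc k) = 0" by blast
      have "\<forall>i<msize t n. \<forall>j<msize t n.
      cayley t n g $$ (msize t n - Suc j, i) * form_sgn t n (msize t n - Suc j) + form_sgn t n i * cayley t n g $$ (msize t n - Suc i, j) = 0"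
        using lie_skew_iff[OF lie_carrier[OF al]] al by (simp add: lie_def)
      from this[rule_format, of "msize t n - Suc k" j] k ij a0
      have "cayley t n g $$ (k, j) = 0" by (auto simp: form_sgn_def split: if_splits)
      then show ?thesis by simp
    qed (use z in auto)
  qed
  then have "(\<Sum>k\<in>{i<..<j}. g $$ (i, k) * cayley t n g $$ (k, j)) = 0"
    by (intro sum.neutral) auto
  then show ?thesis using cayley_entry(2)[OF 2 g ij] d by simp
qed

section \<open>Elementary characters as sums of additive characters\<close>

text \<open>Finiteness of the field forces modulus 1: translating a point of maximal modulus by
  \<open>b\<close> gives \<open>norm (\<theta> b) \<le> 1\<close>, and the same bound at
  \<open>-b\<close> gives the reverse.\<close>

lemma additive_char_props:
  fixes \<theta> :: "'a::{field,finite} \<Rightarrow> complex"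
  assumes "nontrivial_additive_char \<theta>"
  shows "\<theta> (a + b) = \<theta> a * \<theta> b" "\<theta> 0 = 1" "cnj (\<theta> a) * \<theta> a = 1"
proof -
  have add: "\<theta> (a + b) = \<theta> a * \<theta> b" and nz: "\<theta> a \<noteq> 0" for a b
    using assms by (auto simp: nontrivial_additive_char_def)
  show "\<theta> (a + b) = \<theta> a * \<theta> b" by (rule add)
  show 0: "\<theta> 0 = 1" using add[of 0 0] nz[of 0] by simp
  have fin: "finite (range (\<lambda>a. norm (\<theta> a)))" by simp
  have "Max (range (\<lambda>a. norm (\<theta> a))) \<in> range (\<lambda>a. norm (\<theta> a))"
    using fin by (rule Max_in) simp
  then obtain x where x: "norm (\<theta> x) = Max (range (\<lambda>a. norm (\<theta> a)))" by force
  have le: "norm (\<theta> b) \<le> 1" for b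
  proof -
    have "norm (\<theta> (x + b)) \<le> norm (\<theta> x)"
      unfolding x by (rule Max_ge[OF fin]) simp
    then have "norm (\<theta> x) * norm (\<theta> b) \<le> norm (\<theta> x)" by (simp add: add norm_mult)
    then show ?thesis using nz[of x] by simp
  qed
  have "norm (\<theta> a) * norm (\<theta> (- a)) = 1" using add[of a "- a"] 0 by (simp flip: norm_mult)
  then have "norm (\<theta> a) = 1"
    using le[of a] le[of "- a"] mult_left_mono[OF le[of "- a"], of "norm (\<theta> a)"] by simp
  then show "cnj (\<theta> a) * \<theta> a = 1" by (simp add: mult.commute complex_norm_square[symmetric])
qed

lemma additive_char_sum:
  assumes "nontrivial_additive_char \<theta>" "finite I"
  shows "\<theta> (\<Sum>i\<in>I. f i) = (\<Prod>i\<in>I. \<theta> (f i :: 'a::{field,finite}))"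
  using assms(2) by induction (auto simp: additive_char_props[OF assms(1)])

lemma sum_additive_char:
  fixes \<theta> :: "'a::{field,finite} \<Rightarrow> complex"
  assumes \<theta>: "nontrivial_additive_char \<theta>"
  shows "(\<Sum>c\<in>UNIV. \<theta> (c * y)) = (if y = 0 then of_nat CARD('a) else 0)"
proof (cases "y = 0")
  case False
  obtain b where b: "\<theta> b \<noteq> 1" using \<theta> by (auto simp: nontrivial_additive_char_def)
  have "(\<Sum>c\<in>UNIV. \<theta> (c * y)) = (\<Sum>c\<in>UNIV. \<theta> ((c + b / y) * y))"
    by (rule sum.reindex_bij_witness[of _ "\<lambda>c. c + b / y" "\<lambda>c. c - b / y"]) auto
  also have "\<dots> = (\<Sum>c\<in>UNIV. \<theta> (c * y)) * \<theta> b"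
    using False by (simp add: distrib_right additive_char_props(1)[OF \<theta>] sum_distrib_right)
  finally show ?thesis using b False by simp
qed (simp add: additive_char_props[OF \<theta>])

text \<open>Fourier expansion of a system of vanishing conditions: the indicator is a product of
  one-variable orthogonality relations, multiplied out over all coefficient functions
  \<open>c\<close>.\<close>

lemma indicator_additive_char:
  fixes \<theta> :: "'a::{field,finite} \<Rightarrow> complex"
  assumes \<theta>: "nontrivial_additive_char \<theta>" and Z: "finite Z"
  shows "(\<Sum>c\<in>Z \<rightarrow>\<^sub>E UNIV. \<theta> (\<Sum>z\<in>Z. c z * f z)) = (if \<forall>z\<in>Z. f z = 0 then of_nat CARD('a) ^ card Z else 0)"
proof -
  have "(\<Sum>c\<in>Z \<rightarrow>\<^sub>E UNIV. \<theta> (\<Sum>z\<in>Z. c z * f z)) = (\<Sum>c\<in>Z \<rightarrow>\<^sub>E UNIV. \<Prod>z\<in>Z. \<theta> (c z * f z))"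
    by (simp add: additive_char_sum[OF \<theta> Z])
  also have "\<dots> = (\<Prod>z\<in>Z. \<Sum>c\<in>UNIV. \<theta> (c * f z))"
    using Z by (subst prod_sum_PiE) auto
  also have "\<dots> = (\<Prod>z\<in>Z. if f z = 0 then of_nat CARD('a) else 0)"
    by (simp add: sum_additive_char[OF \<theta>])
  also have "\<dots> = (if \<forall>z\<in>Z. f z = 0 then of_nat CARD('a) ^ card Z else 0)"
    using Z by (auto simp: prod_zero_iff)
  finally show ?thesis .
qed

text \<open>The coefficients \<open>c\<close> are the Fourier variables dual to the zero conditions.
  The factor 2 translates an entry of \<open>g\<close> into one of its transform, as in
  \<open>cayley_dist_pos\<close>.\<close>

definition root_form :: "ctype \<Rightarrow> nat \<Rightarrow> root \<Rightarrow> 'a::field \<Rightarrow> (nat \<times> nat \<Rightarrow> 'a) \<Rightarrow> 'a mat \<Rightarrow> 'a" where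
  "root_form t n \<alpha> r c a = (\<Sum>z\<in>root_zeros t n \<alpha>. c z * a $$ z) + 2 * r * a $$ dist_pos t n \<alpha>"

definition conj_form where
  "conj_form t n \<alpha> r p a =
     root_form t n \<alpha> r (snd p) (fst p * a * inv\<^bsub>unip_group t n\<^esub> (fst p :: 'a::field mat))"

text \<open>The index set of an expanded elementary character: the conjugating element of Frobenius'
  formula together with Fourier coefficients.\<close>

definition root_params :: "ctype \<Rightarrow> nat \<Rightarrow> root \<Rightarrow> ('a::field mat \<times> (nat \<times> nat \<Rightarrow> 'a)) set" where
  "root_params t n \<alpha> = unip t n \<times> (root_zeros t n \<alpha> \<rightarrow>\<^sub>E UNIV)"

lemma unip_group_simps [simp]:
  "carrier (unip_group t n) = unip t n" "x \<otimes>\<^bsub>unip_group t n\<^esub> y = x * y" "\<one>\<^bsub>unip_group t n\<^esub> = 1\<^sub>m (msize t n)"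
  by (simp_all add: unip_group_def)

lemma unip_inv:
  fixes x :: "'a::field mat"
  assumes "x \<in> unip t n"
  shows "inv\<^bsub>unip_group t n\<^esub> x \<in> unip t n" "x * inv\<^bsub>unip_group t n\<^esub> x = 1\<^sub>m (msize t n)"
    "inv\<^bsub>unip_group t n\<^esub> x * x = 1\<^sub>m (msize t n)"
proof -
  interpret group "unip_group t n :: 'a mat monoid" by (rule group_unip)
  show "inv\<^bsub>unip_group t n\<^esub> x \<in> unip t n" "x * inv\<^bsub>unip_group t n\<^esub> x = 1\<^sub>m (msize t n)"
    "inv\<^bsub>unip_group t n\<^esub> x * x = 1\<^sub>m (msize t n)"
    using inv_closed[of x] r_inv[of x] l_inv[of x] assms by simp_all
qed

lemma unip_mult: "x \<in> unip t n \<Longrightarrow> y \<in> unip t n \<Longrightarrow> x * y \<in> unip t n" for x :: "'a::field mat"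
proof -
  interpret group "unip_group t n :: 'a mat monoid" by (rule group_unip)
  show "x \<in> unip t n \<Longrightarrow> y \<in> unip t n \<Longrightarrow> x * y \<in> unip t n" using m_closed[of x y] by simp
qed

lemma elem_char_expansion:
  fixes \<theta> :: "'a::{field,finite} \<Rightarrow> complex"
  assumes 2: "(2::'a) \<noteq> 0" and \<theta>: "nontrivial_additive_char \<theta>" and \<alpha>: "\<alpha> \<in> roots t n" and g: "g \<in> unip t n"
  shows "elem_char t n \<theta> \<alpha> r g =
    inverse (of_nat (card (unip_root t n \<alpha> :: 'a mat set)) * of_nat CARD('a) ^ card (root_zeros t n \<alpha>)) *
    (\<Sum>p\<in>root_params t n \<alpha>. \<theta> (conj_form t n \<alpha> r p (cayley t n g)))"
proof -
  let ?i = "\<lambda>x. inv\<^bsub>unip_group t n\<^esub> x" and ?q = "of_nat CARD('a) ^ card (root_zeros t n \<alpha>) :: complex"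
  let ?H = "unip_root t n \<alpha> :: 'a mat set"
  have q: "?q \<noteq> 0" by simp
  have *: "(if x * g * ?i x \<in> ?H then elem_lin_char t n \<theta> \<alpha> r (x * g * ?i x) else 0) =
      inverse ?q * (\<Sum>c\<in>root_zeros t n \<alpha> \<rightarrow>\<^sub>E UNIV. \<theta> (conj_form t n \<alpha> r (x, c) (cayley t n g)))"
    if x: "x \<in> unip t n" for x
  proof -
    let ?y = "x * g * ?i x"
    have y: "?y \<in> unip t n" using unip_mult unip_inv(1) x g by blast
    have a: "cayley t n ?y = x * cayley t n g * ?i x"
      using unip_inv[OF x] x by (intro cayley_conj[OF 2 g y]) (auto simp: unip_carrier)
    have "(\<Sum>c\<in>root_zeros t n \<alpha> \<rightarrow>\<^sub>E UNIV. \<theta> (conj_form t n \<alpha> r (x, c) (cayley t n g))) =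
        (\<Sum>c\<in>root_zeros t n \<alpha> \<rightarrow>\<^sub>E UNIV. \<theta> (\<Sum>z\<in>root_zeros t n \<alpha>. c z * cayley t n ?y $$ z)) *
        \<theta> (2 * r * cayley t n ?y $$ dist_pos t n \<alpha>)"
      by (simp add: conj_form_def root_form_def a additive_char_props(1)[OF \<theta>] sum_distrib_right)
    also have "\<dots> = (if ?y \<in> ?H then ?q * \<theta> (2 * r * cayley t n ?y $$ dist_pos t n \<alpha>) else 0)"
      using y by (simp add: indicator_additive_char[OF \<theta> finite_root_zeros] unip_root_eq[OF \<alpha>]
          cayley_root_zeros_iff[OF 2 y \<alpha>])
    also have "\<dots> = (if ?y \<in> ?H then ?q * elem_lin_char t n \<theta> \<alpha> r ?y else 0)"
      using cayley_dist_pos[OF 2 y \<alpha>]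
      by (auto simp: unip_root_eq[OF \<alpha>] elem_lin_char_def entry_def dist_pos_def mult_ac)
    finally show ?thesis using q by (simp add: field_simps)
  qed
  have "elem_char t n \<theta> \<alpha> r g =
      (\<Sum>x\<in>unip t n. if x * g * ?i x \<in> ?H then elem_lin_char t n \<theta> \<alpha> r (x * g * ?i x) else 0) / of_nat (card ?H)"
    unfolding elem_char_def induced_def
    by (simp add: sum.inter_filter[OF finite_unip])
  also have "\<dots> = inverse (of_nat (card ?H) * ?q) *
      (\<Sum>x\<in>unip t n. \<Sum>c\<in>root_zeros t n \<alpha> \<rightarrow>\<^sub>E UNIV. \<theta> (conj_form t n \<alpha> r (x, c) (cayley t n g)))"
    by (simp add: * divide_inverse mult_ac flip: sum_distrib_left)
  also have "(\<Sum>x\<in>unip t n. \<Sum>c\<in>root_zeros t n \<alpha> \<rightarrow>\<^sub>E UNIV. \<theta> (conj_form t n \<alpha> r (x, c) (cayley t n g)))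
      = (\<Sum>p\<in>root_params t n \<alpha>. \<theta> (conj_form t n \<alpha> r p (cayley t n g)))"
    unfolding root_params_def sum.cartesian_product by (simp add: split_beta)
  finally show ?thesis .
qed

lemma conj_form_linear:
  fixes a b :: "'a::field mat"
  assumes \<alpha>: "\<alpha> \<in> roots t n" and p: "p \<in> root_params t n \<alpha>"
    and a: "a \<in> carrier_mat (msize t n) (msize t n)" and b: "b \<in> carrier_mat (msize t n) (msize t n)"
  shows "conj_form t n \<alpha> r p (a + s \<cdot>\<^sub>m b) = conj_form t n \<alpha> r p a + s * conj_form t n \<alpha> r p b"
proof -
  let ?m = "msize t n"
  obtain x c where xc: "p = (x, c)" "x \<in> unip t n" using p by (auto simp: root_params_def)
  define y where "y = inv\<^bsub>unip_group t n\<^esub> x"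
  have x: "x \<in> carrier_mat ?m ?m" "y \<in> carrier_mat ?m ?m"
    using unip_inv(1)[OF xc(2)] xc(2) by (auto simp: y_def unip_carrier)
  have eq: "x * (a + s \<cdot>\<^sub>m b) * y = x * a * y + s \<cdot>\<^sub>m (x * b * y)"
    using a b x by (simp add: mult_add_distrib_mat[of _ ?m ?m _ ?m] add_mult_distrib_mat[of _ ?m ?m _ _ ?m]
        mult_smult_assoc_mat[of _ ?m ?m _ ?m] mult_smult_distrib[of _ ?m ?m _ ?m] mult_carrier_mat[of _ ?m ?m _ ?m])
  have entry: "(x * (a + s \<cdot>\<^sub>m b) * y) $$ (i, j) = (x * a * y) $$ (i, j) + s * (x * b * y) $$ (i, j)"
    if "i < ?m" "j < ?m" for i j
    unfolding eq using that a b x by (simp del: index_mult_mat(1))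
  have z: "(x * (a + s \<cdot>\<^sub>m b) * y) $$ z = (x * a * y) $$ z + s * (x * b * y) $$ z"
    if "z \<in> insert (dist_pos t n \<alpha>) (root_zeros t n \<alpha>)" for z
  proof -
    have "fst z < ?m \<and> snd z < ?m"
      using that dist_pos_bounds[OF \<alpha>] root_zeros_upper[OF \<alpha>, of "fst z" "snd z"] by (auto simp: msize_def)
    then show ?thesis using entry[of "fst z" "snd z"] by simp
  qed
  have "(\<Sum>z\<in>root_zeros t n \<alpha>. c z * (x * (a + s \<cdot>\<^sub>m b) * y) $$ z) =
      (\<Sum>z\<in>root_zeros t n \<alpha>. c z * (x * a * y) $$ z) + s * (\<Sum>z\<in>root_zeros t n \<alpha>. c z * (x * b * y) $$ z)"
    by (simp add: z distrib_left sum.distrib sum_distrib_left mult.left_commute)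
  then show ?thesis
    by (simp add: conj_form_def root_form_def xc(1) z distrib_left mult_ac flip: y_def)
qed

section \<open>Values on test matrices\<close>

lemma upper_entries_simps:
  "1 \<le> i \<Longrightarrow> i < j \<Longrightarrow> j \<le> n \<Longrightarrow> upper_entries t n (Minus (int i) (int j)) = {(i - 1, j - 1)}"
  "1 \<le> i \<Longrightarrow> i < j \<Longrightarrow> j \<le> n \<Longrightarrow> upper_entries t n (Plus (int i) (int j)) =
     {(i - 1, msize t n - j), (j - 1, msize t n - i)}"
  "1 \<le> i \<Longrightarrow> i \<le> n \<Longrightarrow> upper_entries t n (Long (int i)) = {(i - 1, msize t n - i)}"
  "1 \<le> i \<Longrightarrow> i \<le> n \<Longrightarrow> t = OddOrthogonal \<Longrightarrow> upper_entries t n (Short (int i)) = {(i - 1, n)}"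
  by (auto simp: upper_entries_def mirror_def dist_pos_simps msize_def mid_def)

lemma upper_entries_disjoint:
  assumes "\<alpha> \<in> roots t n" "\<beta> \<in> roots t n" "e \<in> upper_entries t n \<alpha>" "e \<in> upper_entries t n \<beta>"
  shows "\<alpha> = \<beta>"
  using assms(1)
proof (cases rule: roots_cases)
  case \<alpha>: (Minus i j)
  from assms(2) show ?thesis
    by (cases rule: roots_cases) (use \<alpha> assms(3,4) in \<open>auto simp: upper_entries_simps msize_def mid_def\<close>)
next
  case \<alpha>: (Plus i j)
  from assms(2) show ?thesis
    by (cases rule: roots_cases) (use \<alpha> assms(3,4) in \<open>auto simp: upper_entries_simps msize_def mid_def\<close>)
next
  case \<alpha>: (Long i)
  from assms(2) show ?thesis
    by (cases rule: roots_cases) (use \<alpha> assms(3,4) in \<open>auto simp: upper_entries_simps msize_def mid_def\<close>)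
next
  case \<alpha>: (Short i)
  from assms(2) show ?thesis
    by (cases rule: roots_cases) (use \<alpha> assms(3,4) in \<open>auto simp: upper_entries_simps msize_def mid_def\<close>)
qed

lemma upper_entries_labels:
  assumes "\<alpha> \<in> roots t n" "e \<in> upper_entries t n \<alpha>"
  shows "\<exists>a b. (a, b) \<in> root_entries \<alpha> \<and> a \<in> labels t n \<and> b \<in> labels t n \<and> e = (pos t n a, pos t n b)"
  using assms(1)
proof (cases rule: roots_cases)
  case (Minus i j)
  then show ?thesis using assms(2)
    by (intro exI[of _ "int i"] exI[of _ "int j"]) (auto simp: upper_entries_simps labels_def pos_def)
next
  case (Plus i j)
  have "e = (pos t n (int i), pos t n (- int j)) \<or> e = (pos t n (int j), pos t n (- int i))"
    using assms(2) Plus by (auto simp: upper_entries_simps pos_def nat_diff_distrib)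
  then show ?thesis
  proof
    assume "e = (pos t n (int i), pos t n (- int j))"
    with Plus show ?thesis by (intro exI[of _ "int i"] exI[of _ "- int j"]) (auto simp: labels_def)
  next
    assume "e = (pos t n (int j), pos t n (- int i))"
    with Plus show ?thesis by (intro exI[of _ "int j"] exI[of _ "- int i"]) (auto simp: labels_def)
  qed
next
  case (Long i)
  then show ?thesis using assms(2)
    by (intro exI[of _ "int i"] exI[of _ "- int i"]) (auto simp: upper_entries_simps labels_def pos_def nat_diff_distrib)
next
  case (Short i)
  then show ?thesis using assms(2)
    by (intro exI[of _ "int i"] exI[of _ 0]) (auto simp: upper_entries_simps labels_def pos_def)
qed

lemma basic_roots_placement:
  assumes "basic_roots t n D"
  shows "placement (upper_entries t n) D"
  unfolding placement_def
proof (intro ballI impI)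
  fix \<alpha> \<beta> e e' assume D: "\<alpha> \<in> D" "\<beta> \<in> D" and e: "e \<in> upper_entries t n \<alpha>" "e' \<in> upper_entries t n \<beta>"
    and eq: "fst e = fst e' \<or> snd e = snd e'"
  have R: "\<alpha> \<in> roots t n" "\<beta> \<in> roots t n" using assms D by (auto simp: basic_roots_def)
  obtain a b where ab: "(a, b) \<in> root_entries \<alpha>" "a \<in> labels t n" "b \<in> labels t n" "e = (pos t n a, pos t n b)"
    using upper_entries_labels[OF R(1) e(1)] by blast
  obtain c d where cd: "(c, d) \<in> root_entries \<beta>" "c \<in> labels t n" "d \<in> labels t n" "e' = (pos t n c, pos t n d)"
    using upper_entries_labels[OF R(2) e(2)] by blast
  have "a = c \<or> b = d"
    using eq ab cd bij_betw_pos[of t n] by (auto simp: bij_betw_def dest: inj_onD)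
  moreover have "(a, b) \<in> (\<Union>\<alpha>\<in>D. root_entries \<alpha>)" "(c, d) \<in> (\<Union>\<alpha>\<in>D. root_entries \<alpha>)"
    using ab cd D by blast+
  moreover have "basic_entries (\<Union>\<alpha>\<in>D. root_entries \<alpha>)" using assms by (simp add: basic_roots_def)
  ultimately have "a = c \<and> b = d" unfolding basic_entries_def by metis
  then have "e = e'" using ab cd by simp
  then show "e = e' \<and> \<alpha> = \<beta>" using upper_entries_disjoint[OF R e(1)] e(2) by simp
qed

text \<open>The distinguished entry coincides with its mirror image exactly for the roots \<open>2\<epsilon>\<^sub>i\<close>, where both
  contributions add up to \<open>4\<close>.\<close>

definition entry_coef :: "ctype \<Rightarrow> nat \<Rightarrow> root \<Rightarrow> nat \<times> nat \<Rightarrow> 'a::field" where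
  "entry_coef t n \<alpha> e = 2 * ((if e = dist_pos t n \<alpha> then 1 else 0) -
     (if e = mirror t n (dist_pos t n \<alpha>)
      then form_sgn t n (fst (dist_pos t n \<alpha>)) * form_sgn t n (snd (dist_pos t n \<alpha>)) else 0))"

lemma entry_coef_nonzero:
  assumes 2: "(2::'a::field) \<noteq> 0" and \<alpha>: "\<alpha> \<in> roots t n" and e: "e \<in> upper_entries t n \<alpha>"
  shows "entry_coef t n \<alpha> e \<noteq> (0 :: 'a)"
proof (cases "dist_pos t n \<alpha> = mirror t n (dist_pos t n \<alpha>)")
  \<comment> \<open>A corner on the anti-diagonal occurs only for \<open>Long i\<close>. The form is
    then alternating, the signs in the two halves differ, and the two contributions reinforce
    instead of cancelling.\<close>
  case True
  from \<alpha> have "form_sgn t n (fst (dist_pos t n \<alpha>)) * form_sgn t n (snd (dist_pos t n \<alpha>)) = (-1 :: 'a)"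
    by (cases rule: roots_cases) (use True in \<open>auto simp: dist_pos_simps mirror_def form_sgn_def msize_def mid_def\<close>)
  moreover have "(2 :: 'a) * 2 \<noteq> 0" by (rule no_zero_divisors[OF 2 2])
  ultimately show ?thesis using True e by (auto simp: entry_coef_def upper_entries_def)
next
  case False
  then show ?thesis using e 2
    by (auto simp: entry_coef_def upper_entries_def form_sgn_def split: if_splits)
qed

section \<open>Left and right factors at a corner\<close>

definition root_left :: "'a mat \<times> 'b \<Rightarrow> nat \<times> nat \<Rightarrow> nat \<Rightarrow> 'a" where
  "root_left p e k = fst p $$ (fst e, k)"

text \<open>All zero conditions in the row of \<open>e\<close> have the same left factor as
  \<open>e\<close>, so they are collected here. The value 0 outside the matrix is needed because
  \<open>staircase\<close> constrains every index beyond the corner.\<close>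

definition root_right where
  "root_right t n \<alpha> r p e k = (if k < msize t n then
     (\<Sum>z\<in>{z \<in> root_zeros t n \<alpha>. fst z = fst e}. snd p z * (inv\<^bsub>unip_group t n\<^esub> (fst p)) $$ (k, snd z))
     + entry_coef t n \<alpha> e * (r :: 'a::field) * (inv\<^bsub>unip_group t n\<^esub> (fst p)) $$ (k, snd e) else 0)"

text \<open>Rows of \<open>x\<close> begin and columns of its inverse end with 1 on the diagonal,
  and the collected zero conditions lie strictly left of \<open>e\<close>. So the corner value is
  independent of the parameters.\<close>

lemma root_forms_staircase:
  assumes D: "D \<subseteq> roots t n" and f: "f \<in> (\<Pi>\<^sub>E \<alpha>\<in>D. root_params t n \<alpha>)"
  shows "staircase (upper_entries t n) D (\<lambda>\<alpha> e. entry_coef t n \<alpha> e * (\<phi> \<alpha> :: 'a::field))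
    (\<lambda>\<alpha>. root_left (f \<alpha>)) (\<lambda>\<alpha>. root_right t n \<alpha> (\<phi> \<alpha>) (f \<alpha>))"
  unfolding staircase_def
proof (intro ballI)
  fix \<alpha> e assume \<alpha>: "\<alpha> \<in> D" and e: "e \<in> upper_entries t n \<alpha>"
  let ?m = "msize t n"
  have R: "\<alpha> \<in> roots t n" using D \<alpha> by blast
  note b = upper_entries_bounds[OF R e]
  obtain x c where xc: "f \<alpha> = (x, c)" "x \<in> unip t n" using f \<alpha> by (fastforce simp: root_params_def)
  note xD = unitriangularD[OF unip_unitriangular[OF xc(2)]]
    and yD = unitriangularD[OF unip_unitriangular[OF unip_inv(1)[OF xc(2)]]]
  have z: "snd z < snd e" if z: "z \<in> root_zeros t n \<alpha>" "fst z = fst e" for z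
  proof -
    have "(fst z, snd z) \<in> root_zeros t n \<alpha>" using z(1) by simp
    from root_zeros_upper(3)[OF R this] obtain q where q: "(fst z, q) \<in> upper_entries t n \<alpha>" "snd z < q"
      by blast
    have "e = (fst z, q)" by (rule upper_entries_rows[OF R e q(1)]) (simp add: z(2))
    then have "snd e = q" by (rule ssubst) simp
    then show ?thesis using q(2) by simp
  qed
  have "root_left (f \<alpha>) e (fst e) = 1" "\<forall>k<fst e. root_left (f \<alpha>) e k = 0"
    using b xD(2)[of _ "fst e"] xD(3)[of "fst e"] by (simp_all add: root_left_def xc)
  moreover have "root_right t n \<alpha> (\<phi> \<alpha>) (f \<alpha>) e k = (if k = snd e then entry_coef t n \<alpha> e * \<phi> \<alpha> else 0)"
    if "snd e \<le> k" for k
  proof (cases "k < ?m")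
    case True
    have "(\<Sum>z\<in>{z \<in> root_zeros t n \<alpha>. fst z = fst e}. c z * (inv\<^bsub>unip_group t n\<^esub> x) $$ (k, snd z)) = 0"
    proof (rule sum.neutral, rule ballI)
      fix z' assume "z' \<in> {z \<in> root_zeros t n \<alpha>. fst z = fst e}"
      then have "snd z' < k" using z[of z'] that by simp
      then show "c z' * (inv\<^bsub>unip_group t n\<^esub> x) $$ (k, snd z') = 0" using yD(2) True by simp
    qed
    moreover have "(inv\<^bsub>unip_group t n\<^esub> x) $$ (k, snd e) = (if k = snd e then 1 else 0)"
      using yD(2,3) True that by simp
    ultimately show ?thesis using True by (simp add: root_right_def xc)
  qed (use b in \<open>simp add: root_right_def\<close>)
  ultimately show "root_left (f \<alpha>) e (fst e) = 1 \<and> (\<forall>k<fst e. root_left (f \<alpha>) e k = 0) \<and>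
      root_right t n \<alpha> (\<phi> \<alpha>) (f \<alpha>) e (snd e) = entry_coef t n \<alpha> e * \<phi> \<alpha> \<and>
      (\<forall>k>snd e. root_right t n \<alpha> (\<phi> \<alpha>) (f \<alpha>) e k = 0)" by simp
qed

lemma conj_form_test_mat:
  fixes X Y :: "nat \<Rightarrow> 'a::field"
  assumes \<alpha>: "\<alpha> \<in> roots t n" and p: "p \<in> root_params t n \<alpha>" and X: "\<forall>k\<ge>n. X k = 0"
  shows "conj_form t n \<alpha> r p (test_mat t n X Y) =
    (\<Sum>e\<in>upper_entries t n \<alpha>. (\<Sum>k<msize t n. root_left p e k * X k) *
      (\<Sum>k<msize t n. root_right t n \<alpha> r p e k * Y k))"
proof -
  let ?m = "msize t n" and ?s = "form_sgn t n :: nat \<Rightarrow> 'a" and ?Z = "root_zeros t n \<alpha>"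
    and ?E = "upper_entries t n \<alpha>"
  obtain x c where xc: "p = (x, c)" "x \<in> unip t n" using p by (auto simp: root_params_def)
  define y where "y = inv\<^bsub>unip_group t n\<^esub> x"
  note xD = unitriangularD[OF unip_unitriangular[OF xc(2)]]
  define V where "V q = (\<Sum>k<?m. x $$ (q, k) * X k)" for q
  define W where "W q = (\<Sum>k<?m. y $$ (k, q) * Y k)" for q
  define d where "d = dist_pos t n \<alpha>"
  define d' where "d' = mirror t n d"
  have V0: "V q = 0" if q: "n \<le> q" "q < ?m" for q
    unfolding V_def
  proof (intro sum.neutral ballI)
    fix k assume "k \<in> {..<?m}"
    then show "x $$ (q, k) * X k = 0" using xD(2)[of k q] X q by (cases "k < n") auto
  qed
  have ent: "(x * test_mat t n X Y * y) $$ (i, j) = V i * W j - ?s i * ?s j * V (?m - Suc j) * W (?m - Suc i)"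
    if "i < ?m" "j < ?m" for i j
    unfolding V_def W_def using unip_inv[OF xc(2)] that
    by (intro conj_test_mat_entry[OF xc(2)]) (auto simp: y_def unip_carrier)
  have entZ: "(x * test_mat t n X Y * y) $$ z = V (fst z) * W (snd z)" if "z \<in> ?Z" for z
  proof -
    \<comment> \<open>By the column bound the mirrored row is at least \<open>n\<close>, so the
      subtracted term is 0 and only a product remains.\<close>
    have b: "fst z < n" "snd z < n + mid t"
      using root_zeros_upper[OF \<alpha>, of "fst z" "snd z"] that by auto
    then have "V (?m - Suc (snd z)) = 0" by (intro V0) (auto simp: msize_def)
    then show ?thesis using ent[of "fst z" "snd z"] b by (auto simp: msize_def)
  qed
  have db: "fst d < n" "fst d < snd d" "snd d < ?m" using dist_pos_bounds[OF \<alpha>] by (auto simp: d_def)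
  have "(\<Sum>z\<in>?Z. c z * (x * test_mat t n X Y * y) $$ z) = (\<Sum>z\<in>?Z. V (fst z) * (c z * W (snd z)))"
    by (intro sum.cong refl) (simp add: entZ)
  \<comment> \<open>Grouping by rows attaches each zero condition to one corner, as a root has at
    most one upper entry in a row.\<close>
  also have "\<dots> = (\<Sum>q\<in>fst ` ?E. \<Sum>z\<in>{z\<in>?Z. fst z = q}. V (fst z) * (c z * W (snd z)))"
    using root_zeros_upper(3)[OF \<alpha>]
    by (intro sum.group[symmetric] finite_root_zeros finite_imageI finite_upper_entries) force
  also have "\<dots> = (\<Sum>e\<in>?E. \<Sum>z\<in>{z\<in>?Z. fst z = fst e}. V (fst z) * (c z * W (snd z)))"
    using upper_entries_rows[OF \<alpha>] by (subst sum.reindex) (auto simp: inj_on_def)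
  also have "\<dots> = (\<Sum>e\<in>?E. V (fst e) * (\<Sum>z\<in>{z\<in>?Z. fst z = fst e}. c z * W (snd z)))"
    by (intro sum.cong refl) (simp add: sum_distrib_left)
  finally have 1: "(\<Sum>z\<in>?Z. c z * (x * test_mat t n X Y * y) $$ z) = \<dots>" .
  have E: "d \<in> ?E" "d' \<in> ?E \<longleftrightarrow> fst d' < n" using db by (auto simp: upper_entries_def d_def d'_def)
  have "(\<Sum>e\<in>?E. V (fst e) * (entry_coef t n \<alpha> e * r * W (snd e))) =
      (\<Sum>e\<in>?E. (if e = d then 2 * r * V (fst d) * W (snd d) else 0) -
        (if e = d' then 2 * r * (?s (fst d) * ?s (snd d)) * V (fst d') * W (snd d') else 0))"
    by (intro sum.cong refl) (auto simp: entry_coef_def d_def d'_def algebra_simps)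
  also have "\<dots> = 2 * r * V (fst d) * W (snd d) -
      (if d' \<in> ?E then 2 * r * (?s (fst d) * ?s (snd d)) * V (fst d') * W (snd d') else 0)"
    using E(1) by (simp add: sum_subtractf finite_upper_entries)
  \<comment> \<open>If the mirrored entry is missing from the upper entries, its row is at least
    \<open>n\<close> and its \<open>V\<close> is 0 anyway.\<close>
  also have "\<dots> = 2 * r * (V (fst d) * W (snd d) - ?s (fst d) * ?s (snd d) * V (fst d') * W (snd d'))"
    using E(2) V0[of "fst d'"] db by (auto simp: d'_def mirror_def algebra_simps)
  also have "\<dots> = 2 * r * (x * test_mat t n X Y * y) $$ d"
    using ent[of "fst d" "snd d"] db by (simp add: d'_def mirror_def)
  finally have 2: "2 * r * (x * test_mat t n X Y * y) $$ d = (\<Sum>e\<in>?E. V (fst e) * (entry_coef t n \<alpha> e * r * W (snd e)))" ..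
  have 3: "(\<Sum>k<?m. root_right t n \<alpha> r p e k * Y k) =
      (\<Sum>z\<in>{z\<in>?Z. fst z = fst e}. c z * W (snd z)) + entry_coef t n \<alpha> e * r * W (snd e)" for e
  proof -
    have "(\<Sum>k<?m. root_right t n \<alpha> r p e k * Y k) =
      (\<Sum>k<?m. (\<Sum>z\<in>{z\<in>?Z. fst z = fst e}. c z * (y $$ (k, snd z) * Y k)) + entry_coef t n \<alpha> e * r * (y $$ (k, snd e) * Y k))"
      by (intro sum.cong refl) (simp add: root_right_def xc y_def distrib_right sum_distrib_right mult.assoc)
    also have "\<dots> = (\<Sum>z\<in>{z\<in>?Z. fst z = fst e}. c z * W (snd z)) + entry_coef t n \<alpha> e * r * W (snd e)"
      unfolding W_def sum.distrib sum_distrib_left by (subst sum.swap) simp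
    finally show ?thesis .
  qed
  have 4: "(\<Sum>k<?m. root_left p e k * X k) = V (fst e)" for e
    by (simp add: root_left_def xc V_def)
  show ?thesis
    unfolding 3 4 distrib_left sum.distrib 1[symmetric] 2[symmetric]
    by (simp add: conj_form_def root_form_def xc y_def d_def)
qed

section \<open>Orthogonality of supercharacters\<close>

definition super_params :: "ctype \<Rightarrow> nat \<Rightarrow> root set \<Rightarrow> (root \<Rightarrow> 'a::field mat \<times> (nat \<times> nat \<Rightarrow> 'a)) set" where
  "super_params t n D = (\<Pi>\<^sub>E \<alpha>\<in>D. root_params t n \<alpha>)"

definition super_form :: "ctype \<Rightarrow> nat \<Rightarrow> root set \<Rightarrow> (root \<Rightarrow> 'a) \<Rightarrow> (root \<Rightarrow> 'a mat \<times> (nat \<times> nat \<Rightarrow> 'a)) \<Rightarrow> 'a::field mat \<Rightarrow> 'a" where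
  "super_form t n D \<phi> f a = (\<Sum>\<alpha>\<in>D. conj_form t n \<alpha> (\<phi> \<alpha>) (f \<alpha>) a)"

lemma super_form_linear:
  fixes a b :: "'a::field mat"
  assumes D: "D \<subseteq> roots t n" and f: "f \<in> super_params t n D"
    and a: "a \<in> carrier_mat (msize t n) (msize t n)" and b: "b \<in> carrier_mat (msize t n) (msize t n)"
  shows "super_form t n D \<phi> f (a + s \<cdot>\<^sub>m b) = super_form t n D \<phi> f a + s * super_form t n D \<phi> f b"
proof -
  have "conj_form t n \<alpha> (\<phi> \<alpha>) (f \<alpha>) (a + s \<cdot>\<^sub>m b) =
      conj_form t n \<alpha> (\<phi> \<alpha>) (f \<alpha>) a + s * conj_form t n \<alpha> (\<phi> \<alpha>) (f \<alpha>) b" if "\<alpha> \<in> D" for \<alpha>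
    using that D f a b by (intro conj_form_linear) (auto simp: super_params_def)
  then show ?thesis by (simp add: super_form_def sum.distrib sum_distrib_left)
qed

lemma super_form_test_mat:
  fixes X Y :: "nat \<Rightarrow> 'a::field"
  assumes D: "D \<subseteq> roots t n" and f: "f \<in> super_params t n D" and X: "\<forall>k\<ge>n. X k = 0"
  shows "super_form t n D \<phi> f (test_mat t n X Y) =
    rank_sum (msize t n) (upper_entries t n) D (\<lambda>\<alpha>. root_left (f \<alpha>)) (\<lambda>\<alpha>. root_right t n \<alpha> (\<phi> \<alpha>) (f \<alpha>)) X Y"
  unfolding super_form_def rank_sum_def
  using D f by (intro sum.cong refl conj_form_test_mat X) (auto simp: super_params_def)

lemma superchar_expansion:
  fixes \<theta> :: "'a::{field,finite} \<Rightarrow> complex"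
  assumes 2: "(2::'a) \<noteq> 0" and \<theta>: "nontrivial_additive_char \<theta>" and D: "D \<subseteq> roots t n"
  shows "\<exists>K. \<forall>g\<in>unip t n. superchar t n \<theta> D \<phi> g =
    K * (\<Sum>f\<in>super_params t n D. \<theta> (super_form t n D \<phi> f (cayley t n g)))"
proof -
  have fD: "finite D" using D finite_roots finite_subset by blast
  define K :: "root \<Rightarrow> complex" where "K \<alpha> = inverse (of_nat (card (unip_root t n \<alpha> :: 'a mat set)) *
      of_nat CARD('a) ^ card (root_zeros t n \<alpha>))" for \<alpha>
  have fin: "finite (root_params t n \<alpha> :: ('a mat \<times> _) set)" for \<alpha>
    unfolding root_params_def
    by (intro finite_cartesian_product finite_unip finite_PiE finite_root_zeros) simp
  have "superchar t n \<theta> D \<phi> g = prod K D * (\<Sum>f\<in>super_params t n D. \<theta> (super_form t n D \<phi> f (cayley t n g)))"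
    if g: "g \<in> unip t n" for g
  proof -
    have "superchar t n \<theta> D \<phi> g =
        (\<Prod>\<alpha>\<in>D. K \<alpha> * (\<Sum>p\<in>root_params t n \<alpha>. \<theta> (conj_form t n \<alpha> (\<phi> \<alpha>) p (cayley t n g))))"
      unfolding superchar_def K_def using D by (intro prod.cong refl elem_char_expansion[OF 2 \<theta> _ g]) auto
    also have "\<dots> = prod K D * (\<Prod>\<alpha>\<in>D. \<Sum>p\<in>root_params t n \<alpha>. \<theta> (conj_form t n \<alpha> (\<phi> \<alpha>) p (cayley t n g)))"
      by (simp add: prod.distrib)
    also have "(\<Prod>\<alpha>\<in>D. \<Sum>p\<in>root_params t n \<alpha>. \<theta> (conj_form t n \<alpha> (\<phi> \<alpha>) p (cayley t n g))) =
        (\<Sum>f\<in>super_params t n D. \<Prod>\<alpha>\<in>D. \<theta> (conj_form t n \<alpha> (\<phi> \<alpha>) (f \<alpha>) (cayley t n g)))"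
      unfolding super_params_def using fD fin by (rule prod_sum_PiE)
    finally show ?thesis by (simp add: super_form_def additive_char_sum[OF \<theta> fD])
  qed
  then show ?thesis by blast
qed

lemma lie_add_smult:
  assumes a: "a \<in> lie t n" and b: "b \<in> lie t n"
  shows "a + s \<cdot>\<^sub>m b \<in> lie t n"
proof -
  let ?m = "msize t n"
  note ab = lie_carrier[OF a] lie_carrier[OF b]
  have c: "a + s \<cdot>\<^sub>m b \<in> carrier_mat ?m ?m" using ab by simp
  have A: "a $$ (?m - Suc j, i) * form_sgn t n (?m - Suc j) + form_sgn t n i * a $$ (?m - Suc i, j) = 0"
    if "i < ?m" "j < ?m" for i j using lie_skew_iff[OF ab(1)] a that by (simp add: lie_def)
  have B: "b $$ (?m - Suc j, i) * form_sgn t n (?m - Suc j) + form_sgn t n i * b $$ (?m - Suc i, j) = 0"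
    if "i < ?m" "j < ?m" for i j using lie_skew_iff[OF ab(2)] b that by (simp add: lie_def)
  have "(a + s \<cdot>\<^sub>m b) $$ (?m - Suc j, i) * form_sgn t n (?m - Suc j) + form_sgn t n i * (a + s \<cdot>\<^sub>m b) $$ (?m - Suc i, j) = 0"
    if ij: "i < ?m" "j < ?m" for i j
  proof -
    have "(a + s \<cdot>\<^sub>m b) $$ (?m - Suc j, i) * form_sgn t n (?m - Suc j) + form_sgn t n i * (a + s \<cdot>\<^sub>m b) $$ (?m - Suc i, j)
      = (a $$ (?m - Suc j, i) * form_sgn t n (?m - Suc j) + form_sgn t n i * a $$ (?m - Suc i, j)) +
        s * (b $$ (?m - Suc j, i) * form_sgn t n (?m - Suc j) + form_sgn t n i * b $$ (?m - Suc i, j))"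
      using ij ab by (simp add: algebra_simps)
    then show ?thesis using A[OF ij] B[OF ij] by simp
  qed
  moreover have "\<forall>i<?m. \<forall>j\<le>i. (a + s \<cdot>\<^sub>m b) $$ (i, j) = 0"
    using ab lie_strict[OF a] lie_strict[OF b] by auto
  ultimately show ?thesis using lie_skew_iff[OF c] c by (simp add: lie_def)
qed

text \<open>Translation by a multiple of \<open>b\<close>, scaled so that \<open>L - L'\<close>
  changes by \<open>u\<close>, multiplies the sum by \<open>\<theta> u\<close>, which is not
  1.\<close>

lemma sum_lie_additive_char:
  fixes \<theta> :: "'a::{field,finite} \<Rightarrow> complex" and L L' :: "'a mat \<Rightarrow> 'a"
  assumes \<theta>: "nontrivial_additive_char \<theta>" and b: "b \<in> lie t n" and ne: "L b \<noteq> L' b"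
    and L: "\<And>a s. a \<in> lie t n \<Longrightarrow> L (a + s \<cdot>\<^sub>m b) = L a + s * L b"
    and L': "\<And>a s. a \<in> lie t n \<Longrightarrow> L' (a + s \<cdot>\<^sub>m b) = L' a + s * L' b"
  shows "(\<Sum>a\<in>lie t n. \<theta> (L a) * cnj (\<theta> (L' a))) = 0"
proof -
  note bc = lie_carrier[OF b]
  obtain u where u: "\<theta> u \<noteq> 1" using \<theta> by (auto simp: nontrivial_additive_char_def)
  define s where "s = u / (L b - L' b)"
  have s: "s * L b = u + s * L' b" using ne by (simp add: s_def field_simps)
  have shift: "a + r \<cdot>\<^sub>m b + (- r) \<cdot>\<^sub>m b = a" if "a \<in> lie t n" for a :: "'a mat" and r
    using lie_carrier[OF that] bc by (intro eq_matI) auto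
  have "(\<Sum>a\<in>lie t n. \<theta> (L a) * cnj (\<theta> (L' a))) =
      (\<Sum>a\<in>lie t n. \<theta> (L (a + s \<cdot>\<^sub>m b)) * cnj (\<theta> (L' (a + s \<cdot>\<^sub>m b))))"
    using shift[of _ s] shift[of _ "- s"] lie_add_smult[OF _ b]
    by (intro sum.reindex_bij_witness[of _ "\<lambda>a. a + s \<cdot>\<^sub>m b" "\<lambda>a. a + (- s) \<cdot>\<^sub>m b"]) auto
  also have "\<dots> = (\<Sum>a\<in>lie t n. \<theta> u * (\<theta> (L a) * cnj (\<theta> (L' a))))"
  proof (intro sum.cong refl)
    fix a :: "'a mat" assume a: "a \<in> lie t n"
    have "\<theta> (L (a + s \<cdot>\<^sub>m b)) * cnj (\<theta> (L' (a + s \<cdot>\<^sub>m b))) =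
        \<theta> u * (\<theta> (L a) * cnj (\<theta> (L' a))) * (cnj (\<theta> (s * L' b)) * \<theta> (s * L' b))"
      by (simp add: L[OF a] L'[OF a] s additive_char_props(1)[OF \<theta>] mult_ac)
    then show "\<theta> (L (a + s \<cdot>\<^sub>m b)) * cnj (\<theta> (L' (a + s \<cdot>\<^sub>m b))) = \<theta> u * (\<theta> (L a) * cnj (\<theta> (L' a)))"
      by (simp add: additive_char_props(3)[OF \<theta>])
  qed
  also have "\<dots> = \<theta> u * (\<Sum>a\<in>lie t n. \<theta> (L a) * cnj (\<theta> (L' a)))"
    by (simp add: sum_distrib_left)
  finally show ?thesis using u by simp
qed

text \<open>Corners and corner values do not depend on \<open>f\<close> and \<open>f'\<close>, so
  equality on test matrices alone already lets \<open>staircase_unique\<close> recover the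
  pair.\<close>

lemma super_forms_differ:
  fixes \<phi> \<phi>' :: "root \<Rightarrow> 'a::field"
  assumes 2: "(2::'a) \<noteq> 0" and D: "basic_roots t n D" "basic_roots t n D'"
    and \<phi>: "\<phi> \<in> D \<rightarrow>\<^sub>E UNIV - {0}" "\<phi>' \<in> D' \<rightarrow>\<^sub>E UNIV - {0}"
    and ne: "(D, \<phi>) \<noteq> (D', \<phi>')"
    and f: "f \<in> super_params t n D" "f' \<in> super_params t n D'"
  shows "\<exists>b\<in>lie t n. super_form t n D \<phi> f b \<noteq> super_form t n D' \<phi>' f' b"
proof (rule ccontr)
  assume "\<not> ?thesis"
  then have eq: "super_form t n D \<phi> f b = super_form t n D' \<phi>' f' b" if "b \<in> lie t n" for b
    using that by blast
  have sub: "D \<subseteq> roots t n" "D' \<subseteq> roots t n" using D by (auto simp: basic_roots_def)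
  have fin: "finite D" "finite D'" using sub finite_roots finite_subset by blast+
  let ?E = "upper_entries t n" and ?c = "\<lambda>\<phi> \<alpha> e. entry_coef t n \<alpha> e * (\<phi> \<alpha> :: 'a)"
  have *: "(\<alpha> \<in> D \<longrightarrow> \<alpha> \<in> D' \<and> ?c \<phi>' \<alpha> e = ?c \<phi> \<alpha> e) \<and> (\<alpha> \<in> D' \<longrightarrow> \<alpha> \<in> D)" if e: "e \<in> ?E \<alpha>" for \<alpha> e
  proof (rule staircase_unique[where E = ?E and n = n and m = "msize t n" and c = "?c \<phi>" and c' = "?c \<phi>'"
      and w = "\<lambda>\<alpha>. root_left (f \<alpha>)" and v = "\<lambda>\<alpha>. root_right t n \<alpha> (\<phi> \<alpha>) (f \<alpha>)"
      and w' = "\<lambda>\<alpha>. root_left (f' \<alpha>)" and v' = "\<lambda>\<alpha>. root_right t n \<alpha> (\<phi>' \<alpha>) (f' \<alpha>)"])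
    show "fst e < n \<and> fst e < snd e \<and> snd e < msize t n" if "\<alpha> \<in> D \<union> D'" "e \<in> ?E \<alpha>" for \<alpha> e
      using that sub by (intro upper_entries_bounds[of \<alpha>]) auto
    show "\<alpha> = \<beta>" if "\<alpha> \<in> D \<union> D'" "\<beta> \<in> D \<union> D'" "e \<in> ?E \<alpha>" "e \<in> ?E \<beta>" for \<alpha> \<beta> e
      using that sub by (intro upper_entries_disjoint[of \<alpha> t n \<beta> e]) auto
    show "entry_coef t n \<alpha> e * \<phi> \<alpha> \<noteq> 0" if "\<alpha> \<in> D" "e \<in> ?E \<alpha>" for \<alpha> e
      using that sub \<phi>(1) entry_coef_nonzero[OF 2, of \<alpha> t n e] by auto
    show "entry_coef t n \<alpha> e * \<phi>' \<alpha> \<noteq> 0" if "\<alpha> \<in> D'" "e \<in> ?E \<alpha>" for \<alpha> e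
      using that sub \<phi>(2) entry_coef_nonzero[OF 2, of \<alpha> t n e] by auto
    show "staircase ?E D (?c \<phi>) (\<lambda>\<alpha>. root_left (f \<alpha>)) (\<lambda>\<alpha>. root_right t n \<alpha> (\<phi> \<alpha>) (f \<alpha>))"
      using f by (intro root_forms_staircase sub) (simp add: super_params_def)
    show "staircase ?E D' (?c \<phi>') (\<lambda>\<alpha>. root_left (f' \<alpha>)) (\<lambda>\<alpha>. root_right t n \<alpha> (\<phi>' \<alpha>) (f' \<alpha>))"
      using f by (intro root_forms_staircase sub) (simp add: super_params_def)
    show "rank_sum (msize t n) ?E D (\<lambda>\<alpha>. root_left (f \<alpha>)) (\<lambda>\<alpha>. root_right t n \<alpha> (\<phi> \<alpha>) (f \<alpha>)) X Y =
        rank_sum (msize t n) ?E D' (\<lambda>\<alpha>. root_left (f' \<alpha>)) (\<lambda>\<alpha>. root_right t n \<alpha> (\<phi>' \<alpha>) (f' \<alpha>)) X Y"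
      if "a < n" "\<forall>k>a. X k = 0" "\<forall>k\<le>a. Y k = 0" for a X Y
    proof -
      have "\<forall>k\<ge>n. X k = 0" using that by auto
      then show ?thesis
        using eq[OF test_mat_lie[OF that(2,3)]] super_form_test_mat[OF sub(1) f(1)] super_form_test_mat[OF sub(2) f(2)]
        by simp
    qed
  qed (use fin D e in \<open>auto intro: basic_roots_placement finite_upper_entries\<close>)
  have 1: "\<alpha> \<in> D \<longleftrightarrow> \<alpha> \<in> D'" for \<alpha>
    using *[of "dist_pos t n \<alpha>" \<alpha>] dist_pos_upper[of \<alpha> t n] sub by blast
  have "\<phi> \<alpha> = \<phi>' \<alpha>" for \<alpha>
  proof (cases "\<alpha> \<in> D")
    case True
    then have R: "\<alpha> \<in> roots t n" using sub by blast
    show ?thesis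
      using *[OF dist_pos_upper[OF R]] True entry_coef_nonzero[OF 2 R dist_pos_upper[OF R]] by simp
  next
    \<comment> \<open>Outside the common domain both functions are \<open>undefined\<close> by
      extensionality.\<close>
    case False
    then show ?thesis using 1 \<phi> by (auto simp: PiE_def extensional_def)
  qed
  with 1 ne show False by auto
qed

text \<open>Each elementary character takes the index of its subgroup as value at 1. A
  supercharacter is therefore not identically zero and has nonzero norm.\<close>

lemma superchar_one:
  fixes \<theta> :: "'a::{field,finite} \<Rightarrow> complex"
  assumes \<theta>: "nontrivial_additive_char \<theta>" and D: "D \<subseteq> roots t n"
  shows "superchar t n \<theta> D \<phi> (1\<^sub>m (msize t n)) \<noteq> 0"
proof -
  let ?U = "unip t n :: 'a mat set" and ?one = "1\<^sub>m (msize t n) :: 'a mat"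
  interpret group "unip_group t n :: 'a mat monoid" by (rule group_unip)
  have one: "?one \<in> ?U" using one_closed by simp
  have "elem_char t n \<theta> \<alpha> (\<phi> \<alpha>) ?one \<noteq> 0" if \<alpha>: "\<alpha> \<in> D" for \<alpha>
  proof -
    have R: "\<alpha> \<in> roots t n" using \<alpha> D by blast
    let ?H = "unip_root t n \<alpha> :: 'a mat set"
    have "?one $$ z = 0" if "z \<in> root_zeros t n \<alpha>" for z
      using root_zeros_upper[OF R, of "fst z" "snd z"] that
      by (cases z) (auto simp: root_zeros_def msize_def)
    then have H: "?one \<in> ?H" using one by (simp add: unip_root_eq[OF R])
    have "?H \<subseteq> ?U" by (auto simp: unip_root_eq[OF R])
    then have fH: "finite ?H" using finite_unip finite_subset by blast
    have conj: "x * ?one * inv\<^bsub>unip_group t n\<^esub> x = ?one" if "x \<in> ?U" for x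
      using unip_inv(2)[OF that] unip_carrier[OF that] by simp
    have "?one $$ dist_pos t n \<alpha> = 0"
      using dist_pos_bounds[OF R] by (cases "dist_pos t n \<alpha>") auto
    then have "elem_lin_char t n \<theta> \<alpha> (\<phi> \<alpha>) ?one = 1"
      by (simp add: elem_lin_char_def entry_def dist_pos_def additive_char_props(2)[OF \<theta>])
    then have "elem_char t n \<theta> \<alpha> (\<phi> \<alpha>) ?one = of_nat (card ?U) / of_nat (card ?H)"
      using H by (simp add: elem_char_def induced_def conj cong: conj_cong)
    moreover have "card ?U \<noteq> 0" "card ?H \<noteq> 0" using one H fH finite_unip[of t n, where 'a = 'a] by (auto simp: card_eq_0_iff)
    ultimately show ?thesis by simp
  qed
  moreover have "finite D" using D finite_roots finite_subset by blast
  ultimately show ?thesis by (simp add: superchar_def)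
qed

lemma class_inner_self_nonzero:
  assumes "finite (carrier G)" "x \<in> carrier G" "f x \<noteq> 0"
  shows "class_inner G f f \<noteq> 0"
proof -
  have "(\<Sum>x\<in>carrier G. f x * cnj (f x)) = of_real (\<Sum>x\<in>carrier G. (norm (f x))\<^sup>2)"
    by (simp only: complex_norm_square of_real_sum)
  moreover have "(\<Sum>x\<in>carrier G. (norm (f x))\<^sup>2) > 0"
    using assms by (intro sum_pos2[of _ x]) auto
  moreover have "card (carrier G) \<noteq> 0" using assms by auto
  ultimately show ?thesis by (simp add: class_inner_def del: of_real_sum)
qed

theorem theorem5p4:
  fixes t :: ctype and n p e :: nat
    and \<theta> :: "'a::{field,finite} \<Rightarrow> complex"
    and D D' :: "root set" and \<phi> \<phi>' :: "root \<Rightarrow> 'a"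
  assumes "prime p" and "p \<ge> 3" and "e \<ge> 1" and "CARD('a) = p ^ e" and "n \<ge> 1"
    and "nontrivial_additive_char \<theta>"
    and "basic_roots t n D" and "basic_roots t n D'"
    and "\<phi> \<in> D \<rightarrow>\<^sub>E UNIV - {0}" and "\<phi>' \<in> D' \<rightarrow>\<^sub>E UNIV - {0}"
  shows "class_inner (unip_group t n) (superchar t n \<theta> D \<phi>) (superchar t n \<theta> D' \<phi>') \<noteq> 0
    \<longleftrightarrow> (D, \<phi>) = (D', \<phi>')"
proof
  let ?one = "1\<^sub>m (msize t n) :: 'a mat"
  have sub: "D \<subseteq> roots t n" "D' \<subseteq> roots t n" using assms(7,8) by (auto simp: basic_roots_def)
  have "?one \<in> carrier (unip_group t n)"
    using group.is_monoid[OF group_unip] monoid.one_closed by fastforce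
  then have "class_inner (unip_group t n) (superchar t n \<theta> D \<phi>) (superchar t n \<theta> D \<phi>) \<noteq> 0"
    using superchar_one[OF assms(6) sub(1), of \<phi>] finite_unip[of t n, where 'a = 'a]
    by (intro class_inner_self_nonzero[of _ ?one]) simp_all
  moreover assume "(D, \<phi>) = (D', \<phi>')"
  ultimately show "class_inner (unip_group t n) (superchar t n \<theta> D \<phi>) (superchar t n \<theta> D' \<phi>') \<noteq> 0"
    by simp
next
  have sub: "D \<subseteq> roots t n" "D' \<subseteq> roots t n" using assms(7,8) by (auto simp: basic_roots_def)
  \<comment> \<open>The characteristic divides the odd number \<open>p ^ e\<close>.\<close>
  have 2: "(2::'a) \<noteq> 0"
  proof
    assume "(2::'a) = 0"
    then have "of_nat 2 = (0::'a)" by simp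
    then have "CHAR('a) dvd 2" by (simp only: of_nat_eq_0_iff_char_dvd)
    moreover have "CHAR('a) dvd p ^ e" using CHAR_dvd_CARD[where 'a = 'a] assms(4) by simp
    moreover have "coprime 2 (p ^ e)"
      using assms(1,2) prime_odd_nat[of p] by simp
    ultimately have "CHAR('a) dvd 1" by (meson coprime_common_divisor_nat coprime_def)
    then show False using of_nat_CHAR[where 'a = 'a] by simp
  qed
  assume nz: "class_inner (unip_group t n) (superchar t n \<theta> D \<phi>) (superchar t n \<theta> D' \<phi>') \<noteq> 0"
  show "(D, \<phi>) = (D', \<phi>')"
  proof (rule ccontr)
    assume ne: "(D, \<phi>) \<noteq> (D', \<phi>')"
    obtain K where K: "\<And>g. g \<in> unip t n \<Longrightarrow> superchar t n \<theta> D \<phi> g =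
        K * (\<Sum>f\<in>super_params t n D. \<theta> (super_form t n D \<phi> f (cayley t n g)))"
      using superchar_expansion[OF 2 assms(6) sub(1)] by blast
    obtain K' where K': "\<And>g. g \<in> unip t n \<Longrightarrow> superchar t n \<theta> D' \<phi>' g =
        K' * (\<Sum>f\<in>super_params t n D'. \<theta> (super_form t n D' \<phi>' f (cayley t n g)))"
      using superchar_expansion[OF 2 assms(6) sub(2)] by blast
    have zero: "(\<Sum>a\<in>lie t n. \<theta> (super_form t n D \<phi> f a) * cnj (\<theta> (super_form t n D' \<phi>' f' a))) = 0"
      if f: "f \<in> super_params t n D" "f' \<in> super_params t n D'" for f f'
    proof -
      obtain b where b: "b \<in> lie t n" "super_form t n D \<phi> f b \<noteq> super_form t n D' \<phi>' f' b"
        using super_forms_differ[OF 2 assms(7-10) ne f] by blast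
      show ?thesis
        using super_form_linear[OF sub(1) f(1)] super_form_linear[OF sub(2) f(2)] b
        by (intro sum_lie_additive_char[where L = "super_form t n D \<phi> f" and L' = "super_form t n D' \<phi>' f'",
            OF assms(6) b]) (auto simp: lie_carrier)
    qed
    have "(\<Sum>g\<in>unip t n. superchar t n \<theta> D \<phi> g * cnj (superchar t n \<theta> D' \<phi>' g)) =
        (\<Sum>g\<in>unip t n. (\<lambda>a. \<Sum>f\<in>super_params t n D. \<Sum>f'\<in>super_params t n D'.
          K * cnj K' * (\<theta> (super_form t n D \<phi> f a) * cnj (\<theta> (super_form t n D' \<phi>' f' a)))) (cayley t n g))"
    proof (intro sum.cong refl)
      fix g :: "'a mat" assume g: "g \<in> unip t n"
      define A where "A f = \<theta> (super_form t n D \<phi> f (cayley t n g))" for f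
      define B where "B f = \<theta> (super_form t n D' \<phi>' f (cayley t n g))" for f
      have "superchar t n \<theta> D \<phi> g * cnj (superchar t n \<theta> D' \<phi>' g) =
          K * cnj K' * (sum A (super_params t n D) * (\<Sum>f'\<in>super_params t n D'. cnj (B f')))"
        by (simp add: K[OF g] K'[OF g] A_def B_def mult_ac)
      also have "\<dots> = (\<Sum>f\<in>super_params t n D. \<Sum>f'\<in>super_params t n D'. K * cnj K' * (A f * cnj (B f')))"
        by (subst sum_product) (simp only: sum_distrib_left)
      finally show "superchar t n \<theta> D \<phi> g * cnj (superchar t n \<theta> D' \<phi>' g) =
          (\<lambda>a. \<Sum>f\<in>super_params t n D. \<Sum>f'\<in>super_params t n D'.
            K * cnj K' * (\<theta> (super_form t n D \<phi> f a) * cnj (\<theta> (super_form t n D' \<phi>' f' a)))) (cayley t n g)"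
        by (simp only: A_def B_def)
    qed
    \<comment> \<open>The bijection moves the sum from the group to the linear space, where
      \<open>zero\<close> removes each pair of forms separately.\<close>
    also have "\<dots> = (\<Sum>a\<in>lie t n. \<Sum>f\<in>super_params t n D. \<Sum>f'\<in>super_params t n D'.
          K * cnj K' * (\<theta> (super_form t n D \<phi> f a) * cnj (\<theta> (super_form t n D' \<phi>' f' a))))"
      by (rule sum.reindex_bij_betw[OF bij_betw_cayley[OF 2]])
    also have "\<dots> = (\<Sum>f\<in>super_params t n D. \<Sum>f'\<in>super_params t n D'. \<Sum>a\<in>lie t n.
          K * cnj K' * (\<theta> (super_form t n D \<phi> f a) * cnj (\<theta> (super_form t n D' \<phi>' f' a))))"
      by (subst sum.swap, intro sum.cong refl, rule sum.swap)
    also have "\<dots> = 0" by (simp add: zero flip: sum_distrib_left)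
    finally show False using nz by (simp add: class_inner_def)
  qed
qed

end
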